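(* Let $d\ge2$. Let $(\mathcal{D}_N)$ be a sequence of partitions of $\mathbb{S}^d$ into $N$ equal area subsets $D_{j,N}$, $j=1,\dots,N$, such that $\operatorname{diam}D_{j,N}\le c/N^{1/d}$, where $c$ is a positive constant independent of $j$ and $N$. Let $X_N=\{\mathbf{x}_{1,N},\dots,\mathbf{x}_{N,N}\}$, where $\mathbf{x}_{j,N}$ is chosen randomly from $D_{j,N}$ with respect to uniform measure on $D_{j,N}$ (independently for different $j$). Then, for $d/2<s<d/2+1$, $$\frac{\beta'}{N^{s/d}}\le\sqrt{\mathbb{E}\big[\{\operatorname{wce}(Q[X_N];\mathbb{H}^s(\mathbb{S}^d))\}^2\big]}\le\frac{\beta}{N^{s/d}},$$ where $\beta'>0$ and $\beta>0$ depend on the $\mathbb{H}^s(\mathbb{S}^d)$-norm but are independent of $N$, and $\beta$ also depends on $(\mathcal{D}_N)$.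
   Context: $\mathbb{S}^d$ is the unit sphere in $\mathbb{R}^{d+1}$, $d\ge 2$, and $\sigma_d$ is its normalized surface measure ($\sigma_d(\mathbb{S}^d)=1$). A partition of $\mathbb{S}^d$ into $N$ equal area subsets means measurable sets $D_{1,N},\dots,D_{N,N}$ with $\bigcup_jD_{j,N}=\mathbb{S}^d$, $\sigma_d(D_{j,N}\cap D_{k,N})=0$ for $j\ne k$, and $\sigma_d(D_{j,N})=1/N$. The uniform measure on $D_{j,N}$ is $\mu_{j,N}=\sigma_d|_{D_{j,N}}/\sigma_d(D_{j,N})$; the expectation is with respect to the product measure $\mu_{1,N}\times\cdots\times\mu_{N,N}$. $\operatorname{diam}A=\sup\{|\mathbf{x}-\mathbf{y}|:\mathbf{x},\mathbf{y}\in A\}$ (Euclidean distance). Let $\{Y_{\ell,k}:k=1,\dots,Z(d,\ell)\}$ be an $\mathbb{L}_2(\mathbb{S}^d,\sigma_d)$-orthonormal family of real spherical harmonics of exact degree $\ell$, where $Z(d,\ell)=(2\ell+d-1)\frac{\Gamma(\ell+d-1)}{\Gamma(d)\Gamma(\ell+1)}$, and let $\lambda_\ell=\ell(\ell+d-1)$, $\ell\ge 0$. For $f\in \mathbb{L}_2(\mathbb{S}^d)$ put $\widehat f_{\ell,k}=\int_{\mathbb{S}^d} f\,Y_{\ell,k}\,\mathrm{d}\sigma_d$. For $s>d/2$ the Sobolev space $\mathbb{H}^s(\mathbb{S}^d)$ is the set of $f\in \mathbb{L}_2(\mathbb{S}^d)$ with $\sum_{\ell=0}^\infty\sum_{k=1}^{Z(d,\ell)}(1+\lambda_\ell)^s|\widehat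 f_{\ell,k}|^2<\infty$ (embedded in $C(\mathbb{S}^d)$), with norm $\|f\|_{\mathbb{H}^s}=\big[\sum_{\ell=0}^\infty\sum_{k=1}^{Z(d,\ell)}\frac{1}{a_\ell^{(s)}}|\widehat f_{\ell,k}|^2\big]^{1/2}$, where $(a_\ell^{(s)})_{\ell\ge0}$ is a fixed sequence of positive reals with $a_\ell^{(s)}\asymp(1+\lambda_\ell)^{-s}$. Here $a_n\asymp b_n$ means $c_1a_n\le b_n\le c_2a_n$ for all $n$ with positive constants $c_1,c_2$ independent of $n$. For $X_N=\{\mathbf{x}_1,\dots,\mathbf{x}_N\}\subset\mathbb{S}^d$, let $Q[X_N](f)=\frac1N\sum_{j=1}^Nf(\mathbf{x}_j)$, $I(f)=\int_{\mathbb{S}^d}f\,\mathrm{d}\sigma_d$, and $\operatorname{wce}(Q[X_N];\mathbb{H}^s(\mathbb{S}^d))=\sup\{|Q[X_N](f)-I(f)|:f\in\mathbb{H}^s(\mathbb{S}^d),\ \|f\|_{\mathbb{H}^s}\le1\}$. *)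

theory Defs
  imports "HOL-Analysis.Analysis"
begin

(* The sphere in d + 1 dimensions is sphere 0 1 in a Euclidean space with DIM('a) = d + 1.
   The normalized surface measure of A is the proportion of the unit ball filled by the
   cone {t x | x in A, 0 < t < 1}, i.e. the image of the uniform measure on the ball under
   radial projection sgn x = x / |x|.  The completion admits all sets measurable for the
   surface measure, not only the Borel sets. *)
definition sphere_measure :: "'a::euclidean_space measure" where
  "sphere_measure =
     completion (restrict_space (distr (uniform_measure lborel (ball 0 1)) borel sgn) (sphere 0 1))"

lemma space_sphere_measure [simp]: "space sphere_measure = sphere 0 1"
  by (simp add: sphere_measure_def space_restrict_space)

definition equal_area_partition :: "nat \<Rightarrow> (nat \<Rightarrow> 'a::euclidean_space set) \<Rightarrow> bool" where
  "equal_area_partition N D \<longleftrightarrow>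
     (\<forall>j\<in>{1..N}. D j \<in> sets sphere_measure) \<and>
     (\<Union>j\<in>{1..N}. D j) = sphere 0 1 \<and>
     (\<forall>j\<in>{1..N}. \<forall>k\<in>{1..N}. j \<noteq> k \<longrightarrow> measure sphere_measure (D j \<inter> D k) = 0) \<and>
     (\<forall>j\<in>{1..N}. measure sphere_measure (D j) = 1 / real N)"

(* The joint law of independent points x 1, ..., x N with x j uniform on D j. *)
definition random_points :: "nat \<Rightarrow> (nat \<Rightarrow> 'a::euclidean_space set) \<Rightarrow> (nat \<Rightarrow> 'a) measure" where
  "random_points N D = (\<Pi>\<^sub>M j\<in>{1..N}. uniform_measure sphere_measure (D j))"

(* Only applied to polynomial functions, so the derivatives exist. *)
definition laplacian :: "('a::euclidean_space \<Rightarrow> real) \<Rightarrow> 'a \<Rightarrow> real" where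
  "laplacian p x = (\<Sum>b\<in>Basis. deriv (deriv (\<lambda>t. p (x + t *\<^sub>R b))) 0)"

(* Restrictions to the sphere of harmonic homogeneous polynomials of degree l. *)
definition spherical_harmonic :: "nat \<Rightarrow> ('a::euclidean_space \<Rightarrow> real) \<Rightarrow> bool" where
  "spherical_harmonic l Y \<longleftrightarrow>
     (\<exists>p. real_polynomial_function p \<and>
          (\<forall>t x. p (t *\<^sub>R x) = t ^ l * p x) \<and>
          (\<forall>x. laplacian p x = 0) \<and>
          (\<forall>x\<in>sphere 0 1. Y x = p x))"

definition harm_dim :: "nat \<Rightarrow> nat \<Rightarrow> real" where
  "harm_dim d l = (2 * real l + real d - 1) * Gamma (real l + real d - 1) /
                  (Gamma (real d) * Gamma (real l + 1))"

(* harm_dim is integer-valued for d at least 2, so the floor loses nothing. *)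
definition harm_index :: "nat \<Rightarrow> nat \<Rightarrow> nat set" where
  "harm_index d l = {1..nat \<lfloor>harm_dim d l\<rfloor>}"

definition harmonic_family :: "nat \<Rightarrow> (nat \<Rightarrow> nat \<Rightarrow> 'a::euclidean_space \<Rightarrow> real) \<Rightarrow> bool" where
  "harmonic_family d Y \<longleftrightarrow>
     (\<forall>l. (\<forall>k\<in>harm_index d l. spherical_harmonic l (Y l k)) \<and>
          (\<forall>k\<in>harm_index d l. \<forall>k'\<in>harm_index d l.
             (\<integral>x. Y l k x * Y l k' x \<partial>sphere_measure) = (if k = k' then 1 else 0)))"

definition eigval :: "nat \<Rightarrow> nat \<Rightarrow> real" where
  "eigval d l = real l * (real l + real d - 1)"

definition fourier_coeff ::
    "(nat \<Rightarrow> nat \<Rightarrow> 'a::euclidean_space \<Rightarrow> real) \<Rightarrow> ('a \<Rightarrow> real) \<Rightarrow> nat \<Rightarrow> nat \<Rightarrow> real" where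
  "fourier_coeff Y f l k = (\<integral>x. f x * Y l k x \<partial>sphere_measure)"

(* Since s > d/2 embeds the Sobolev space into the continuous functions, each class is given by
   its continuous representative, which is the one that point evaluation refers to.
   Values off the sphere are irrelevant. *)
definition sobolev_space ::
    "nat \<Rightarrow> real \<Rightarrow> (nat \<Rightarrow> nat \<Rightarrow> 'a::euclidean_space \<Rightarrow> real) \<Rightarrow> ('a \<Rightarrow> real) set" where
  "sobolev_space d s Y =
     {f. continuous_on (sphere 0 1) f \<and>
         integrable sphere_measure (\<lambda>x. (f x)\<^sup>2) \<and>
         summable (\<lambda>l. \<Sum>k\<in>harm_index d l. (1 + eigval d l) powr s * \<bar>fourier_coeff Y f l k\<bar>\<^sup>2)}"

definition sobolev_norm ::
    "nat \<Rightarrow> (nat \<Rightarrow> real) \<Rightarrow> (nat \<Rightarrow> nat \<Rightarrow> 'a::euclidean_space \<Rightarrow> real) \<Rightarrow> ('a \<Rightarrow> real) \<Rightarrow> real" where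
  "sobolev_norm d a Y f =
     sqrt (\<Sum>l. \<Sum>k\<in>harm_index d l. (1 / a l) * \<bar>fourier_coeff Y f l k\<bar>\<^sup>2)"

(* The relation between the sequences is required for all n, not just eventually. *)
definition comparable :: "(nat \<Rightarrow> real) \<Rightarrow> (nat \<Rightarrow> real) \<Rightarrow> bool" where
  "comparable a b \<longleftrightarrow> (\<exists>c1>0. \<exists>c2>0. \<forall>n. c1 * a n \<le> b n \<and> b n \<le> c2 * a n)"

definition qmc :: "nat \<Rightarrow> (nat \<Rightarrow> 'a) \<Rightarrow> ('a \<Rightarrow> real) \<Rightarrow> real" where
  "qmc N x f = 1 / real N * (\<Sum>j=1..N. f (x j))"

(* For s > d/2 and a comparable to (1 + eigval d l) powr (-s) the set is bounded, so the
   supremum in the reals is the actual one. *)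
definition wce ::
    "nat \<Rightarrow> real \<Rightarrow> (nat \<Rightarrow> real) \<Rightarrow> (nat \<Rightarrow> nat \<Rightarrow> 'a::euclidean_space \<Rightarrow> real) \<Rightarrow>
     nat \<Rightarrow> (nat \<Rightarrow> 'a) \<Rightarrow> real" where
  "wce d s a Y N x =
     Sup {\<bar>qmc N x f - (\<integral>y. f y \<partial>sphere_measure)\<bar> |f.
            f \<in> sobolev_space d s Y \<and> sobolev_norm d a Y f \<le> 1}"

end

theory Submission
  imports Defs "HOL-Probability.Infinite_Product_Measure"
begin

text \<open>
  The proof rests on an exact formula for the worst-case error. A function in the Sobolev space is
  the pointwise sum of its expansion in the Y l k, so the quadrature error is a linear functional
  in its coefficients, and Cauchy-Schwarz gives (wce_squared)

    wce^2 = sum over l \<ge> 1 of a l * (sum over k of (mean of Y l k over the nodes)^2).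

  Upper bound. The cells have equal area, so the expected mean of Y l k over the nodes is its
  integral, which is 0 for l \<ge> 1. By independence the second moment is 1/N^2 times the sum over the
  cells of the variance of Y l k on the cell. Summed over k, the variance on one cell is at most Z l,
  the number of harmonics of degree l (addition_theorem_diagonal), and at most
  Z l * l * (2 l + d - 1) * diam^2, because the squared gradients of these harmonics add up to
  Z l * l * (2 l + d - 1) on the sphere (sum_gradient_squares). With a l * Z l of order l^(d-1-2s) and
  diam at most of order 1/M for M = N^(1/d), the expectation of wce^2 is at most a constant times

    1/N * (sum over l of l^(d-1-2s) * min 1 ((l/M)^2)).

  The terms with l \<le> M add up to order M^(d-2s) because s < d/2 + 1, the others because s > d/2, and
  M^(d-2s)/N = N^(-2s/d).

  Lower bound. It holds for every choice of nodes. Let G be the reproducing kernel of the harmonics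
  of degree at most L, and let D be the number of these harmonics, which is the value of G on the
  diagonal. The square of G is a non-negative polynomial of degree at most 2 L. Its mean over all pairs
  of nodes is at least D^2/N, the contribution of the diagonal, and by Bessel's inequality at most D times
  the sum over l \<le> 2 L of the squared means of the Y l k (energy_sum_ge). If D \<ge> 2 N, this sum is at
  least 2, and at least 1 without its term of degree 0. Since L of order M suffices for D \<ge> 2 N
  and a l is at least of order L^(-2s) for l \<le> 2 L, this gives wce^2 \<ge> const * N^(-2s/d).

  Three facts on harmonic polynomials carry these arguments. A family of the prescribed size spans
  all harmonics of its degree, because a harmonic form is determined by its value and its normal
  derivative on a hyperplane, and the dimensions of the spaces of these data add up to harm_dim
  (harmonic_poly_linearly_dependent, harmonic_expansion). Harmonics of different degrees are
  orthogonal, by an integration by parts that follows from the rotation invariance of the measure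
  (harmonic_poly_orthogonal). Every polynomial agrees on the sphere with a sum of harmonics
  (hom_poly_harm_decomp), so that completeness follows from the Stone-Weierstrass theorem.
\<close>

section \<open>Partial derivatives and the Laplacian of polynomial functions\<close>

lemmas rpf_linear = real_polynomial_function.intros(1)
  and rpf_const = real_polynomial_function.intros(2)
  and rpf_add = real_polynomial_function.intros(3)
  and rpf_mult = real_polynomial_function.intros(4)

text \<open>The directional derivative in the form that occurs inside the definition of the Laplacian: for
  polynomials, laplacian_eq turns the iterated deriv of that definition into an iterated pd.\<close>
definition pd :: "'a::euclidean_space \<Rightarrow> ('a \<Rightarrow> real) \<Rightarrow> 'a \<Rightarrow> real" where
  "pd b p x = deriv (\<lambda>t. p (x + t *\<^sub>R b)) 0"

lemma pd_has_real_derivative: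
  assumes "real_polynomial_function p"
  shows "((\<lambda>t. p (x + t *\<^sub>R b)) has_real_derivative pd b p (x + t *\<^sub>R b)) (at t)"
proof -
  have *: "\<exists>D. ((\<lambda>t. p (y + t *\<^sub>R b)) has_real_derivative D) (at t)" for y :: 'a and t
  proof -
    have "p differentiable at (y + t *\<^sub>R b)"
      using assms differentiable_at_polynomial_function real_polynomial_function_eq by blast
    moreover have "(\<lambda>t. y + t *\<^sub>R b) differentiable at t"
      by (intro derivative_intros)
    ultimately have "(p \<circ> (\<lambda>t. y + t *\<^sub>R b)) differentiable at t"
      by (intro differentiable_chain_at) auto
    then show ?thesis
      by (simp add: o_def real_differentiable_def)
  qed
  from *[of "x + t *\<^sub>R b" 0]
  have "((\<lambda>u. p (x + t *\<^sub>R b + u *\<^sub>R b)) has_real_derivative pd b p (x + t *\<^sub>R b)) (at 0)"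
    unfolding pd_def by (metis DERIV_imp_deriv)
  then have "((\<lambda>u. p (x + (u + t) *\<^sub>R b)) has_real_derivative pd b p (x + t *\<^sub>R b)) (at 0)"
    by (simp add: algebra_simps)
  then show ?thesis
    using DERIV_shift[of "\<lambda>t. p (x + t *\<^sub>R b)" "pd b p (x + t *\<^sub>R b)" 0 t] by simp
qed

lemma pdI: "((\<lambda>t. p (x + t *\<^sub>R b)) has_real_derivative D) (at 0) \<Longrightarrow> pd b p x = D"
  unfolding pd_def by (rule DERIV_imp_deriv)

lemma pd_has_real_derivative_0:
  assumes "real_polynomial_function p"
  shows "((\<lambda>t. p (x + t *\<^sub>R b)) has_real_derivative pd b p x) (at 0)"
  using pd_has_real_derivative[OF assms, of x b 0] by simp

lemma pd_const [simp]: "pd b (\<lambda>x. c) = (\<lambda>x. 0)"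
  by (rule ext, rule pdI) simp

lemma pd_linear:
  assumes "linear f"
  shows "pd b f = (\<lambda>x. f b)"
proof (rule ext, rule pdI)
  fix x
  have "(\<lambda>t. f (x + t *\<^sub>R b)) = (\<lambda>t. f x + t * f b)"
    using assms by (auto simp: linear_add linear_scale)
  then show "((\<lambda>t. f (x + t *\<^sub>R b)) has_real_derivative f b) (at 0)"
    by (auto intro!: derivative_eq_intros)
qed

lemma pd_inner [simp]: "pd b (\<lambda>x. x \<bullet> c) = (\<lambda>x. b \<bullet> c)"
  by (rule pd_linear) (auto intro!: linearI simp: inner_add_left)

lemma pd_add:
  assumes "real_polynomial_function f" "real_polynomial_function g"
  shows "pd b (\<lambda>x. f x + g x) = (\<lambda>x. pd b f x + pd b g x)"
  by (rule ext, rule pdI) (intro DERIV_add pd_has_real_derivative_0 assms)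

lemma pd_mult:
  assumes "real_polynomial_function f" "real_polynomial_function g"
  shows "pd b (\<lambda>x. f x * g x) = (\<lambda>x. pd b f x * g x + f x * pd b g x)"
proof (rule ext, rule pdI)
  fix x
  show "((\<lambda>t. f (x + t *\<^sub>R b) * g (x + t *\<^sub>R b)) has_real_derivative
         pd b f x * g x + f x * pd b g x) (at 0)"
    using DERIV_mult[OF pd_has_real_derivative_0[OF assms(1), of x b] pd_has_real_derivative_0[OF assms(2), of x b]]
    by (simp add: mult.commute add.commute)
qed

lemma pd_cmult:
  assumes "real_polynomial_function f"
  shows "pd b (\<lambda>x. c * f x) = (\<lambda>x. c * pd b f x)"
  using pd_mult[OF rpf_const assms, of b c] by simp

lemma pd_sum:
  assumes "\<And>i. i \<in> I \<Longrightarrow> real_polynomial_function (f i)"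
  shows "pd b (\<lambda>x. \<Sum>i\<in>I. f i x) = (\<lambda>x. \<Sum>i\<in>I. pd b (f i) x)"
  by (rule ext, rule pdI) (intro DERIV_sum pd_has_real_derivative_0 assms)

lemma rpf_pd:
  assumes "real_polynomial_function p"
  shows "real_polynomial_function (pd b p)"
  using assms
proof induction
  case (linear f)
  then show ?case
    by (simp add: pd_linear bounded_linear.linear rpf_const)
next
  case (const c)
  then show ?case by (simp add: rpf_const)
next
  case (add f g)
  then show ?case by (simp add: pd_add rpf_add)
next
  case (mult f g)
  then show ?case
    by (simp add: pd_mult rpf_add rpf_mult)
qed

lemma rpf_sum:
  "\<lbrakk>finite I; \<And>i. i \<in> I \<Longrightarrow> real_polynomial_function (f i)\<rbrakk>
    \<Longrightarrow> real_polynomial_function (\<lambda>x. \<Sum>i\<in>I. f i x)"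
  by (rule real_polynomial_function_sum)

lemma rpf_inner: "real_polynomial_function (\<lambda>x::'a::euclidean_space. x \<bullet> c)"
  by (intro rpf_linear bounded_linear_inner_left)

lemma laplacian_eq:
  assumes "real_polynomial_function p"
  shows "laplacian p = (\<lambda>x. \<Sum>b\<in>Basis. pd b (pd b p) x)"
proof -
  have "deriv (\<lambda>t. p (x + t *\<^sub>R b)) = (\<lambda>t. pd b p (x + t *\<^sub>R b))" for x b
    using pd_has_real_derivative[OF assms] by (auto intro!: DERIV_imp_deriv)
  then show ?thesis
    unfolding laplacian_def by (simp add: pd_def[of _ "pd _ p"])
qed

lemma rpf_laplacian: "real_polynomial_function p \<Longrightarrow> real_polynomial_function (laplacian p)"
  by (simp add: laplacian_eq rpf_sum rpf_pd)

lemma laplacian_add: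
  assumes "real_polynomial_function f" "real_polynomial_function g"
  shows "laplacian (\<lambda>x. f x + g x) = (\<lambda>x. laplacian f x + laplacian g x)"
  using assms
  by (simp add: laplacian_eq rpf_add pd_add rpf_pd sum.distrib)

lemma laplacian_cmult:
  assumes "real_polynomial_function f"
  shows "laplacian (\<lambda>x. c * f x) = (\<lambda>x. c * laplacian f x)"
  using assms
  by (simp add: laplacian_eq rpf_mult rpf_const
      pd_cmult rpf_pd sum_distrib_left)

lemma laplacian_sum:
  assumes "finite I" "\<And>i. i \<in> I \<Longrightarrow> real_polynomial_function (f i)"
  shows "laplacian (\<lambda>x. \<Sum>i\<in>I. f i x) = (\<lambda>x. \<Sum>i\<in>I. laplacian (f i) x)"
  using assms
proof (induction I rule: finite_induct)
  case empty
  then show ?case by (simp add: laplacian_eq rpf_const)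
next
  case (insert i I)
  then show ?case
    by (simp add: laplacian_add rpf_sum)
qed

lemma laplacian_mult:
  assumes "real_polynomial_function f" "real_polynomial_function g"
  shows "laplacian (\<lambda>x. f x * g x) =
    (\<lambda>x. laplacian f x * g x + 2 * (\<Sum>b\<in>Basis. pd b f x * pd b g x) + f x * laplacian g x)"
  using assms
  by (auto simp: laplacian_eq rpf_mult rpf_add pd_mult
      pd_add rpf_pd sum.distrib sum_distrib_left sum_distrib_right algebra_simps intro!: ext)

section \<open>Homogeneous polynomials\<close>

text \<open>Homogeneous polynomials of degree l in the coordinates of B, as an inductive closure, so that
  statements about them follow by induction without coefficients or multi-indices. The clause zero
  makes every degree a vector space. The parameter B is there for the dimension count, which adds one
  coordinate at a time.\<close>
inductive hom_poly :: "'a::euclidean_space set \<Rightarrow> nat \<Rightarrow> ('a \<Rightarrow> real) \<Rightarrow> bool" for B where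
  const: "hom_poly B 0 (\<lambda>x. c)"
| zero: "hom_poly B l (\<lambda>x. 0)"
| add: "hom_poly B l f \<Longrightarrow> hom_poly B l g \<Longrightarrow> hom_poly B l (\<lambda>x. f x + g x)"
| coord: "hom_poly B l f \<Longrightarrow> b \<in> B \<Longrightarrow> hom_poly B (Suc l) (\<lambda>x. (x \<bullet> b) * f x)"

lemma hom_poly_rpf: "hom_poly B l f \<Longrightarrow> real_polynomial_function f"
  by (induction rule: hom_poly.induct)
    (auto intro: rpf_const rpf_add
      rpf_mult rpf_inner)

lemma hom_poly_scale: "hom_poly B l f \<Longrightarrow> f (t *\<^sub>R x) = t ^ l * f x"
  by (induction rule: hom_poly.induct) (auto simp: algebra_simps)

lemma hom_poly_cmult: "hom_poly B l f \<Longrightarrow> hom_poly B l (\<lambda>x. c * f x)"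
proof (induction rule: hom_poly.induct)
  case (const k)
  show ?case by (rule hom_poly.const)
next
  case (zero l)
  show ?case using hom_poly.zero[of B l] by simp
next
  case (add l f g)
  then show ?case using hom_poly.add[OF add.IH] by (simp add: algebra_simps)
next
  case (coord l f b)
  then show ?case using hom_poly.coord[OF coord.IH coord.hyps(2)] by (simp add: algebra_simps)
qed

lemma hom_poly_diff:
  assumes "hom_poly B l f" "hom_poly B l g"
  shows "hom_poly B l (\<lambda>x. f x - g x)"
  using hom_poly.add[OF assms(1) hom_poly_cmult[OF assms(2), of "-1"]] by simp

lemma hom_poly_sum:
  "(\<And>i. i \<in> I \<Longrightarrow> hom_poly B l (f i)) \<Longrightarrow> hom_poly B l (\<lambda>x. \<Sum>i\<in>I. f i x)"
  by (induction I rule: infinite_finite_induct) (auto intro: hom_poly.zero hom_poly.add)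

lemma hom_poly_0_const: "hom_poly B 0 f \<Longrightarrow> \<exists>c. f = (\<lambda>x. c)"
  by (induction "0::nat" f rule: hom_poly.induct) auto

lemma hom_poly_mult:
  assumes "hom_poly B l f" "hom_poly B m g"
  shows "hom_poly B (l + m) (\<lambda>x. f x * g x)"
  using assms(1)
proof (induction rule: hom_poly.induct)
  case (const c)
  then show ?case using hom_poly_cmult[OF assms(2)] by simp
next
  case (zero l)
  then show ?case using hom_poly.zero by simp
next
  case (add l f f')
  then show ?case using hom_poly.add[OF add.IH] by (simp add: algebra_simps)
next
  case (coord l f b)
  then show ?case using hom_poly.coord[OF coord.IH coord.hyps(2)] by (simp add: algebra_simps)
qed

lemma hom_poly_pd: "hom_poly B l f \<Longrightarrow> hom_poly B (l - 1) (pd b f)"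
proof (induction rule: hom_poly.induct)
  case (const c)
  then show ?case by (simp add: hom_poly.zero)
next
  case (zero l)
  then show ?case by (simp add: hom_poly.zero)
next
  case (add l f g)
  then show ?case by (simp add: pd_add hom_poly_rpf hom_poly.add)
next
  case (coord l f c)
  have eq: "pd b (\<lambda>x. (x \<bullet> c) * f x) = (\<lambda>x. (b \<bullet> c) * f x + (x \<bullet> c) * pd b f x)"
    using coord.hyps by (simp add: pd_mult rpf_inner hom_poly_rpf)
  have "hom_poly B l (\<lambda>x. (x \<bullet> c) * pd b f x)"
  proof (cases l)
    case 0
    then have "pd b f = (\<lambda>x. 0)"
      using coord.hyps hom_poly_0_const by fastforce
    then show ?thesis by (simp add: hom_poly.zero)
  next
    case (Suc k)
    then show ?thesis
      using hom_poly.coord[OF coord.IH coord.hyps(2)] by simp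
  qed
  then show ?case
    using eq hom_poly.add[OF hom_poly_cmult[OF coord.hyps(1)]] by simp
qed

lemma hom_poly_laplacian:
  assumes "hom_poly B l f"
  shows "hom_poly B (l - 2) (laplacian f)"
proof -
  have "hom_poly B (l - 1 - 1) (\<lambda>x. \<Sum>b\<in>Basis. pd b (pd b f) x)"
    by (intro hom_poly_sum hom_poly_pd assms)
  moreover have "l - 1 - 1 = l - 2" by simp
  ultimately show ?thesis
    by (simp add: laplacian_eq[OF hom_poly_rpf[OF assms]])
qed

lemma laplacian_deg_lt_2:
  assumes "hom_poly B l f" "l < 2"
  shows "laplacian f = (\<lambda>x. 0)"
proof -
  have "pd b (pd c f) = (\<lambda>x. 0)" for b c
  proof -
    have "hom_poly B 0 (pd c f)"
      using hom_poly_pd[OF assms(1), of c] assms(2) by (cases l) auto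
    then show ?thesis using hom_poly_0_const by fastforce
  qed
  then show ?thesis by (simp add: laplacian_eq[OF hom_poly_rpf[OF assms(1)]])
qed

lemma euler_hom_poly:
  assumes "hom_poly B l f"
  shows "(\<Sum>b\<in>Basis. (x \<bullet> b) * pd b f x) = real l * f x"
  using assms
proof (induction rule: hom_poly.induct)
  case (add l f g)
  then show ?case
    by (simp add: pd_add hom_poly_rpf algebra_simps sum.distrib)
next
  case (coord l f c)
  have "(\<Sum>b\<in>Basis. (x \<bullet> b) * pd b (\<lambda>x. (x \<bullet> c) * f x) x)
      = (\<Sum>b\<in>Basis. (x \<bullet> b) * (b \<bullet> c)) * f x + (x \<bullet> c) * (\<Sum>b\<in>Basis. (x \<bullet> b) * pd b f x)"
    using coord.hyps
    by (simp add: pd_mult rpf_inner hom_poly_rpf algebra_simps sum.distrib sum_distrib_left)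
  also have "(\<Sum>b\<in>Basis. (x \<bullet> b) * (b \<bullet> c)) = x \<bullet> c"
    unfolding euclidean_inner[of x c] by (simp only: inner_commute)
  finally show ?case using coord.IH by (simp add: algebra_simps)
qed auto

lemma hom_poly_linear:
  assumes "linear f"
  shows "hom_poly Basis 1 f"
proof -
  have "f = (\<lambda>x. \<Sum>b\<in>Basis. (x \<bullet> b) * f b)"
  proof
    fix x
    have "f x = f (\<Sum>b\<in>Basis. (x \<bullet> b) *\<^sub>R b)" by (simp add: euclidean_representation)
    then show "f x = (\<Sum>b\<in>Basis. (x \<bullet> b) * f b)"
      using assms by (simp add: linear_sum linear_scale)
  qed
  moreover have "hom_poly Basis 1 (\<lambda>x. \<Sum>b\<in>Basis. (x \<bullet> b) * f b)"
    using hom_poly.coord[OF hom_poly.const] by (intro hom_poly_sum) auto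
  ultimately show ?thesis by simp
qed

text \<open>The vanishing of g beyond L lets two decompositions be padded to a common length.\<close>
lemma rpf_hom_decomp:
  assumes "real_polynomial_function p"
  shows "\<exists>L g. (\<forall>l. hom_poly Basis l (g l)) \<and> (\<forall>l>L. g l = (\<lambda>x. 0)) \<and> p = (\<lambda>x. \<Sum>l\<le>L. g l x)"
  using assms
proof induction
  case (linear f)
  let ?g = "\<lambda>l. if l = 1 then f else (\<lambda>x. 0)"
  have "f = (\<lambda>x. \<Sum>l\<le>Suc 0. ?g l x)" by (rule ext) simp
  moreover have "\<forall>l. hom_poly Basis l (?g l)"
    using hom_poly_linear[OF bounded_linear.linear[OF linear]] hom_poly.zero by auto
  ultimately show ?case by (intro exI[of _ "Suc 0"] exI[of _ ?g]) auto
next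
  case (const c)
  let ?g = "\<lambda>l. if l = 0 then (\<lambda>x. c) else (\<lambda>x. 0)"
  have "\<forall>l. hom_poly Basis l (?g l)"
    using hom_poly.const hom_poly.zero by auto
  then show ?case by (intro exI[of _ 0] exI[of _ ?g]) auto
next
  case (add p q)
  then obtain L g M h where
    g: "\<And>l. hom_poly Basis l (g l)" "\<And>l. l > L \<Longrightarrow> g l = (\<lambda>x. 0)" "p = (\<lambda>x. \<Sum>l\<le>L. g l x)" and
    h: "\<And>l. hom_poly Basis l (h l)" "\<And>l. l > M \<Longrightarrow> h l = (\<lambda>x. 0)" "q = (\<lambda>x. \<Sum>l\<le>M. h l x)"
    by blast
  have 1: "(\<Sum>l\<le>L. g l x) = (\<Sum>l\<le>max L M. g l x)" for x
    by (rule sum.mono_neutral_left) (use g in auto)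
  have 2: "(\<Sum>l\<le>M. h l x) = (\<Sum>l\<le>max L M. h l x)" for x
    by (rule sum.mono_neutral_left) (use h in auto)
  show ?case
    using g h 1 2
    by (intro exI[of _ "max L M"] exI[of _ "\<lambda>l x. g l x + h l x"])
       (auto simp: sum.distrib intro: hom_poly.add)
next
  case (mult p q)
  then obtain L g M h where
    g: "\<And>l. hom_poly Basis l (g l)" "p = (\<lambda>x. \<Sum>l\<le>L. g l x)" and
    h: "\<And>l. hom_poly Basis l (h l)" "q = (\<lambda>x. \<Sum>l\<le>M. h l x)"
    by blast
  define S where "S = {..L} \<times> {..M}"
  let ?k = "\<lambda>l x. \<Sum>y\<in>{y\<in>S. fst y + snd y = l}. g (fst y) x * h (snd y) x"
  have "hom_poly Basis l (?k l)" for l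
    using g h by (intro hom_poly_sum) (auto intro: hom_poly_mult)
  moreover have "?k l = (\<lambda>x. 0)" if "l > L + M" for l
  proof -
    have "{y\<in>S. fst y + snd y = l} = {}" using that by (auto simp: S_def)
    then show ?thesis by (simp only: sum.empty)
  qed
  moreover have "p x * q x = (\<Sum>l\<le>L+M. ?k l x)" for x
  proof -
    have "p x * q x = (\<Sum>y\<in>S. g (fst y) x * h (snd y) x)"
      by (simp add: g h S_def sum_product sum.cartesian_product case_prod_unfold)
    also have "\<dots> = (\<Sum>l\<le>L+M. ?k l x)"
      by (rule sum.group[symmetric]) (auto simp: S_def)
    finally show ?thesis .
  qed
  ultimately show ?case
    by (intro exI[of _ "L+M"] exI[of _ ?k]) auto
qed

text \<open>Comparing the coefficients of t in p (t x) = t^l p x shows that the components of p of degree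
  other than l vanish.\<close>
lemma hom_polyI:
  assumes "real_polynomial_function p" "\<And>t x. p (t *\<^sub>R x) = t ^ l * p x"
  shows "hom_poly Basis l p"
proof -
  obtain L g where g: "\<And>l. hom_poly Basis l (g l)" "\<And>l. l > L \<Longrightarrow> g l = (\<lambda>x. 0)"
      "p = (\<lambda>x. \<Sum>l\<le>L. g l x)"
    using rpf_hom_decomp[OF assms(1)] by blast
  have "p x = g l x" for x
  proof -
    define n where "n = max L l"
    have "(\<Sum>i\<le>n. g i x * t ^ i) = (\<Sum>i\<le>n. (if i = l then p x else 0) * t ^ i)" for t
    proof -
      have "(\<Sum>i\<le>n. (if i = l then p x else 0) * t ^ i) = (\<Sum>i\<le>n. if i = l then p x * t ^ i else 0)"
        by (rule sum.cong) auto
      also have "\<dots> = p (t *\<^sub>R x)" using assms(2) by (simp add: n_def mult.commute)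
      also have "\<dots> = (\<Sum>i\<le>L. g i x * t ^ i)"
        using hom_poly_scale[OF g(1)] by (simp add: g(3) mult.commute)
      also have "\<dots> = (\<Sum>i\<le>n. g i x * t ^ i)"
        by (rule sum.mono_neutral_left) (use g in \<open>auto simp: n_def\<close>)
      finally show ?thesis by simp
    qed
    then have "\<forall>i\<le>n. g i x = (if i = l then p x else 0)"
      by (subst polyfun_eq_coeffs[symmetric]) blast
    then show ?thesis by (simp add: n_def)
  qed
  then show ?thesis using g(1)[of l] by (metis ext)
qed

section \<open>Harmonic polynomials\<close>

definition harmonic_poly :: "nat \<Rightarrow> ('a::euclidean_space \<Rightarrow> real) \<Rightarrow> bool" where
  "harmonic_poly l p \<longleftrightarrow> hom_poly Basis l p \<and> laplacian p = (\<lambda>x. 0)"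

lemma spherical_harmonic_extends:
  "spherical_harmonic l Y \<Longrightarrow> \<exists>p. harmonic_poly l p \<and> (\<forall>x\<in>sphere 0 1. Y x = p x)"
  unfolding spherical_harmonic_def harmonic_poly_def by (metis ext hom_polyI)

lemma harmonic_poly_rpf: "harmonic_poly l p \<Longrightarrow> real_polynomial_function p"
  using hom_poly_rpf unfolding harmonic_poly_def by blast

lemma harmonic_poly_cmult: "harmonic_poly l p \<Longrightarrow> harmonic_poly l (\<lambda>x. c * p x)"
  unfolding harmonic_poly_def using laplacian_cmult[OF hom_poly_rpf, of Basis l p c] hom_poly_cmult by auto

lemma harmonic_poly_add: "harmonic_poly l p \<Longrightarrow> harmonic_poly l q \<Longrightarrow> harmonic_poly l (\<lambda>x. p x + q x)"
  unfolding harmonic_poly_def using laplacian_add[OF hom_poly_rpf hom_poly_rpf, of Basis l p Basis l q]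
  by (auto intro: hom_poly.add)

lemma harmonic_poly_zero: "harmonic_poly l (\<lambda>x. 0)"
  unfolding harmonic_poly_def by (simp add: hom_poly.zero laplacian_eq rpf_const)

lemma harmonic_poly_const: "harmonic_poly 0 (\<lambda>x. c)"
  unfolding harmonic_poly_def by (simp add: hom_poly.const laplacian_eq rpf_const)

lemma harmonic_poly_sum: "(\<And>i. i \<in> I \<Longrightarrow> harmonic_poly l (f i)) \<Longrightarrow> harmonic_poly l (\<lambda>x. \<Sum>i\<in>I. f i x)"
  by (induction I rule: infinite_finite_induct) (auto intro: harmonic_poly_zero harmonic_poly_add)

subsection \<open>Decomposition of polynomials into harmonic ones\<close>

lemma hom_poly_inner_self: "hom_poly Basis 2 (\<lambda>x. x \<bullet> x)"
proof -
  have "hom_poly Basis (Suc (Suc 0)) (\<lambda>x::'a. \<Sum>b\<in>Basis. (x \<bullet> b) * ((x \<bullet> b) * 1))"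
    by (intro hom_poly_sum hom_poly.coord hom_poly.const) auto
  then show ?thesis
    by (simp add: euclidean_inner[of x x for x] numeral_2_eq_2)
qed

lemma hom_poly_inner_self_power: "hom_poly Basis (2 * j) (\<lambda>x. (x \<bullet> x) ^ j)"
proof (induction j)
  case 0
  then show ?case using hom_poly.const[of Basis 1] by simp
next
  case (Suc j)
  then show ?case using hom_poly_mult[OF hom_poly_inner_self Suc] by simp
qed

lemma pd_inner_self: "b \<in> Basis \<Longrightarrow> pd b (\<lambda>x. x \<bullet> x) = (\<lambda>x. 2 * (x \<bullet> b))"
proof (rule ext, rule pdI)
  fix x assume "b \<in> Basis"
  then have "(\<lambda>t. (x + t *\<^sub>R b) \<bullet> (x + t *\<^sub>R b)) = (\<lambda>t. x \<bullet> x + 2 * t * (x \<bullet> b) + t * t)"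
    by (auto simp: inner_add_left inner_add_right inner_commute algebra_simps)
  then show "((\<lambda>t. (x + t *\<^sub>R b) \<bullet> (x + t *\<^sub>R b)) has_real_derivative 2 * (x \<bullet> b)) (at 0)"
    by (auto intro!: derivative_eq_intros)
qed

lemma laplacian_inner_self: "laplacian (\<lambda>x::'a::euclidean_space. x \<bullet> x) = (\<lambda>x. 2 * real DIM('a))"
  unfolding laplacian_eq[OF hom_poly_rpf[OF hom_poly_inner_self]]
  by (rule ext) (simp add: pd_inner_self pd_cmult rpf_inner)

lemma laplacian_inner_self_mult:
  fixes g :: "'a::euclidean_space \<Rightarrow> real"
  assumes "hom_poly Basis m g"
  shows "laplacian (\<lambda>x. (x \<bullet> x) * g x)
    = (\<lambda>x. (2 * real DIM('a) + 4 * real m) * g x + (x \<bullet> x) * laplacian g x)"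
proof
  fix x
  have "(\<Sum>b\<in>Basis. pd b (\<lambda>x. x \<bullet> x) x * pd b g x) = (\<Sum>b\<in>Basis. 2 * ((x \<bullet> b) * pd b g x))"
    by (rule sum.cong) (auto simp: pd_inner_self)
  also have "\<dots> = 2 * (real m * g x)"
    using euler_hom_poly[OF assms] by (simp add: sum_distrib_left[symmetric])
  finally show "laplacian (\<lambda>x. (x \<bullet> x) * g x) x
    = (2 * real DIM('a) + 4 * real m) * g x + (x \<bullet> x) * laplacian g x"
    unfolding laplacian_mult[OF hom_poly_rpf[OF hom_poly_inner_self] hom_poly_rpf[OF assms]]
      laplacian_inner_self
    by (simp only: algebra_simps)
qed

text \<open>On |x|^(2j) h with h harmonic the Laplacian only lowers the power of |x|^2. The factor is
  positive for j > 0, which makes the Laplacian invertible on such terms; for constant h the formula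
  also evaluates the sum of the squared gradients in sum_gradient_squares.\<close>
lemma laplacian_inner_self_power_mult:
  fixes h :: "'a::euclidean_space \<Rightarrow> real"
  assumes "harmonic_poly m h"
  shows "laplacian (\<lambda>x. (x \<bullet> x) ^ j * h x)
    = (\<lambda>x. 2 * real j * (real DIM('a) + 2 * real m + 2 * real j - 2) * ((x \<bullet> x) ^ (j - 1) * h x))"
proof (induction j)
  case 0
  then show ?case using assms by (simp add: harmonic_poly_def)
next
  case (Suc j)
  have h: "hom_poly Basis (2 * j + m) (\<lambda>x. (x \<bullet> x) ^ j * h x)"
    using assms by (intro hom_poly_mult hom_poly_inner_self_power) (auto simp: harmonic_poly_def)
  have "laplacian (\<lambda>x. (x \<bullet> x) ^ Suc j * h x) x
      = 2 * real (Suc j) * (real DIM('a) + 2 * real m + 2 * real (Suc j) - 2)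
          * ((x \<bullet> x) ^ (Suc j - 1) * h x)" for x
    unfolding power_Suc mult.assoc[of "x \<bullet> x" for x :: 'a] laplacian_inner_self_mult[OF h] Suc.IH
    by (cases j) (simp_all add: field_simps)
  then show ?case by (rule ext)
qed

text \<open>The span of the |x|^(2j) h with h harmonic and total degree l. On the unit sphere the powers of
  |x| disappear and a sum of spherical harmonics remains.\<close>
inductive harm_decomp :: "nat \<Rightarrow> ('a::euclidean_space \<Rightarrow> real) \<Rightarrow> bool" where
  harmonic_poly: "harmonic_poly m h \<Longrightarrow> harm_decomp (m + 2 * j) (\<lambda>x. (x \<bullet> x) ^ j * h x)"
| add: "harm_decomp l p \<Longrightarrow> harm_decomp l q \<Longrightarrow> harm_decomp l (\<lambda>x. p x + q x)"

lemma harm_decomp_hom_poly: "harm_decomp l p \<Longrightarrow> hom_poly Basis l p"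
proof (induction rule: harm_decomp.induct)
  case (harmonic_poly m h j)
  then show ?case
    using hom_poly_mult[OF hom_poly_inner_self_power, of m h j] by (simp add: harmonic_poly_def add.commute)
qed (rule hom_poly.add)

text \<open>The Laplacian maps |x|^(2j+2) h to a non-zero multiple of |x|^(2j) h.\<close>
lemma harm_decomp_laplacian_solvable:
  "harm_decomp l p \<Longrightarrow> \<exists>u. harm_decomp (l + 2) u \<and> laplacian u = p"
proof (induction rule: harm_decomp.induct)
  case (harmonic_poly m h j)
  define c where "c = 2 * real (Suc j) * (real DIM('a) + 2 * real m + 2 * real (Suc j) - 2)"
  have "c \<noteq> 0" unfolding c_def by (simp add: add_nonneg_eq_0_iff)
  let ?h = "\<lambda>x. (1 / c) * h x"
  have h: "harmonic_poly m ?h" by (rule harmonic_poly_cmult[OF harmonic_poly])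
  have "laplacian (\<lambda>x. (x \<bullet> x) ^ Suc j * ?h x) = (\<lambda>x. (x \<bullet> x) ^ j * h x)"
    unfolding laplacian_inner_self_power_mult[OF h] c_def[symmetric] using \<open>c \<noteq> 0\<close> by auto
  moreover have "harm_decomp (m + 2 * j + 2) (\<lambda>x. (x \<bullet> x) ^ Suc j * ?h x)"
    using harm_decomp.harmonic_poly[OF h, of "Suc j"] by (simp add: algebra_simps)
  ultimately show ?case by blast
next
  case (add l p q)
  then obtain u v where u: "harm_decomp (l + 2) u" "laplacian u = p"
    and v: "harm_decomp (l + 2) v" "laplacian v = q" by blast
  have "laplacian (\<lambda>x. u x + v x) = (\<lambda>x. p x + q x)"
    using laplacian_add[OF hom_poly_rpf hom_poly_rpf] harm_decomp_hom_poly[OF u(1)]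
      harm_decomp_hom_poly[OF v(1)] u(2) v(2) by blast
  moreover have "harm_decomp (l + 2) (\<lambda>x. u x + v x)"
    by (rule harm_decomp.add[OF u(1) v(1)])
  ultimately show ?case by (intro exI[of _ "\<lambda>x. u x + v x"] conjI)
qed

text \<open>Induction on the degree: the Laplacian of p has degree l - 2, so it is the Laplacian of some
  decomposable u, and p - u is harmonic.\<close>
lemma hom_poly_harm_decomp:
  "hom_poly Basis l p \<Longrightarrow> harm_decomp l p"
proof (induction l arbitrary: p rule: less_induct)
  case (less l)
  show ?case
  proof (cases "l < 2")
    case True
    then have "harmonic_poly l p"
      using less.prems laplacian_deg_lt_2 by (auto simp: harmonic_poly_def)
    then show ?thesis using harm_decomp.harmonic_poly[of l p 0] by simp
  next
    case False
    have "harm_decomp (l - 2) (laplacian p)"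
      using less.IH[of "l - 2"] hom_poly_laplacian[OF less.prems] False by simp
    then obtain u where u: "harm_decomp l u" "laplacian u = laplacian p"
      using harm_decomp_laplacian_solvable[of "l - 2" "laplacian p"]
        le_add_diff_inverse2[of 2 l] False by (metis not_less)
    have ur: "hom_poly Basis l u" using u harm_decomp_hom_poly by blast
    have "harmonic_poly l (\<lambda>x. p x + (-1) * u x)"
      unfolding harmonic_poly_def
      using hom_poly_diff[OF less.prems ur]
        laplacian_add[OF hom_poly_rpf[OF less.prems] hom_poly_rpf[OF hom_poly_cmult[OF ur, of "-1"]]]
        laplacian_cmult[OF hom_poly_rpf[OF ur], of "-1"] u(2)
      by auto
    then have "harm_decomp l (\<lambda>x. p x + (-1) * u x)"
      using harm_decomp.harmonic_poly[of l _ 0] by fastforce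
    then show ?thesis using harm_decomp.add[OF _ u(1)] by fastforce
  qed
qed

subsection \<open>The dimension of the space of harmonic polynomials\<close>

text \<open>Gaussian elimination of one unknown for each equation.\<close>
lemma homogeneous_system_nontrivial:
  fixes A :: "'i \<Rightarrow> 's \<Rightarrow> real"
  assumes "finite S" "finite I" "card S < card I"
  shows "\<exists>c. (\<exists>i\<in>I. c i \<noteq> 0) \<and> (\<forall>s\<in>S. (\<Sum>i\<in>I. c i * A i s) = 0)"
  using assms
proof (induction S arbitrary: I A rule: finite_induct)
  case empty
  then obtain i where "i \<in> I" by fastforce
  then show ?case by (intro exI[of _ "\<lambda>_. 1"]) auto
next
  case (insert s S)
  show ?case
  proof (cases "\<forall>i\<in>I. A i s = 0")
    case True
    have "card S < card I" using insert by auto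
    from insert.IH[OF insert.prems(1) this, of A] True show ?thesis by auto
  next
    case False
    then obtain j where j: "j \<in> I" "A j s \<noteq> 0" by auto
    \<comment> \<open>Solve the equation s for the unknown j and substitute.\<close>
    define A' where "A' i u = A i u - A i s / A j s * A j u" for i u
    have "card S < card (I - {j})" using insert j by auto
    then obtain c where c: "\<exists>i\<in>I-{j}. c i \<noteq> 0" "\<forall>u\<in>S. (\<Sum>i\<in>I-{j}. c i * A' i u) = 0"
      using insert.IH[of "I - {j}" A'] insert.prems by auto
    define e where "e = - (\<Sum>i\<in>I-{j}. c i * A i s) / A j s"
    have eq: "(\<Sum>i\<in>I. (c(j := e)) i * A i u) = (\<Sum>i\<in>I-{j}. c i * A' i u)" for u
    proof -
      have "(\<Sum>i\<in>I. (c(j := e)) i * A i u) = e * A j u + (\<Sum>i\<in>I-{j}. c i * A i u)"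
        using insert.prems j by (subst sum.remove[of I j]) (auto intro!: sum.cong)
      also have "\<dots> = (\<Sum>i\<in>I-{j}. c i * A' i u)"
        by (simp add: A'_def e_def algebra_simps sum_subtractf sum_distrib_left sum_divide_distrib)
      finally show ?thesis .
    qed
    have "(\<Sum>i\<in>I-{j}. c i * A' i s) = 0"
      using j by (simp add: A'_def)
    then have "\<forall>u\<in>insert s S. (\<Sum>i\<in>I. (c(j := e)) i * A i u) = 0"
      using c(2) eq by auto
    moreover have "\<exists>i\<in>I. (c(j := e)) i \<noteq> 0" using c(1) by auto
    ultimately show ?thesis by blast
  qed
qed

text \<open>Dimension at most n, expressed by coordinates, which reduces linear dependence to a homogeneous
  system of equations for the coefficients.\<close>
definition spanned_by :: "nat \<Rightarrow> (('a \<Rightarrow> real) \<Rightarrow> bool) \<Rightarrow> bool" where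
  "spanned_by n V \<longleftrightarrow>
     (\<exists>\<phi>::nat \<Rightarrow> 'a \<Rightarrow> real. \<forall>f. V f \<longrightarrow> (\<exists>c. f = (\<lambda>x. \<Sum>i<n. c i * \<phi> i x)))"

lemma sum_lessThan_add:
  fixes f :: "nat \<Rightarrow> real"
  shows "(\<Sum>i<n+m. f i) = (\<Sum>i<n. f i) + (\<Sum>i<m. f (n + i))"
  by (induction m) auto

lemma spanned_by_add:
  assumes "spanned_by n V" "spanned_by m W"
    and split: "\<And>f. U f \<Longrightarrow> \<exists>g h. V g \<and> W h \<and> f = (\<lambda>x. g x + w x * h x)"
  shows "spanned_by (n + m) U"
proof -
  obtain \<phi> where \<phi>: "\<And>f. V f \<Longrightarrow> \<exists>c. f = (\<lambda>x. \<Sum>i<n. c i * \<phi> i x)"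
    using assms(1) unfolding spanned_by_def by blast
  obtain \<psi> where \<psi>: "\<And>f. W f \<Longrightarrow> \<exists>c. f = (\<lambda>x. \<Sum>i<m. c i * \<psi> i x)"
    using assms(2) unfolding spanned_by_def by blast
  let ?\<chi> = "\<lambda>i x. if i < n then \<phi> i x else w x * \<psi> (i - n) x"
  have "\<exists>c. f = (\<lambda>x. \<Sum>i<n+m. c i * ?\<chi> i x)" if U: "U f" for f
  proof -
    obtain g h where gh: "V g" "W h" "f = (\<lambda>x. g x + w x * h x)"
      using split[OF U] by blast
    obtain c e where "g = (\<lambda>x. \<Sum>i<n. c i * \<phi> i x)" "h = (\<lambda>x. \<Sum>i<m. e i * \<psi> i x)"
      using \<phi>[OF gh(1)] \<psi>[OF gh(2)] by blast
    then have "f = (\<lambda>x. \<Sum>i<n+m. (if i < n then c i else e (i - n)) * ?\<chi> i x)"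
      by (auto simp: gh(3) sum_lessThan_add sum_distrib_left intro!: ext sum.cong)
    then show ?thesis by (intro exI[of _ "\<lambda>i. if i < n then c i else e (i - n)"])
  qed
  then show ?thesis unfolding spanned_by_def by (intro exI[of _ ?\<chi>] allI impI)
qed

text \<open>Collect the monomials that contain the coordinate b.\<close>
lemma hom_poly_insert:
  "hom_poly (insert b B) l f \<Longrightarrow>
    \<exists>g h. hom_poly B l g \<and> hom_poly (insert b B) (l - 1) h \<and> (l = 0 \<longrightarrow> h = (\<lambda>x. 0)) \<and>
      f = (\<lambda>x. g x + (x \<bullet> b) * h x)"
proof (induction rule: hom_poly.induct)
  case (const c)
  then show ?case
    by (intro exI[of _ "\<lambda>x. c"] exI[of _ "\<lambda>x. 0"]) (auto intro: hom_poly.const hom_poly.zero)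
next
  case (zero l)
  then show ?case
    by (intro exI[of _ "\<lambda>x. 0"]) (auto intro: hom_poly.zero)
next
  case (add l f f')
  then obtain g h g' h' where
    "hom_poly B l g" "hom_poly (insert b B) (l - 1) h" "l = 0 \<longrightarrow> h = (\<lambda>x. 0)"
    "f = (\<lambda>x. g x + (x \<bullet> b) * h x)"
    "hom_poly B l g'" "hom_poly (insert b B) (l - 1) h'" "l = 0 \<longrightarrow> h' = (\<lambda>x. 0)"
    "f' = (\<lambda>x. g' x + (x \<bullet> b) * h' x)" by blast
  then show ?case
    by (intro exI[of _ "\<lambda>x. g x + g' x"] exI[of _ "\<lambda>x. h x + h' x"])
      (auto intro: hom_poly.add simp: algebra_simps)
next
  case (coord l f c)
  show ?case
  proof (cases "c = b")
    case True
    then show ?thesis using coord.hyps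
      by (intro exI[of _ "\<lambda>x. 0"] exI[of _ f]) (auto intro: hom_poly.zero)
  next
    case False
    then have c: "c \<in> B" using coord.hyps by auto
    obtain g h where gh: "hom_poly B l g" "hom_poly (insert b B) (l - 1) h"
      "l = 0 \<longrightarrow> h = (\<lambda>x. 0)" "f = (\<lambda>x. g x + (x \<bullet> b) * h x)" using coord.IH by blast
    have "hom_poly (insert b B) l (\<lambda>x. (x \<bullet> c) * h x)"
    proof (cases l)
      case 0
      then show ?thesis using gh(3) by (simp add: hom_poly.zero)
    next
      case (Suc k)
      then show ?thesis using hom_poly.coord[OF gh(2), of c] c by simp
    qed
    then show ?thesis
      using hom_poly.coord[OF gh(1) c] gh(4)
      by (intro exI[of _ "\<lambda>x. (x \<bullet> c) * g x"] exI[of _ "\<lambda>x. (x \<bullet> c) * h x"])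
         (auto simp: algebra_simps)
  qed
qed

lemma hom_poly_empty: "hom_poly {} l f \<Longrightarrow> 0 < l \<Longrightarrow> f = (\<lambda>x. 0)"
  by (induction rule: hom_poly.induct) auto

lemma hom_poly_0_spanned: "spanned_by (Suc 0) (hom_poly B 0)"
  unfolding spanned_by_def
proof (intro exI[of _ "\<lambda>i x. 1"] allI impI)
  fix f :: "'a \<Rightarrow> real" assume "hom_poly B 0 f"
  then obtain c where "f = (\<lambda>x. c)" using hom_poly_0_const by blast
  then show "\<exists>c. f = (\<lambda>x. \<Sum>i<Suc 0. c i * 1)" by (intro exI[of _ "\<lambda>_. c"]) simp
qed

text \<open>Splitting off the multiples of one coordinate turns Pascal's rule into a bound on the dimension.\<close>
lemma hom_poly_spanned:
  "finite B \<Longrightarrow> spanned_by ((l + card B - 1) choose l) (hom_poly B l)"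
proof (induction B arbitrary: l rule: finite_induct)
  case empty
  show ?case
  proof (cases l)
    case 0
    then show ?thesis using hom_poly_0_spanned[of "{}"] by simp
  next
    case (Suc k)
    then show ?thesis by (auto simp: spanned_by_def binomial_eq_0 dest: hom_poly_empty)
  qed
next
  case (insert b B)
  show ?case
  proof (induction l)
    case 0
    show ?case using hom_poly_0_spanned by simp
  next
    case (Suc l)
    have "spanned_by ((Suc l + card B - 1 choose Suc l) + (l + card (insert b B) - 1 choose l))
        (hom_poly (insert b B) (Suc l))"
    proof (rule spanned_by_add[OF insert.IH Suc])
      fix f assume "hom_poly (insert b B) (Suc l) f"
      from hom_poly_insert[OF this]
      show "\<exists>g h. hom_poly B (Suc l) g \<and> hom_poly (insert b B) l h \<and> f = (\<lambda>x. g x + x \<bullet> b * h x)"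
        by auto
    qed
    moreover have "(Suc l + card B - 1 choose Suc l) + (l + card (insert b B) - 1 choose l)
        = (Suc l + card (insert b B) - 1 choose Suc l)"
      using insert.hyps by simp
    ultimately show ?case by simp
  qed
qed

lemma isCont_zero_punctured:
  fixes F :: "real \<Rightarrow> real"
  assumes "isCont F 0" "\<And>t. t \<noteq> 0 \<Longrightarrow> F t = 0"
  shows "F 0 = 0"
proof -
  have "(F \<longlongrightarrow> F 0) (at 0)" using assms(1) by (simp add: isCont_def)
  moreover have "(F \<longlongrightarrow> 0) (at 0)"
    by (rule tendsto_eventually) (auto simp: eventually_at_filter assms(2))
  ultimately show ?thesis using tendsto_unique trivial_limit_at by blast
qed

lemma rpf_isCont_line:
  fixes p :: "'a::euclidean_space \<Rightarrow> real"
  shows "real_polynomial_function p \<Longrightarrow> isCont (\<lambda>t. p (x + t *\<^sub>R y)) t"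
  by (rule DERIV_isCont[OF pd_has_real_derivative])

lemma pd_coord_power:
  assumes "b \<in> Basis" "c \<in> Basis"
  shows "pd b (\<lambda>x. (x \<bullet> c) ^ i) = (\<lambda>x. if b = c then real i * (x \<bullet> c) ^ (i - 1) else 0)"
proof (rule ext, rule pdI)
  fix x
  have "(x + t *\<^sub>R b) \<bullet> c = x \<bullet> c + (if b = c then t else 0)" for t
    using assms by (simp add: inner_add_left inner_Basis)
  then have "(\<lambda>t. ((x + t *\<^sub>R b) \<bullet> c) ^ i) = (\<lambda>t. (x \<bullet> c + (if b = c then t else 0)) ^ i)"
    by simp
  then show "((\<lambda>t. ((x + t *\<^sub>R b) \<bullet> c) ^ i) has_real_derivative
      (if b = c then real i * (x \<bullet> c) ^ (i - 1) else 0)) (at 0)"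
    by (auto intro!: derivative_eq_intros)
qed

lemma rpf_coord_power: "real_polynomial_function (\<lambda>x::'a::euclidean_space. (x \<bullet> c) ^ i)"
  by (intro real_polynomial_function_power rpf_inner)

text \<open>Where the coordinate c vanishes, the second factor is a non-zero multiple of q. This is what
  forces a further factor out of a harmonic multiple of a power of that coordinate.\<close>
lemma laplacian_coord_power_mult:
  assumes "real_polynomial_function q" "c \<in> Basis"
  shows "laplacian (\<lambda>x. (x \<bullet> c) ^ (i + 2) * q x) x =
    (x \<bullet> c) ^ i * (real (i + 2) * real (i + 1) * q x + 2 * real (i + 2) * (x \<bullet> c) * pd c q x
      + (x \<bullet> c)\<^sup>2 * laplacian q x)"
proof -
  have 1: "laplacian (\<lambda>x. (x \<bullet> c) ^ (i + 2)) = (\<lambda>x. real (i + 2) * real (i + 1) * (x \<bullet> c) ^ i)"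
  proof -
    have "pd b (pd b (\<lambda>x. (x \<bullet> c) ^ (i + 2)))
        = (\<lambda>x. if b = c then real (i + 2) * real (i + 1) * (x \<bullet> c) ^ i else 0)" if "b \<in> Basis" for b
    proof (cases "b = c")
      case True
      have p1: "pd c (\<lambda>x. (x \<bullet> c) ^ (i + 2)) = (\<lambda>x. real (i + 2) * (x \<bullet> c) ^ (i + 1))"
        unfolding pd_coord_power[OF assms(2) assms(2)] by (simp del: power_Suc)
      have p2: "pd c (\<lambda>x. (x \<bullet> c) ^ (i + 1)) = (\<lambda>x. real (i + 1) * (x \<bullet> c) ^ i)"
        unfolding pd_coord_power[OF assms(2) assms(2)] by simp
      show ?thesis
        unfolding True p1 pd_cmult[OF rpf_coord_power] p2 by (simp only: if_True refl mult.assoc)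
    next
      case False
      then have "pd b (\<lambda>x. (x \<bullet> c) ^ (i + 2)) = (\<lambda>x. 0)"
        unfolding pd_coord_power[OF that assms(2)] by simp
      then show ?thesis using False by (simp only: pd_const if_False)
    qed
    then have "laplacian (\<lambda>x. (x \<bullet> c) ^ (i + 2))
        = (\<lambda>x. \<Sum>b\<in>Basis. if b = c then real (i + 2) * real (i + 1) * (x \<bullet> c) ^ i else 0)"
      unfolding laplacian_eq[OF rpf_coord_power] by (intro ext sum.cong refl) (simp only:)
    then show ?thesis using assms(2) by (simp only: sum.delta finite_Basis if_True)
  qed
  have 2: "(\<Sum>b\<in>Basis. pd b (\<lambda>x. (x \<bullet> c) ^ (i + 2)) x * pd b q x)
      = real (i + 2) * (x \<bullet> c) ^ (i + 1) * pd c q x"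
  proof -
    have "(\<Sum>b\<in>Basis. pd b (\<lambda>x. (x \<bullet> c) ^ (i + 2)) x * pd b q x)
      = (\<Sum>b\<in>Basis. if b = c then real (i + 2) * (x \<bullet> c) ^ (i + 1) * pd c q x else 0)"
      by (intro sum.cong refl) (simp add: pd_coord_power[OF _ assms(2)] del: add_2_eq_Suc')
    then show ?thesis using assms(2) by simp
  qed
  show ?thesis
    unfolding laplacian_mult[OF rpf_coord_power assms(1)] 1 2
    by (simp add: algebra_simps power2_eq_square)
qed

lemma rpf_coord_split:
  assumes "real_polynomial_function q" "b \<in> Basis"
  shows "\<exists>q0 q1. real_polynomial_function q0 \<and> real_polynomial_function q1 \<and>
    (\<forall>x t. q0 (x + t *\<^sub>R b) = q0 x) \<and> q = (\<lambda>x. q0 x + (x \<bullet> b) * q1 x)"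
proof -
  obtain L g where g: "\<And>l. hom_poly Basis l (g l)" "q = (\<lambda>x. \<Sum>l\<le>L. g l x)"
    using rpf_hom_decomp[OF assms(1)] by blast
  have indep: "f (x + t *\<^sub>R b) = f x" if "hom_poly (Basis - {b}) l f" for l f x t
    using that assms(2)
    by (induction rule: hom_poly.induct) (auto simp: inner_add_left inner_Basis)
  have "\<exists>g0 g1. hom_poly (Basis - {b}) l g0 \<and> hom_poly Basis (l - 1) g1 \<and>
      g l = (\<lambda>x. g0 x + (x \<bullet> b) * g1 x)" for l
    using hom_poly_insert[of b "Basis - {b}" l "g l"] g(1) assms(2) by (auto simp: insert_absorb)
  then obtain g0 g1 where "\<And>l. hom_poly (Basis - {b}) l (g0 l)" "\<And>l. hom_poly Basis (l - 1) (g1 l)"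
      and split: "\<And>l. g l = (\<lambda>x. g0 l x + (x \<bullet> b) * g1 l x)" by metis
  note gs = this
  show ?thesis
  proof (intro exI conjI allI)
    show "real_polynomial_function (\<lambda>x. \<Sum>l\<le>L. g0 l x)"
      by (intro rpf_sum hom_poly_rpf[OF gs(1)]) auto
    show "real_polynomial_function (\<lambda>x. \<Sum>l\<le>L. g1 l x)"
      by (intro rpf_sum hom_poly_rpf[OF gs(2)]) auto
    show "(\<Sum>l\<le>L. g0 l (x + t *\<^sub>R b)) = (\<Sum>l\<le>L. g0 l x)" for x t
      using indep[OF gs(1)] by simp
    show "q = (\<lambda>x. (\<Sum>l\<le>L. g0 l x) + (x \<bullet> b) * (\<Sum>l\<le>L. g1 l x))"
      by (simp add: g(2) split sum.distrib sum_distrib_left)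
  qed
qed

text \<open>Uniqueness in the Cauchy problem with data on the hyperplane where the coordinate b is 0. Write x_b
  for this coordinate. If p = x_b^(i+2) q, then dividing the equation for the Laplacian by x_b^i and
  restricting to the hyperplane shows that q vanishes there, so x_b divides q. Hence every power of
  x_b divides p, and by homogeneity p = 0.\<close>
lemma harmonic_poly_divisible_coord_square:
  assumes "harmonic_poly l p" "b \<in> Basis" "real_polynomial_function h" "p = (\<lambda>x. (x \<bullet> b)\<^sup>2 * h x)"
  shows "p = (\<lambda>x. 0)"
proof -
  have div: "\<exists>q. real_polynomial_function q \<and> p = (\<lambda>x. (x \<bullet> b) ^ (i + 2) * q x)" for i
  proof (induction i)
    case 0
    then show ?case unfolding add_0 using assms(3,4) by blast
  next
    case (Suc i)
    then obtain q where q: "real_polynomial_function q" "p = (\<lambda>x. (x \<bullet> b) ^ (i + 2) * q x)" by blast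
    obtain q0 q1 where q01: "real_polynomial_function q0" "real_polynomial_function q1"
      "\<And>x t. q0 (x + t *\<^sub>R b) = q0 x" "q = (\<lambda>x. q0 x + (x \<bullet> b) * q1 x)"
      using rpf_coord_split[OF q(1) assms(2)] by blast
    have q_hyperplane: "q y = 0" if "y \<bullet> b = 0" for y
    proof -
      let ?F = "\<lambda>t. real (i + 2) * real (i + 1) * q (y + t *\<^sub>R b)
          + 2 * real (i + 2) * t * pd b q (y + t *\<^sub>R b) + t\<^sup>2 * laplacian q (y + t *\<^sub>R b)"
      have "?F 0 = 0"
      proof (rule isCont_zero_punctured)
        show "isCont ?F 0"
          by (intro continuous_intros rpf_isCont_line rpf_pd rpf_laplacian q(1))
        fix t :: real assume "t \<noteq> 0"
        have tb: "(y + t *\<^sub>R b) \<bullet> b = t"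
          using that assms(2) by (simp add: inner_add_left)
        have "0 = laplacian p (y + t *\<^sub>R b)"
          using assms(1) by (simp add: harmonic_poly_def)
        also have "\<dots> = t ^ i * ?F t"
          unfolding q(2) laplacian_coord_power_mult[OF q(1) assms(2)] tb by simp
        finally show "?F t = 0" using \<open>t \<noteq> 0\<close> by simp
      qed
      then show ?thesis by simp
    qed
    have "q0 x = 0" for x
    proof -
      have "(x + (-(x \<bullet> b)) *\<^sub>R b) \<bullet> b = 0"
        using assms(2) by (simp add: inner_add_left inner_diff_left)
      from q_hyperplane[OF this] this show ?thesis
        unfolding q01(4) q01(3) by simp
    qed
    then have "p = (\<lambda>x. (x \<bullet> b) ^ (Suc i + 2) * q1 x)"
      by (simp add: q(2) q01(4) algebra_simps)
    then show ?case using q01(2) by blast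
  qed
  obtain q where q: "real_polynomial_function q" "p = (\<lambda>x. (x \<bullet> b) ^ (l + 2) * q x)"
    using div[of l] by blast
  have "p x = 0" for x
  proof -
    let ?F = "\<lambda>t. p x - t\<^sup>2 * ((x \<bullet> b) ^ (l + 2) * q (0 + t *\<^sub>R x))"
    have "?F 0 = 0"
    proof (rule isCont_zero_punctured)
      show "isCont ?F 0" by (intro continuous_intros rpf_isCont_line q(1))
      fix t :: real assume "t \<noteq> 0"
      have "t ^ l * p x = p (t *\<^sub>R x)"
        using assms(1) hom_poly_scale unfolding harmonic_poly_def by metis
      also have "\<dots> = t ^ l * (t\<^sup>2 * ((x \<bullet> b) ^ (l + 2) * q (0 + t *\<^sub>R x)))"
        by (simp add: q(2) power_mult_distrib power2_eq_square algebra_simps)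
      finally show "?F t = 0" using \<open>t \<noteq> 0\<close> by simp
    qed
    then show ?thesis by simp
  qed
  then show ?thesis by blast
qed

text \<open>The number of monomials of degree l plus the number of those of degree l - 1, in d variables.
  For l = 0 there are none of the second kind, but truncated subtraction would count one.\<close>
definition harm_bound :: "nat \<Rightarrow> nat \<Rightarrow> nat" where
  "harm_bound d l = (l + d - 1 choose l) + (if l = 0 then 0 else (l + d - 2) choose (l - 1))"

lemma hom_poly_spanned_mod_square:
  fixes b :: "'a::euclidean_space"
  assumes "b \<in> Basis" "DIM('a) = d + 1"
  shows "\<exists>\<phi>. \<forall>p. hom_poly Basis l p \<longrightarrow> (\<exists>c h. real_polynomial_function h \<and>
     p = (\<lambda>x. (\<Sum>i<harm_bound d l. c i * \<phi> i x) + (x \<bullet> b)\<^sup>2 * h x))"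
proof -
  let ?B = "Basis - {b}"
  have card: "card ?B = d" "finite ?B" using assms by auto
  have ins: "insert b ?B = Basis" using assms by auto
  let ?V = "\<lambda>g1. if l = 0 then g1 = (\<lambda>x. 0) else hom_poly ?B (l - 1) g1"
  let ?U = "\<lambda>f. \<exists>g g1. hom_poly ?B l g \<and> ?V g1 \<and> f = (\<lambda>x. g x + (x \<bullet> b) * g1 x)"
  have V: "spanned_by (if l = 0 then 0 else (l + d - 2) choose (l - 1)) ?V"
  proof (cases "l = 0")
    case True
    then show ?thesis by (simp add: spanned_by_def)
  next
    case False
    then have "l + d - 2 = l - 1 + d - 1" by simp
    then show ?thesis using hom_poly_spanned[OF card(2), of "l - 1"] False card(1) by simp
  qed
  have "spanned_by (harm_bound d l) ?U"
    unfolding harm_bound_def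
    using spanned_by_add[OF hom_poly_spanned[OF card(2), of l] V, of ?U "\<lambda>x. x \<bullet> b"] card(1)
    by auto
  then obtain \<phi> where \<phi>: "\<And>f. ?U f \<Longrightarrow> \<exists>c. f = (\<lambda>x. \<Sum>i<harm_bound d l. c i * \<phi> i x)"
    unfolding spanned_by_def by blast
  have "\<exists>c h. real_polynomial_function h \<and>
     p = (\<lambda>x. (\<Sum>i<harm_bound d l. c i * \<phi> i x) + (x \<bullet> b)\<^sup>2 * h x)" if p: "hom_poly Basis l p" for p
  proof -
    obtain g h where gh: "hom_poly ?B l g" "hom_poly Basis (l - 1) h" "l = 0 \<longrightarrow> h = (\<lambda>x. 0)"
      "p = (\<lambda>x. g x + (x \<bullet> b) * h x)"
      using hom_poly_insert[of b ?B l p] p ins by auto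
    obtain g1 h1 where g1: "hom_poly ?B (l - 1) g1" "hom_poly Basis (l - 1 - 1) h1"
      "h = (\<lambda>x. g1 x + (x \<bullet> b) * h1 x)" "l - 1 = 0 \<longrightarrow> h1 = (\<lambda>x. 0)"
      using hom_poly_insert[of b ?B "l - 1" h] gh(2) ins by auto
    have "?V g1"
      using g1 gh(3) by (auto simp: fun_eq_iff)
    then have "?U (\<lambda>x. g x + (x \<bullet> b) * g1 x)" using gh(1) by blast
    then obtain c where "(\<lambda>x. g x + (x \<bullet> b) * g1 x) = (\<lambda>x. \<Sum>i<harm_bound d l. c i * \<phi> i x)"
      using \<phi> by blast
    then have "p = (\<lambda>x. (\<Sum>i<harm_bound d l. c i * \<phi> i x) + (x \<bullet> b)\<^sup>2 * h1 x)"
      unfolding gh(4) g1(3) fun_eq_iff by (simp add: algebra_simps power2_eq_square)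
    then show ?thesis using hom_poly_rpf[OF g1(2)] by blast
  qed
  then show ?thesis by blast
qed

text \<open>Modulo the square of the coordinate b, a form is given by its value and its normal derivative on
  the hyperplane where that coordinate is 0, which are forms in d variables of degree l and l - 1. With
  too many harmonic forms, some combination has trivial data, so it is divisible by the square and
  therefore 0.\<close>
lemma harmonic_poly_linearly_dependent:
  fixes g :: "'i \<Rightarrow> 'a::euclidean_space \<Rightarrow> real"
  assumes "DIM('a) = d + 1" "finite I" "harm_bound d l < card I" "\<And>i. i \<in> I \<Longrightarrow> harmonic_poly l (g i)"
  shows "\<exists>c. (\<exists>i\<in>I. c i \<noteq> 0) \<and> (\<forall>x. (\<Sum>i\<in>I. c i * g i x) = 0)"
proof -
  obtain b :: 'a where b: "b \<in> Basis" using nonempty_Basis by blast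
  obtain \<phi> where \<phi>: "\<And>p. hom_poly Basis l p \<Longrightarrow> \<exists>c h. real_polynomial_function h \<and>
     p = (\<lambda>x. (\<Sum>i<harm_bound d l. c i * \<phi> i x) + (x \<bullet> b)\<^sup>2 * h x)"
    using hom_poly_spanned_mod_square[OF b assms(1), of l] by blast
  have "\<forall>i\<in>I. \<exists>A h. real_polynomial_function h \<and>
     g i = (\<lambda>x. (\<Sum>j<harm_bound d l. A j * \<phi> j x) + (x \<bullet> b)\<^sup>2 * h x)"
    using \<phi> assms(4) unfolding harmonic_poly_def by blast
  then obtain A h where A: "\<And>i. i \<in> I \<Longrightarrow> real_polynomial_function (h i)"
     "\<And>i. i \<in> I \<Longrightarrow> g i = (\<lambda>x. (\<Sum>j<harm_bound d l. A i j * \<phi> j x) + (x \<bullet> b)\<^sup>2 * h i x)"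
    by metis
  obtain c where c: "\<exists>i\<in>I. c i \<noteq> 0" "\<forall>j<harm_bound d l. (\<Sum>i\<in>I. c i * A i j) = 0"
    using homogeneous_system_nontrivial[of "{..<harm_bound d l}" I A] assms by auto
  let ?p = "\<lambda>x. \<Sum>i\<in>I. c i * g i x"
  have "?p x = (x \<bullet> b)\<^sup>2 * (\<Sum>i\<in>I. c i * h i x)" for x
  proof -
    have "?p x = (\<Sum>i\<in>I. (\<Sum>j<harm_bound d l. c i * A i j * \<phi> j x) + (x \<bullet> b)\<^sup>2 * (c i * h i x))"
      by (rule sum.cong) (auto simp: A(2) algebra_simps sum_distrib_left)
    also have "\<dots> = (\<Sum>j<harm_bound d l. (\<Sum>i\<in>I. c i * A i j) * \<phi> j x) + (x \<bullet> b)\<^sup>2 * (\<Sum>i\<in>I. c i * h i x)"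
      by (subst sum.distrib, subst sum.swap) (simp add: sum_distrib_left sum_distrib_right)
    also have "(\<Sum>j<harm_bound d l. (\<Sum>i\<in>I. c i * A i j) * \<phi> j x) = 0"
      using c(2) by (intro sum.neutral) auto
    finally show ?thesis by simp
  qed
  then have "?p = (\<lambda>x. 0)"
    using assms A
    by (intro harmonic_poly_divisible_coord_square[of l ?p b "\<lambda>x. \<Sum>i\<in>I. c i * h i x"] b harmonic_poly_sum harmonic_poly_cmult
         rpf_sum rpf_mult rpf_const ext) auto
  then show ?thesis using c(1) by metis
qed

section \<open>The surface measure\<close>

lemma nn_integral_lborel_translate:
  fixes f :: "'a::euclidean_space \<Rightarrow> ennreal"
  assumes [measurable]: "f \<in> borel_measurable borel"
  shows "(\<integral>\<^sup>+x. f (c + x) \<partial>lborel) = (\<integral>\<^sup>+x. f x \<partial>lborel)"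
proof -
  have "(\<integral>\<^sup>+x. f (c + x) \<partial>lborel) = (\<integral>\<^sup>+x. f x \<partial>distr lborel borel ((+) c))"
    by (subst nn_integral_distr) auto
  then show ?thesis by (simp only: lborel_distr_plus)
qed

lemma orthogonal_transformation_measurable:
  fixes R :: "'a::euclidean_space \<Rightarrow> 'a"
  assumes "orthogonal_transformation R"
  shows "R \<in> borel_measurable borel"
  using assms orthogonal_transformation_linear linear_continuous_on linear_conv_bounded_linear
    borel_measurable_continuous_onI by metis

text \<open>The image measure is translation invariant and gives balls around 0 their Lebesgue measure.
  Translation invariant measures are proportional, and the unit ball fixes the factor.\<close>
lemma lborel_distr_orthogonal:
  fixes R :: "'a::euclidean_space \<Rightarrow> 'a"
  assumes R: "orthogonal_transformation R"
  shows "distr lborel borel R = lborel"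
proof -
  define \<nu> where "\<nu> = distr lborel borel R"
  note Rm[measurable] = orthogonal_transformation_measurable[OF R]
  obtain S where S: "\<And>x. R (S x) = x"
    using orthogonal_transformation_surj[OF R] by (metis surjD)
  have Radd: "R (x + y) = R x + R y" for x y
    using orthogonal_transformation_linear[OF R] by (simp add: linear_add)
  have Rnorm: "norm (R x) = norm x" for x
    using R by (simp add: orthogonal_transformation)
  have sets_nu: "sets \<nu> = sets borel" "space \<nu> = UNIV" by (simp_all add: \<nu>_def)
  have nu_ball: "emeasure \<nu> (ball 0 r) = emeasure lborel (ball (0::'a) r)" for r
  proof -
    have "R -` ball 0 r = ball 0 r" using Rnorm by auto
    then show ?thesis by (simp add: \<nu>_def emeasure_distr)
  qed
  have transl: "(\<integral>\<^sup>+x. f (y + x) \<partial>\<nu>) = (\<integral>\<^sup>+x. f x \<partial>\<nu>)"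
    if [measurable]: "f \<in> borel_measurable borel" for f :: "'a \<Rightarrow> ennreal" and y
  proof -
    have "(\<integral>\<^sup>+x. f (y + x) \<partial>\<nu>) = (\<integral>\<^sup>+x. f (R (S y + x)) \<partial>lborel)"
      unfolding \<nu>_def by (subst nn_integral_distr) (auto simp: Radd S)
    also have "\<dots> = (\<integral>\<^sup>+x. f (R x) \<partial>lborel)"
      by (rule nn_integral_lborel_translate[of "\<lambda>x. f (R x)"]) simp
    also have "\<dots> = (\<integral>\<^sup>+x. f x \<partial>\<nu>)"
      unfolding \<nu>_def by (subst nn_integral_distr) auto
    finally show ?thesis .
  qed
  have "sigma_finite_measure \<nu>"
  proof
    show "\<exists>A. countable A \<and> A \<subseteq> sets \<nu> \<and> \<Union> A = space \<nu> \<and> (\<forall>a\<in>A. emeasure \<nu> a \<noteq> \<infinity>)"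
    proof (intro exI conjI ballI)
      show "countable (range (\<lambda>n::nat. ball (0::'a) (real n)))" by simp
      show "range (\<lambda>n::nat. ball (0::'a) (real n)) \<subseteq> sets \<nu>" by (auto simp: sets_nu)
      show "\<Union> (range (\<lambda>n::nat. ball (0::'a) (real n))) = space \<nu>"
        using reals_Archimedean2 by (auto simp: sets_nu)
      show "emeasure \<nu> a \<noteq> \<infinity>" if a: "a \<in> range (\<lambda>n::nat. ball (0::'a) (real n))" for a
      proof -
        obtain n where "a = ball 0 (real n)" using a by auto
        then show ?thesis
          using nu_ball emeasure_lborel_ball_finite[of "0::'a" "real n"] by (metis order_less_irrefl)
      qed
    qed
  qed
  then interpret nu: sigma_finite_measure \<nu> .
  interpret pair_sigma_finite \<nu> "lborel :: 'a measure" ..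
  have [measurable_cong]: "sets \<nu> = sets borel" by (rule sets_nu)
  let ?B = "ball (0::'a) 1"
  have [measurable]: "?B \<in> sets borel" by simp
  have ind: "indicator ?B (y - x) = (indicator (ball y 1) x :: ennreal)" for x y
    by (auto simp: dist_norm norm_minus_commute split: split_indicator)
  have translated_ball: "emeasure \<nu> (ball y 1) = emeasure lborel ?B" for y
  proof -
    have "emeasure \<nu> (ball y 1) = (\<integral>\<^sup>+x. indicator (ball y 1) x \<partial>\<nu>)"
      by (rule nn_integral_indicator[symmetric]) (simp add: sets_nu)
    also have "\<dots> = (\<integral>\<^sup>+x. indicator (ball y 1) (y + x) \<partial>\<nu>)"
      by (rule transl[symmetric]) (intro borel_measurable_indicator, simp)
    also have "\<dots> = (\<integral>\<^sup>+x. indicator ?B x \<partial>\<nu>)"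
      by (rule nn_integral_cong) (auto simp: dist_norm split: split_indicator)
    also have "\<dots> = emeasure lborel ?B" by (simp add: nu_ball sets_nu)
    finally show ?thesis .
  qed
  \<comment> \<open>Fubini for the product of the two measures, after the shears x \<mapsto> y + x and y \<mapsto> y - x.\<close>
  have *: "emeasure \<nu> A * emeasure lborel ?B = emeasure lborel A * emeasure lborel ?B"
    if [measurable]: "A \<in> sets borel" for A
  proof -
    have "emeasure \<nu> A * emeasure lborel ?B = (\<integral>\<^sup>+y. (\<integral>\<^sup>+x. indicator A x \<partial>\<nu>) * indicator ?B y \<partial>lborel)"
      by (simp add: nn_integral_cmult_indicator sets_nu)
    also have "\<dots> = (\<integral>\<^sup>+y. (\<integral>\<^sup>+x. indicator A (y + x) \<partial>\<nu>) * indicator ?B y \<partial>lborel)"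
      by (subst transl) auto
    also have "\<dots> = (\<integral>\<^sup>+y. (\<integral>\<^sup>+x. indicator A (y + x) * indicator ?B y \<partial>\<nu>) \<partial>lborel)"
      by (intro nn_integral_cong nn_integral_multc[symmetric]) simp
    also have "\<dots> = (\<integral>\<^sup>+x. (\<integral>\<^sup>+y. indicator A (y + x) * indicator ?B y \<partial>lborel) \<partial>\<nu>)"
      by (rule Fubini') measurable
    also have "\<dots> = (\<integral>\<^sup>+x. (\<integral>\<^sup>+y. indicator A y * indicator ?B (y - x) \<partial>lborel) \<partial>\<nu>)"
    proof (rule nn_integral_cong)
      fix x
      show "(\<integral>\<^sup>+y. indicator A (y + x) * indicator ?B y \<partial>lborel)
          = (\<integral>\<^sup>+y. indicator A y * indicator ?B (y - x) \<partial>lborel)"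
        using nn_integral_lborel_translate[of "\<lambda>y. indicator A y * indicator ?B (y - x)" x]
        by (simp add: add.commute)
    qed
    also have "\<dots> = (\<integral>\<^sup>+y. (\<integral>\<^sup>+x. indicator A y * indicator ?B (y - x) \<partial>\<nu>) \<partial>lborel)"
      by (rule Fubini'[symmetric]) measurable
    also have "\<dots> = (\<integral>\<^sup>+y. indicator A y * emeasure lborel ?B \<partial>lborel)"
    proof (rule nn_integral_cong)
      fix y
      have "(\<integral>\<^sup>+x. indicator A y * indicator ?B (y - x) \<partial>\<nu>)
          = indicator A y * (\<integral>\<^sup>+x. indicator (ball y 1) x \<partial>\<nu>)"
        unfolding ind by (rule nn_integral_cmult) (intro borel_measurable_indicator, simp add: sets_nu)
      then show "(\<integral>\<^sup>+x. indicator A y * indicator ?B (y - x) \<partial>\<nu>) = indicator A y * emeasure lborel ?B"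
        by (simp add: translated_ball sets_nu)
    qed
    also have "\<dots> = emeasure lborel A * emeasure lborel ?B"
      by (subst nn_integral_multc) auto
    finally show ?thesis .
  qed
  have "emeasure lborel ?B \<noteq> 0" "emeasure lborel ?B \<noteq> \<infinity>"
    using content_ball_pos[of 1 "0::'a"] emeasure_lborel_ball_finite[of "0::'a" 1]
    by (auto simp: measure_def less_top[symmetric])
  then have "emeasure \<nu> A = emeasure lborel A" if "A \<in> sets borel" for A
    using *[OF that] by (auto simp: mult.commute[of _ "emeasure lborel ?B"] ennreal_mult_cancel_left)
  then show ?thesis
    unfolding \<nu>_def by (intro measure_eqI) auto
qed

abbreviation ball_measure :: "'a::euclidean_space measure" where
  "ball_measure \<equiv> uniform_measure lborel (ball 0 1)"

lemma emeasure_unit_ball: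
  "emeasure lborel (ball (0::'a::euclidean_space) 1) \<noteq> 0"
  "emeasure lborel (ball (0::'a::euclidean_space) 1) < \<infinity>"
  using content_ball_pos[of 1 "0::'a"] emeasure_lborel_ball_finite[of "0::'a" 1]
  by (auto simp: measure_def)

lemma prob_space_ball_measure: "prob_space (ball_measure :: 'a::euclidean_space measure)"
  using emeasure_unit_ball[where 'a='a] by (intro prob_space_uniform_measure) auto

lemma ball_measure_distr_orthogonal:
  fixes R :: "'a::euclidean_space \<Rightarrow> 'a"
  assumes R: "orthogonal_transformation R"
  shows "distr ball_measure borel R = ball_measure"
proof (rule measure_eqI)
  fix A :: "'a set" assume "A \<in> sets (distr ball_measure borel R)"
  then have A[measurable]: "A \<in> sets borel" by simp
  note [measurable] = orthogonal_transformation_measurable[OF R]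
  have RA: "R -` A \<in> sets borel"
    using measurable_sets[OF orthogonal_transformation_measurable[OF R] A] by simp
  have "emeasure (distr ball_measure borel R) A = emeasure ball_measure (R -` A)"
    by (subst emeasure_distr) auto
  also have "\<dots> = emeasure lborel (ball 0 1 \<inter> R -` A) / emeasure lborel (ball (0::'a) 1)"
    using RA by (subst emeasure_uniform_measure) auto
  also have "ball 0 1 \<inter> R -` A = R -` (ball 0 1 \<inter> A)"
    using R by (auto simp: orthogonal_transformation)
  also have "emeasure lborel (R -` (ball 0 1 \<inter> A)) = emeasure (distr lborel borel R) (ball 0 1 \<inter> A)"
    by (subst emeasure_distr) auto
  also have "\<dots> / emeasure lborel (ball (0::'a) 1) = emeasure ball_measure A"
    by (subst emeasure_uniform_measure) (auto simp: lborel_distr_orthogonal[OF R])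
  finally show "emeasure (distr ball_measure borel R) A = emeasure ball_measure A" .
qed simp

lemma borel_measurable_sgn_euclidean [measurable]:
  "(sgn :: 'a::euclidean_space \<Rightarrow> 'a) \<in> borel_measurable borel"
  unfolding sgn_div_norm by measurable

lemma AE_ball_measure_sgn_sphere:
  "AE x in ball_measure. sgn x \<in> sphere (0::'a::euclidean_space) 1"
proof (rule AE_uniform_measureI)
  have "AE x::'a in lborel. x \<noteq> 0" by (rule AE_lborel_singleton)
  then show "AE x::'a in lborel. x \<in> ball 0 1 \<longrightarrow> sgn x \<in> sphere 0 1"
    by eventually_elim (auto simp: norm_sgn)
qed simp

lemma prob_space_sphere_measure: "prob_space (sphere_measure :: 'a::euclidean_space measure)"
proof -
  interpret prob_space "ball_measure :: 'a measure" by (rule prob_space_ball_measure)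
  have "sgn \<in> measurable (ball_measure :: 'a measure) borel" by simp
  then have d: "prob_space (distr (ball_measure :: 'a measure) borel sgn)" by (rule prob_space_distr)
  have "emeasure (distr (ball_measure :: 'a measure) borel sgn) (sphere 0 1) = 1"
    using AE_ball_measure_sgn_sphere[where 'a='a]
    by (intro prob_space.emeasure_eq_1_AE[OF d]) (auto simp: AE_distr_iff)
  then have "prob_space (restrict_space (distr (ball_measure :: 'a measure) borel sgn) (sphere 0 1))"
    by (intro prob_space_restrict_space) auto
  then show ?thesis
    unfolding sphere_measure_def by (rule prob_space.prob_space_completion)
qed

lemma restrict_borel_measurable_sphere_base:
  "f \<in> borel_measurable (restrict_space borel (sphere 0 1)) \<Longrightarrow>
   f \<in> borel_measurable (restrict_space (distr (ball_measure :: 'a::euclidean_space measure) borel sgn) (sphere 0 1))"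
  by (subst measurable_cong_sets[OF sets_restrict_space_cong refl]) auto

lemma borel_measurable_sphere_measure:
  "f \<in> borel_measurable (restrict_space borel (sphere 0 1)) \<Longrightarrow> f \<in> borel_measurable sphere_measure"
  unfolding sphere_measure_def
  using restrict_borel_measurable_sphere_base measurable_completion by blast

lemma continuous_on_sphere_measurable:
  "continuous_on (sphere 0 1) f \<Longrightarrow> f \<in> borel_measurable sphere_measure"
  by (intro borel_measurable_sphere_measure borel_measurable_continuous_on_restrict)

lemma continuous_on_sphere_bounded:
  fixes f :: "'a::euclidean_space \<Rightarrow> real"
  assumes "continuous_on (sphere 0 1) f"
  shows "\<exists>C\<ge>0. \<forall>x\<in>sphere 0 1. \<bar>f x\<bar> \<le> C"
proof -
  have "bounded (f ` sphere 0 1)"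
    using assms compact_continuous_image compact_sphere compact_imp_bounded by blast
  then obtain C where "\<forall>x\<in>sphere 0 1. \<bar>f x\<bar> \<le> C" by (auto simp: bounded_iff)
  then show ?thesis by (intro exI[of _ "max C 0"]) (auto intro: order_trans)
qed

lemma integrable_continuous_on_sphere:
  fixes f :: "'a::euclidean_space \<Rightarrow> real"
  assumes "continuous_on (sphere 0 1) f"
  shows "integrable sphere_measure f"
proof -
  interpret prob_space "sphere_measure :: 'a measure" by (rule prob_space_sphere_measure)
  obtain C where "\<forall>x\<in>sphere 0 1. \<bar>f x\<bar> \<le> C"
    using continuous_on_sphere_bounded[OF assms] by blast
  then show ?thesis
    by (intro integrable_const_bound[where B=C] AE_I2 continuous_on_sphere_measurable assms) auto
qed

text \<open>The indicator only matters at the origin, which sgn does not map to the sphere.\<close>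
lemma integral_sphere_measure:
  fixes f :: "'a::euclidean_space \<Rightarrow> real"
  assumes f: "f \<in> borel_measurable (restrict_space borel (sphere 0 1))"
  shows "(\<integral>x. f x \<partial>sphere_measure) = (\<integral>x. indicator (sphere 0 1) (sgn x) * f (sgn x) \<partial>ball_measure)"
    and "(\<lambda>x. indicator (sphere 0 1) (sgn x) * f (sgn x)) \<in> borel_measurable borel"
proof -
  have m: "(\<lambda>x. indicator (sphere 0 1) x * f x) \<in> borel_measurable borel"
    using f by (subst (asm) borel_measurable_restrict_space_iff) auto
  then show "(\<lambda>x. indicator (sphere 0 1) (sgn x) * f (sgn x)) \<in> borel_measurable borel"
    using measurable_compose[OF borel_measurable_sgn_euclidean m] by simp
  have "(\<integral>x. f x \<partial>sphere_measure)
      = (\<integral>x. f x \<partial>(restrict_space (distr ball_measure borel sgn) (sphere 0 1)))"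
    unfolding sphere_measure_def
    by (rule integral_completion[OF restrict_borel_measurable_sphere_base[OF f]])
  also have "\<dots> = (\<integral>x. indicator (sphere 0 1) x * f x \<partial>distr ball_measure borel sgn)"
    by (subst integral_restrict_space) auto
  also have "\<dots> = (\<integral>x. indicator (sphere 0 1) (sgn x) * f (sgn x) \<partial>ball_measure)"
    by (subst integral_distr) (use m in auto)
  finally show "(\<integral>x. f x \<partial>sphere_measure) = (\<integral>x. indicator (sphere 0 1) (sgn x) * f (sgn x) \<partial>ball_measure)" .
qed

lemma orthogonal_transformation_continuous:
  fixes R :: "'a::euclidean_space \<Rightarrow> 'a"
  shows "orthogonal_transformation R \<Longrightarrow> continuous_on S R"
  using orthogonal_transformation_linear linear_continuous_on linear_conv_bounded_linear by blast

lemma continuous_on_sphere_orthogonal: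
  fixes R :: "'a::euclidean_space \<Rightarrow> 'a"
  assumes R: "orthogonal_transformation R" and f: "continuous_on (sphere 0 1) f"
  shows "continuous_on (sphere 0 1) (\<lambda>x. f (R x))"
  using R by (intro continuous_on_compose2[OF f] orthogonal_transformation_continuous)
    (auto simp: orthogonal_transformation)

lemma integral_sphere_orthogonal:
  fixes R :: "'a::euclidean_space \<Rightarrow> 'a" and f :: "'a \<Rightarrow> real"
  assumes R: "orthogonal_transformation R" and f: "continuous_on (sphere 0 1) f"
  shows "(\<integral>x. f (R x) \<partial>sphere_measure) = (\<integral>x. f x \<partial>sphere_measure)"
proof -
  have lin: "linear R" and nrm: "\<And>x. norm (R x) = norm x"
    using R by (auto simp: orthogonal_transformation)
  have sgnR: "sgn (R x) = R (sgn x)" for x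
    by (simp add: sgn_div_norm nrm linear_scale[OF lin])
  let ?g = "\<lambda>x. indicator (sphere 0 1) (sgn x) * f (sgn x)"
  note m = borel_measurable_continuous_on_restrict[OF f]
  have "(\<integral>x. f (R x) \<partial>sphere_measure) = (\<integral>x. ?g (R x) \<partial>ball_measure)"
    by (subst integral_sphere_measure[OF borel_measurable_continuous_on_restrict[OF
            continuous_on_sphere_orthogonal[OF R f]]])
       (auto intro!: Bochner_Integration.integral_cong simp: sgnR nrm split: split_indicator)
  also have "\<dots> = (\<integral>x. ?g x \<partial>distr ball_measure borel R)"
    using integral_sphere_measure(2)[OF m] orthogonal_transformation_measurable[OF R]
    by (subst integral_distr) auto
  also have "\<dots> = (\<integral>x. f x \<partial>sphere_measure)"
    unfolding ball_measure_distr_orthogonal[OF R] by (rule integral_sphere_measure(1)[OF m, symmetric])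
  finally show ?thesis .
qed

text \<open>The surface measure has full support: the cone over a spherical cap contains a ball.\<close>
lemma continuous_nonneg_integral_zero:
  fixes f :: "'a::euclidean_space \<Rightarrow> real"
  assumes f: "continuous_on (sphere 0 1) f" and nonneg: "\<And>x. x \<in> sphere 0 1 \<Longrightarrow> 0 \<le> f x"
    and int: "(\<integral>x. f x \<partial>sphere_measure) = 0" and x0: "x0 \<in> sphere 0 1"
  shows "f x0 = 0"
proof (rule ccontr)
  assume "f x0 \<noteq> 0"
  then have pos: "0 < f x0" using nonneg[OF x0] by simp
  let ?g = "\<lambda>x. indicator (sphere 0 1) (sgn x) * f (sgn x)"
  interpret prob_space "ball_measure :: 'a measure" by (rule prob_space_ball_measure)
  note m = integral_sphere_measure(2)[OF borel_measurable_continuous_on_restrict[OF f]]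
  obtain C where C: "\<forall>x\<in>sphere 0 1. \<bar>f x\<bar> \<le> C" "0 \<le> C"
    using continuous_on_sphere_bounded[OF f] by blast
  have "integrable ball_measure ?g"
    by (rule integrable_const_bound[where B=C]) (use C m in \<open>auto split: split_indicator\<close>)
  moreover have "(\<integral>x. ?g x \<partial>ball_measure) = 0"
    using integral_sphere_measure(1)[OF borel_measurable_continuous_on_restrict[OF f]] int by simp
  ultimately have "AE x in ball_measure. ?g x = 0"
    using nonneg by (subst (asm) integral_nonneg_eq_0_iff_AE) (auto split: split_indicator)
  then have ae: "AE x in lborel. x \<in> ball 0 1 \<longrightarrow> ?g x = 0"
    using emeasure_unit_ball[where 'a='a] by (simp add: AE_uniform_measure)
  obtain \<delta> where \<delta>: "\<delta> > 0" "\<And>x. x \<in> sphere 0 1 \<Longrightarrow> dist x x0 < \<delta> \<Longrightarrow> dist (f x) (f x0) < f x0"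
    using f x0 pos unfolding continuous_on_iff by metis
  have "isCont sgn ((1/2) *\<^sub>R x0)" using x0 by (intro isCont_sgn) auto
  moreover have sx: "sgn ((1/2) *\<^sub>R x0) = x0" using x0 by (simp add: sgn_scaleR sgn_div_norm)
  ultimately obtain e where e: "e > 0" "\<And>y. dist y ((1/2) *\<^sub>R x0) < e \<Longrightarrow> dist (sgn y) x0 < \<delta>"
    using \<delta>(1) unfolding continuous_at_eps_delta by metis
  let ?r = "min e (1/2)"
  have bad: "y \<in> ball 0 1 \<and> ?g y \<noteq> 0" if y: "y \<in> ball ((1/2) *\<^sub>R x0) ?r" for y
  proof -
    have d: "dist y ((1/2) *\<^sub>R x0) < e" "dist y ((1/2) *\<^sub>R x0) < 1/2" using y by (auto simp: dist_commute)
    have h: "norm ((1/2) *\<^sub>R x0) = 1/2" using x0 by simp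
    have "norm y < 1" using d(2) h norm_triangle_sub[of y "(1/2) *\<^sub>R x0"] by (simp add: dist_norm)
    moreover have "y \<noteq> 0" using d(2) h by (auto simp: dist_norm)
    then have "sgn y \<in> sphere 0 1" by (simp add: norm_sgn)
    moreover have "f (sgn y) > 0"
      using \<delta>(2)[OF \<open>sgn y \<in> sphere 0 1\<close> e(2)[OF d(1)]] by (auto simp: dist_real_def)
    ultimately show ?thesis by auto
  qed
  from ae have "AE x in lborel. x \<notin> ball ((1/2) *\<^sub>R x0) ?r"
    by eventually_elim (use bad in blast)
  then have "emeasure lborel (ball ((1/2) *\<^sub>R x0) ?r) = 0"
    by (subst (asm) AE_iff_null_sets[symmetric]) (auto simp: null_sets_def)
  then show False
    using content_ball_pos[of ?r "(1/2) *\<^sub>R x0"] e(1) by (simp add: measure_def)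
qed

section \<open>Integration by parts on the sphere\<close>

lemma rpf_continuous_on:
  "real_polynomial_function p \<Longrightarrow> continuous_on S p"
  by (simp add: continuous_on_polymonial_function real_polynomial_function_eq)

lemma rpf_has_derivative:
  fixes p :: "'a::euclidean_space \<Rightarrow> real"
  assumes "real_polynomial_function p"
  shows "\<exists>D. (p has_derivative D) (at x) \<and> (\<forall>v. D v = pd v p x)"
proof -
  have "p differentiable at x"
    using assms differentiable_at_polynomial_function real_polynomial_function_eq by blast
  then obtain D where D: "(p has_derivative D) (at x)"
    by (auto simp: differentiable_def)
  have "D v = pd v p x" for v
  proof -
    have "((\<lambda>t. x + t *\<^sub>R v) has_derivative (\<lambda>t. t *\<^sub>R v)) (at 0)"
      by (auto intro!: derivative_eq_intros)
    moreover have "(p has_derivative D) (at (x + 0 *\<^sub>R v))" using D by simp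
    ultimately have "((\<lambda>t. p (x + t *\<^sub>R v)) has_derivative (\<lambda>t. D (t *\<^sub>R v))) (at 0)"
      by (rule has_derivative_compose)
    moreover have "(\<lambda>t. D (t *\<^sub>R v)) = (\<lambda>t. t * D v)"
      using has_derivative_linear[OF D] by (simp add: linear_scale)
    ultimately have "((\<lambda>t. p (x + t *\<^sub>R v)) has_real_derivative D v) (at 0)"
      by (simp add: has_field_derivative_def mult_commute_abs)
    then show ?thesis by (simp add: pdI)
  qed
  then show ?thesis using D by blast
qed

lemma rpf_lipschitz_cball:
  fixes p :: "'a::euclidean_space \<Rightarrow> real"
  assumes "real_polynomial_function p"
  shows "\<exists>C\<ge>0. \<forall>x\<in>cball 0 1. \<forall>y\<in>cball 0 1. \<bar>p x - p y\<bar> \<le> C * norm (x - y)"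
  using assms
proof induction
  case (linear f)
  obtain K where K: "K \<ge> 0" "\<And>x. norm (f x) \<le> norm x * K"
    using bounded_linear.nonneg_bounded[OF linear] by blast
  have "\<bar>f x - f y\<bar> \<le> K * norm (x - y)" for x y
    using K(2)[of "x - y"] linear_diff[OF bounded_linear.linear[OF linear]] by (simp add: mult.commute)
  then show ?case using K(1) by blast
next
  case (const c)
  then show ?case by (intro exI[of _ 0]) auto
next
  case (add f g)
  then obtain C1 C2 where C: "C1 \<ge> 0" "\<And>x y. x \<in> cball 0 1 \<Longrightarrow> y \<in> cball 0 1 \<Longrightarrow> \<bar>f x - f y\<bar> \<le> C1 * norm (x - y)"
    "C2 \<ge> 0" "\<And>x y. x \<in> cball 0 1 \<Longrightarrow> y \<in> cball 0 1 \<Longrightarrow> \<bar>g x - g y\<bar> \<le> C2 * norm (x - y)" by blast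
  have "\<bar>(f x + g x) - (f y + g y)\<bar> \<le> (C1 + C2) * norm (x - y)"
    if "x \<in> cball 0 1" "y \<in> cball 0 1" for x y
    using C(2)[OF that] C(4)[OF that] by (simp add: algebra_simps)
  then show ?case using C by (intro exI[of _ "C1 + C2"]) auto
next
  case (mult f g)
  then obtain C1 C2 where C: "C1 \<ge> 0" "\<And>x y. x \<in> cball 0 1 \<Longrightarrow> y \<in> cball 0 1 \<Longrightarrow> \<bar>f x - f y\<bar> \<le> C1 * norm (x - y)"
    "C2 \<ge> 0" "\<And>x y. x \<in> cball 0 1 \<Longrightarrow> y \<in> cball 0 1 \<Longrightarrow> \<bar>g x - g y\<bar> \<le> C2 * norm (x - y)" by blast
  have bd: "\<exists>B\<ge>0. \<forall>x\<in>cball 0 1. \<bar>h x\<bar> \<le> B" if "real_polynomial_function h" for h :: "'a \<Rightarrow> real"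
  proof -
    have "bounded (h ` cball 0 1)"
      using rpf_continuous_on[OF that] compact_continuous_image compact_cball compact_imp_bounded by blast
    then obtain B where "\<forall>x\<in>cball 0 1. \<bar>h x\<bar> \<le> B" by (auto simp: bounded_iff)
    then show ?thesis by (intro exI[of _ "max B 0"]) (auto intro: order_trans)
  qed
  obtain B1 B2 where B: "B1 \<ge> 0" "\<And>x. x \<in> cball 0 1 \<Longrightarrow> \<bar>f x\<bar> \<le> B1"
    "B2 \<ge> 0" "\<And>x. x \<in> cball 0 1 \<Longrightarrow> \<bar>g x\<bar> \<le> B2"
    using bd[OF mult.hyps(1)] bd[OF mult.hyps(2)] by blast
  have "\<bar>f x * g x - f y * g y\<bar> \<le> (B1 * C2 + B2 * C1) * norm (x - y)"
    if xy: "x \<in> cball 0 1" "y \<in> cball 0 1" for x y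
  proof -
    have "f x * g x - f y * g y = f x * (g x - g y) + g y * (f x - f y)" by (simp add: algebra_simps)
    also have "\<bar>\<dots>\<bar> \<le> \<bar>f x\<bar> * \<bar>g x - g y\<bar> + \<bar>g y\<bar> * \<bar>f x - f y\<bar>"
      by (metis abs_triangle_ineq abs_mult)
    also have "\<dots> \<le> B1 * (C2 * norm (x - y)) + B2 * (C1 * norm (x - y))"
      using B C xy by (intro add_mono mult_mono) auto
    finally show ?thesis by (simp add: algebra_simps)
  qed
  then show ?case using B C by (intro exI[of _ "B1 * C2 + B2 * C1"]) auto
qed

text \<open>The rotation by the angle t in the plane of b and c, written as a perturbation of the identity
  to make its derivative at t = 0 visible.\<close>
definition plane_rotation :: "'a::euclidean_space \<Rightarrow> 'a \<Rightarrow> real \<Rightarrow> 'a \<Rightarrow> 'a" where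
  "plane_rotation b c t x =
     x + ((cos t - 1) * (x \<bullet> b) - sin t * (x \<bullet> c)) *\<^sub>R b
       + ((cos t - 1) * (x \<bullet> c) + sin t * (x \<bullet> b)) *\<^sub>R c"

lemma plane_rotation_orthogonal:
  assumes "b \<in> Basis" "c \<in> Basis" "b \<noteq> c"
  shows "orthogonal_transformation (plane_rotation b c t)"
  unfolding orthogonal_transformation_def
proof (intro conjI allI)
  show "linear (plane_rotation b c t)"
    by (rule linearI) (simp_all add: plane_rotation_def algebra_simps inner_add_left)
  fix v w :: 'a
  have bc: "b \<bullet> b = 1" "c \<bullet> c = 1" "b \<bullet> c = 0" "c \<bullet> b = 0" using assms by (auto simp: inner_Basis)
  define \<alpha> where "\<alpha> v = (cos t - 1) * (v \<bullet> b) - sin t * (v \<bullet> c)" for v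
  define \<beta> where "\<beta> v = (cos t - 1) * (v \<bullet> c) + sin t * (v \<bullet> b)" for v
  have "plane_rotation b c t v \<bullet> plane_rotation b c t w
      = v \<bullet> w + (\<alpha> w * (v \<bullet> b) + \<beta> w * (v \<bullet> c) + \<alpha> v * (w \<bullet> b) + \<beta> v * (w \<bullet> c) + \<alpha> v * \<alpha> w + \<beta> v * \<beta> w)"
    unfolding plane_rotation_def \<alpha>_def[symmetric] \<beta>_def[symmetric]
    by (simp add: inner_add_left inner_add_right bc inner_commute algebra_simps)
  also have "\<alpha> w * (v \<bullet> b) + \<beta> w * (v \<bullet> c) + \<alpha> v * (w \<bullet> b) + \<beta> v * (w \<bullet> c) + \<alpha> v * \<alpha> w + \<beta> v * \<beta> w
      = ((cos t)\<^sup>2 + (sin t)\<^sup>2 - 1) * ((v \<bullet> b) * (w \<bullet> b) + (v \<bullet> c) * (w \<bullet> c))"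
    unfolding \<alpha>_def \<beta>_def power2_eq_square by algebra
  finally show "plane_rotation b c t v \<bullet> plane_rotation b c t w = v \<bullet> w" by simp
qed

lemma plane_rotation_has_derivative:
  "((\<lambda>t. plane_rotation b c t x) has_derivative (\<lambda>t. t *\<^sub>R ((x \<bullet> b) *\<^sub>R c - (x \<bullet> c) *\<^sub>R b))) (at 0)"
  unfolding plane_rotation_def
  by (auto intro!: derivative_eq_intros ext simp: algebra_simps)

lemma abs_cos_diff_one_le: "\<bar>cos t - 1\<bar> \<le> \<bar>t::real\<bar>"
proof -
  have "cos t - 1 = - (2 * (sin (t / 2))\<^sup>2)"
    using cos_double_sin[of "t / 2"] by simp
  also have "\<bar>\<dots>\<bar> = 2 * \<bar>sin (t / 2)\<bar> * \<bar>sin (t / 2)\<bar>"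
    by (simp add: power2_eq_square abs_mult)
  also have "\<dots> \<le> 2 * \<bar>t / 2\<bar> * 1"
    using abs_sin_x_le_abs_x[of "t / 2"] abs_sin_le_one[of "t / 2"] by (intro mult_mono) auto
  finally show ?thesis by simp
qed

lemma plane_rotation_dist:
  assumes "b \<in> Basis" "c \<in> Basis" "norm x = 1"
  shows "norm (plane_rotation b c t x - x) \<le> 4 * \<bar>t\<bar>"
proof -
  have xb: "\<bar>x \<bullet> b\<bar> \<le> 1" "\<bar>x \<bullet> c\<bar> \<le> 1"
    using Basis_le_norm[OF assms(1), of x] Basis_le_norm[OF assms(2), of x] assms(3) by auto
  have t: "\<bar>cos t - 1\<bar> \<le> \<bar>t\<bar>" "\<bar>sin t\<bar> \<le> \<bar>t\<bar>"
    using abs_cos_diff_one_le abs_sin_x_le_abs_x by auto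
  have p: "\<bar>(cos t - 1) * u\<bar> \<le> \<bar>t\<bar>" "\<bar>sin t * u\<bar> \<le> \<bar>t\<bar>" if "\<bar>u\<bar> \<le> 1" for u
    using mult_mono[OF t(1) that] mult_mono[OF t(2) that] by (auto simp: abs_mult)
  have "norm (plane_rotation b c t x - x)
    \<le> norm (((cos t - 1) * (x \<bullet> b) - sin t * (x \<bullet> c)) *\<^sub>R b)
      + norm (((cos t - 1) * (x \<bullet> c) + sin t * (x \<bullet> b)) *\<^sub>R c)"
    unfolding plane_rotation_def by (metis add.assoc add_diff_cancel_left' norm_triangle_ineq)
  also have "\<dots> = \<bar>(cos t - 1) * (x \<bullet> b) - sin t * (x \<bullet> c)\<bar> + \<bar>(cos t - 1) * (x \<bullet> c) + sin t * (x \<bullet> b)\<bar>"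
    using assms by simp
  also have "\<dots> \<le> 4 * \<bar>t\<bar>"
    using p(1)[OF xb(1)] p(1)[OF xb(2)] p(2)[OF xb(1)] p(2)[OF xb(2)] by linarith
  finally show ?thesis .
qed

text \<open>The integral of F over the rotated sphere does not depend on the angle; this is its derivative
  at 0. The Lipschitz bound on F dominates the difference quotients.\<close>
lemma integral_rotation_field:
  fixes F :: "'a::euclidean_space \<Rightarrow> real"
  assumes F: "real_polynomial_function F" and bc: "b \<in> Basis" "c \<in> Basis"
  shows "(\<integral>x. (x \<bullet> b) * pd c F x - (x \<bullet> c) * pd b F x \<partial>sphere_measure) = 0"
proof (cases "b = c")
  case True
  then show ?thesis by simp
next
  case False
  interpret prob_space "sphere_measure :: 'a measure" by (rule prob_space_sphere_measure)
  define R where "R t = plane_rotation b c t" for t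
  have orth: "orthogonal_transformation (R t)" for t
    unfolding R_def by (rule plane_rotation_orthogonal[OF bc False])
  define s where "s n = 1 / real (Suc n)" for n
  have s0: "s n > 0" for n by (simp add: s_def)
  have slim: "s \<longlonglongrightarrow> 0" unfolding s_def using LIMSEQ_inverse_real_of_nat by (simp add: inverse_eq_divide)
  define g where "g n x = (F (R (s n) x) - F x) / s n" for n x
  obtain C where C: "C \<ge> 0" "\<And>x y. x \<in> cball 0 1 \<Longrightarrow> y \<in> cball 0 1 \<Longrightarrow> \<bar>F x - F y\<bar> \<le> C * norm (x - y)"
    using rpf_lipschitz_cball[OF F] by blast
  let ?G = "\<lambda>x. (x \<bullet> b) * pd c F x - (x \<bullet> c) * pd b F x"
  note cont = rpf_continuous_on[OF F, of "sphere 0 1"]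
  note contR = continuous_on_sphere_orthogonal[OF orth cont]
  have gcont: "continuous_on (sphere 0 1) (g n)" for n
    unfolding g_def using s0[of n] by (intro continuous_intros contR cont) auto
  have "(\<lambda>n. \<integral>x. g n x \<partial>sphere_measure) \<longlonglongrightarrow> (\<integral>x. ?G x \<partial>sphere_measure)"
  proof (rule integral_dominated_convergence[where w="\<lambda>_. 4 * C"])
    show "?G \<in> borel_measurable sphere_measure"
      by (intro continuous_on_sphere_measurable continuous_intros rpf_continuous_on rpf_pd F)
    show "g n \<in> borel_measurable sphere_measure" for n
      by (rule continuous_on_sphere_measurable[OF gcont])
    show "AE x in sphere_measure. (\<lambda>n. g n x) \<longlonglongrightarrow> ?G x"
    proof (rule AE_I2)
      fix x :: 'a
      obtain D where D: "(F has_derivative D) (at x)" "\<And>v. D v = pd v F x"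
        using rpf_has_derivative[OF F] by blast
      have "R 0 x = x" by (simp add: R_def plane_rotation_def)
      then have "(F has_derivative D) (at (R 0 x))" using D by simp
      from has_derivative_compose[OF plane_rotation_has_derivative[of b c x, folded R_def] this]
      have "((\<lambda>t. F (R t x)) has_derivative (\<lambda>t. D (t *\<^sub>R ((x \<bullet> b) *\<^sub>R c - (x \<bullet> c) *\<^sub>R b)))) (at 0)" .
      moreover have "(\<lambda>t. D (t *\<^sub>R ((x \<bullet> b) *\<^sub>R c - (x \<bullet> c) *\<^sub>R b))) = (\<lambda>t. t * ?G x)"
        using has_derivative_linear[OF D(1)] unfolding D(2)[symmetric]
        by (simp add: linear_scale linear_diff algebra_simps)
      ultimately have "((\<lambda>t. F (R t x)) has_real_derivative ?G x) (at 0)"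
        by (simp add: has_field_derivative_def mult_commute_abs)
      then have lim: "((\<lambda>t. (F (R t x) - F x) / t) \<longlongrightarrow> ?G x) (at 0)"
        using \<open>R 0 x = x\<close> by (simp add: DERIV_def)
      have "filterlim s (at 0) sequentially"
        using slim s0 by (auto simp: filterlim_at less_imp_neq[THEN not_sym])
      from filterlim_compose[OF lim this]
      show "(\<lambda>n. g n x) \<longlonglongrightarrow> ?G x" unfolding g_def .
    qed
    show "AE x in sphere_measure. norm (g n x) \<le> 4 * C" for n
    proof (rule AE_I2)
      fix x :: 'a assume "x \<in> space sphere_measure"
      then have nx: "norm x = 1" by simp
      then have "norm (R (s n) x) = 1" using orth by (simp add: orthogonal_transformation)
      then have "\<bar>F (R (s n) x) - F x\<bar> \<le> C * norm (R (s n) x - x)" using C(2) nx by simp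
      also have "\<dots> \<le> C * (4 * s n)"
        using plane_rotation_dist[OF bc nx, of "s n"] C(1) s0[of n]
        by (intro mult_left_mono) (auto simp: R_def)
      finally show "norm (g n x) \<le> 4 * C"
        using s0[of n] by (simp add: g_def field_simps)
    qed
  qed simp
  moreover have "(\<integral>x. g n x \<partial>sphere_measure) = 0" for n
    unfolding g_def using integral_sphere_orthogonal[OF orth cont, of "s n"]
    by (simp add: Bochner_Integration.integral_diff integrable_continuous_on_sphere cont contR)
  ultimately show ?thesis by (simp add: LIMSEQ_const_iff)
qed

lemma integral_sphere_sum:
  fixes f :: "'i \<Rightarrow> 'a::euclidean_space \<Rightarrow> real"
  assumes "\<And>i. i \<in> I \<Longrightarrow> continuous_on (sphere 0 1) (f i)"
  shows "(\<integral>x. (\<Sum>i\<in>I. f i x) \<partial>sphere_measure) = (\<Sum>i\<in>I. \<integral>x. f i x \<partial>sphere_measure)"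
  by (intro Bochner_Integration.integral_sum integrable_continuous_on_sphere assms)

text \<open>Integration by parts on the sphere. Apply integral_rotation_field to the product of G with the
  coordinate c, and sum over c: since |x| = 1, the derivatives of G in direction b are collected into
  one, and the others into the radial derivative, which Euler's formula evaluates.\<close>
lemma integral_sphere_pd:
  fixes G :: "'a::euclidean_space \<Rightarrow> real"
  assumes G: "hom_poly Basis m G" and b: "b \<in> Basis"
  shows "(\<integral>x. pd b G x \<partial>sphere_measure)
    = (real DIM('a) - 1 + real m) * (\<integral>x. (x \<bullet> b) * G x \<partial>sphere_measure)"
proof -
  note Gr = hom_poly_rpf[OF G]
  let ?T = "\<lambda>c x. (x \<bullet> b) * pd c (\<lambda>x. (x \<bullet> c) * G x) x - (x \<bullet> c) * pd b (\<lambda>x. (x \<bullet> c) * G x) x"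
  have cont: "continuous_on (sphere 0 1) (?T c)" for c
    by (intro continuous_intros rpf_continuous_on rpf_pd rpf_mult rpf_inner Gr)
  have "0 = (\<Sum>c\<in>Basis. \<integral>x. ?T c x \<partial>sphere_measure)"
    using integral_rotation_field[OF rpf_mult[OF rpf_inner Gr] b] by simp
  also have "\<dots> = (\<integral>x. (\<Sum>c\<in>Basis. ?T c x) \<partial>sphere_measure)"
    by (rule integral_sphere_sum[symmetric]) (rule cont)
  also have "\<dots> = (\<integral>x. (real DIM('a) - 1 + real m) * ((x \<bullet> b) * G x) - pd b G x \<partial>sphere_measure)"
  proof (rule Bochner_Integration.integral_cong[OF refl])
    fix x :: 'a assume "x \<in> space sphere_measure"
    then have x: "x \<bullet> x = 1" by (simp add: norm_eq_sqrt_inner)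
    have "?T c x = (x \<bullet> b) * G x + (x \<bullet> b) * ((x \<bullet> c) * pd c G x)
        - (if c = b then (x \<bullet> b) * G x else 0) - (x \<bullet> c) * (x \<bullet> c) * pd b G x" if "c \<in> Basis" for c
      unfolding pd_mult[OF rpf_inner Gr] pd_inner using that b by (auto simp: inner_Basis algebra_simps)
    then have "(\<Sum>c\<in>Basis. ?T c x) = (\<Sum>c\<in>Basis. (x \<bullet> b) * G x + (x \<bullet> b) * ((x \<bullet> c) * pd c G x)
        - (if c = b then (x \<bullet> b) * G x else 0) - (x \<bullet> c) * (x \<bullet> c) * pd b G x)"
      by (rule sum.cong[OF refl])
    also have "\<dots> = real DIM('a) * ((x \<bullet> b) * G x) + (x \<bullet> b) * (\<Sum>c\<in>Basis. (x \<bullet> c) * pd c G x)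
        - (x \<bullet> b) * G x - (\<Sum>c\<in>Basis. (x \<bullet> c) * (x \<bullet> c)) * pd b G x"
      using b by (simp add: sum.distrib sum_subtractf sum_distrib_left sum_distrib_right)
    also have "(\<Sum>c\<in>Basis. (x \<bullet> c) * (x \<bullet> c)) = 1"
      using x by (simp only: euclidean_inner[of x x])
    finally show "(\<Sum>c\<in>Basis. ?T c x) = (real DIM('a) - 1 + real m) * ((x \<bullet> b) * G x) - pd b G x"
      by (simp add: euler_hom_poly[OF G] algebra_simps)
  qed
  also have "\<dots> = (\<integral>x. (real DIM('a) - 1 + real m) * ((x \<bullet> b) * G x) \<partial>sphere_measure)
      - (\<integral>x. pd b G x \<partial>sphere_measure)"
    by (rule Bochner_Integration.integral_diff)
      (intro integrable_continuous_on_sphere continuous_intros rpf_continuous_on rpf_pd rpf_mult rpf_inner Gr)+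
  finally show ?thesis by simp
qed

text \<open>For harmonic p the divergence of the field q * grad p is the scalar product of the two gradients,
  and its radial component is l * p * q.\<close>
lemma integral_sphere_gradients:
  fixes p q :: "'a::euclidean_space \<Rightarrow> real"
  assumes p: "harmonic_poly l p" and q: "hom_poly Basis m q"
  shows "(\<integral>x. (\<Sum>b\<in>Basis. pd b p x * pd b q x) \<partial>sphere_measure)
    = (real DIM('a) - 2 + real l + real m) * (real l * (\<integral>x. p x * q x \<partial>sphere_measure))"
proof (cases "l = 0")
  case True
  then obtain c where "p = (\<lambda>x. c)" using p hom_poly_0_const unfolding harmonic_poly_def by blast
  then show ?thesis using True by simp
next
  case False
  have pr: "real_polynomial_function p" and qr: "real_polynomial_function q"
    and hp: "hom_poly Basis l p"
    using p q hom_poly_rpf harmonic_poly_rpf by (auto simp: harmonic_poly_def)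
  have "(\<integral>x. (\<Sum>b\<in>Basis. pd b p x * pd b q x) \<partial>sphere_measure)
      = (\<integral>x. (\<Sum>b\<in>Basis. pd b (\<lambda>x. pd b p x * q x) x) \<partial>sphere_measure)"
  proof (rule Bochner_Integration.integral_cong[OF refl])
    fix x :: 'a
    have "(\<Sum>b\<in>Basis. pd b (\<lambda>x. pd b p x * q x) x)
        = laplacian p x * q x + (\<Sum>b\<in>Basis. pd b p x * pd b q x)"
      by (simp add: pd_mult rpf_pd pr qr laplacian_eq sum.distrib sum_distrib_right)
    then show "(\<Sum>b\<in>Basis. pd b p x * pd b q x) = (\<Sum>b\<in>Basis. pd b (\<lambda>x. pd b p x * q x) x)"
      using p by (simp add: harmonic_poly_def)
  qed
  also have "\<dots> = (\<Sum>b\<in>Basis. \<integral>x. pd b (\<lambda>x. pd b p x * q x) x \<partial>sphere_measure)"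
    by (intro integral_sphere_sum rpf_continuous_on rpf_pd rpf_mult pr qr)
  also have "\<dots> = (\<Sum>b\<in>Basis. (real DIM('a) - 1 + real (l - 1 + m)) *
      (\<integral>x. (x \<bullet> b) * (pd b p x * q x) \<partial>sphere_measure))"
    by (intro sum.cong refl integral_sphere_pd hom_poly_mult hom_poly_pd hp q)
  also have "\<dots> = (real DIM('a) - 1 + real (l - 1 + m)) *
      (\<integral>x. (\<Sum>b\<in>Basis. (x \<bullet> b) * (pd b p x * q x)) \<partial>sphere_measure)"
    unfolding sum_distrib_left[symmetric]
    by (subst integral_sphere_sum) (intro rpf_continuous_on rpf_mult rpf_inner rpf_pd pr qr refl)+
  also have "(\<lambda>x. \<Sum>b\<in>Basis. (x \<bullet> b) * (pd b p x * q x)) = (\<lambda>x. real l * (p x * q x))"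
    using euler_hom_poly[OF hp] by (simp add: mult.assoc[symmetric] sum_distrib_right[symmetric])
  finally show ?thesis using False by (simp add: of_nat_diff)
qed

text \<open>The left-hand side of integral_sphere_gradients is symmetric in p and q, so a positive
  multiple of l - m annihilates the inner product of p and q.\<close>
lemma harmonic_poly_orthogonal:
  fixes p q :: "'a::euclidean_space \<Rightarrow> real"
  assumes p: "harmonic_poly l p" and q: "harmonic_poly m q" and "l \<noteq> m" and "DIM('a) \<ge> 2"
  shows "(\<integral>x. p x * q x \<partial>sphere_measure) = 0"
proof -
  have pq: "hom_poly Basis l p" "hom_poly Basis m q" using p q by (auto simp: harmonic_poly_def)
  have "(real DIM('a) - 2 + real l + real m) * (real l * (\<integral>x. p x * q x \<partial>sphere_measure))
      = (\<integral>x. (\<Sum>b\<in>Basis. pd b p x * pd b q x) \<partial>sphere_measure)"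
    by (rule integral_sphere_gradients[OF p pq(2), symmetric])
  also have "\<dots> = (\<integral>x. (\<Sum>b\<in>Basis. pd b q x * pd b p x) \<partial>sphere_measure)"
    by (simp only: mult.commute)
  also have "\<dots> = (real DIM('a) - 2 + real m + real l) * (real m * (\<integral>x. q x * p x \<partial>sphere_measure))"
    by (rule integral_sphere_gradients[OF q pq(1)])
  also have "(\<integral>x. q x * p x \<partial>sphere_measure) = (\<integral>x. p x * q x \<partial>sphere_measure)"
    by (simp only: mult.commute)
  finally have "(real DIM('a) - 2 + real l + real m) * (real l * (\<integral>x. p x * q x \<partial>sphere_measure))
      = (real DIM('a) - 2 + real m + real l) * (real m * (\<integral>x. p x * q x \<partial>sphere_measure))" .
  then have "(real DIM('a) - 2 + real l + real m) * ((real l - real m) * (\<integral>x. p x * q x \<partial>sphere_measure)) = 0"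
    by (simp add: algebra_simps)
  moreover have "real DIM('a) - 2 + real l + real m \<noteq> 0"
    using assms(3,4) by (auto simp: add_nonneg_eq_0_iff)
  ultimately show ?thesis using assms(3) by simp
qed

lemma pd_expand:
  fixes p :: "'a::euclidean_space \<Rightarrow> real"
  assumes "real_polynomial_function p"
  shows "pd v p x = (\<Sum>b\<in>Basis. (v \<bullet> b) * pd b p x)"
proof -
  obtain D where D: "(p has_derivative D) (at x)" "\<And>v. D v = pd v p x"
    using rpf_has_derivative[OF assms] by blast
  have lin: "linear D" using has_derivative_linear[OF D(1)] .
  have "D v = D (\<Sum>b\<in>Basis. (v \<bullet> b) *\<^sub>R b)" by (simp add: euclidean_representation)
  also have "\<dots> = (\<Sum>b\<in>Basis. (v \<bullet> b) * D b)"
    using lin by (simp add: linear_sum linear_scale)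
  finally show ?thesis by (simp add: D(2))
qed

section \<open>Invariance of harmonic polynomials under isometries\<close>

lemma rpf_orthogonal:
  fixes R :: "'a::euclidean_space \<Rightarrow> 'a"
  assumes "orthogonal_transformation R" "real_polynomial_function p"
  shows "real_polynomial_function (\<lambda>x. p (R x))"
proof -
  have "polynomial_function R"
    using orthogonal_transformation_linear[OF assms(1)]
    by (intro polynomial_function_bounded_linear) (simp add: linear_conv_bounded_linear)
  then show ?thesis
    using real_polynomial_function_compose[OF _ assms(2)] by (simp add: o_def)
qed

text \<open>The Laplacian is the trace of the second derivative, and the vectors R b are an orthonormal basis
  as well.\<close>
lemma laplacian_orthogonal:
  fixes R :: "'a::euclidean_space \<Rightarrow> 'a"
  assumes R: "orthogonal_transformation R" and p: "real_polynomial_function p"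
  shows "laplacian (\<lambda>x. p (R x)) x = laplacian p (R x)"
proof -
  have lin: "linear R" and inner: "\<And>v w. R v \<bullet> R w = v \<bullet> w"
    using R by (auto simp: orthogonal_transformation_def)
  have pdR: "pd b (\<lambda>x. q (R x)) = (\<lambda>x. pd (R b) q (R x))" if "real_polynomial_function q" for q b
  proof (rule ext, rule pdI)
    fix x
    show "((\<lambda>t. q (R (x + t *\<^sub>R b))) has_real_derivative pd (R b) q (R x)) (at 0)"
      using pd_has_real_derivative_0[OF that, of "R x" "R b"]
      by (simp add: linear_add[OF lin] linear_scale[OF lin])
  qed
  obtain S where S: "\<And>x. R (S x) = x"
    using orthogonal_transformation_surj[OF R] by (metis surjD)
  have trace: "(\<Sum>b\<in>Basis. (R b \<bullet> c) * (R b \<bullet> c')) = c \<bullet> c'" for c c'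
  proof -
    have "(\<Sum>b\<in>Basis. (R b \<bullet> c) * (R b \<bullet> c')) = (\<Sum>b\<in>Basis. (S c \<bullet> b) * (S c' \<bullet> b))"
      using inner[of _ "S c"] inner[of _ "S c'"] by (simp add: S inner_commute)
    also have "\<dots> = S c \<bullet> S c'" by (rule euclidean_inner[symmetric])
    also have "\<dots> = c \<bullet> c'" using inner[of "S c" "S c'"] by (simp add: S)
    finally show ?thesis .
  qed
  have "laplacian (\<lambda>x. p (R x)) x = (\<Sum>b\<in>Basis. pd (R b) (pd (R b) p) (R x))"
    by (simp add: laplacian_eq[OF rpf_orthogonal[OF R p]] pdR p rpf_pd)
  also have "\<dots> = (\<Sum>b\<in>Basis. \<Sum>c\<in>Basis. \<Sum>c'\<in>Basis. (R b \<bullet> c) * (R b \<bullet> c') * pd c (pd c' p) (R x))"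
  proof (rule sum.cong[OF refl])
    fix b :: 'a
    have "pd (R b) p = (\<lambda>y. \<Sum>c'\<in>Basis. (R b \<bullet> c') * pd c' p y)"
      using pd_expand[OF p] by blast
    then have "pd c (pd (R b) p) (R x) = (\<Sum>c'\<in>Basis. (R b \<bullet> c') * pd c (pd c' p) (R x))" for c
      by (simp add: pd_sum rpf_mult rpf_const rpf_pd p pd_cmult)
    then show "pd (R b) (pd (R b) p) (R x)
        = (\<Sum>c\<in>Basis. \<Sum>c'\<in>Basis. (R b \<bullet> c) * (R b \<bullet> c') * pd c (pd c' p) (R x))"
      by (subst pd_expand[OF rpf_pd[OF p]]) (simp add: sum_distrib_left mult.assoc)
  qed
  also have "\<dots> = (\<Sum>c\<in>Basis. \<Sum>c'\<in>Basis. (\<Sum>b\<in>Basis. (R b \<bullet> c) * (R b \<bullet> c')) * pd c (pd c' p) (R x))"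
    by (subst sum.swap, rule sum.cong[OF refl], subst sum.swap) (simp add: sum_distrib_right)
  also have "\<dots> = (\<Sum>c\<in>Basis. \<Sum>c'\<in>Basis. if c = c' then pd c (pd c' p) (R x) else 0)"
    unfolding trace by (intro sum.cong refl) (auto simp: inner_Basis)
  also have "\<dots> = laplacian p (R x)"
    by (simp add: laplacian_eq[OF p])
  finally show ?thesis .
qed

lemma harmonic_poly_orthogonal_transformation:
  fixes R :: "'a::euclidean_space \<Rightarrow> 'a"
  assumes R: "orthogonal_transformation R" and p: "harmonic_poly l p"
  shows "harmonic_poly l (\<lambda>x. p (R x))"
  unfolding harmonic_poly_def
proof
  have lin: "linear R" using R by (simp add: orthogonal_transformation_def)
  show "hom_poly Basis l (\<lambda>x. p (R x))"
    using p hom_poly_scale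
    by (intro hom_polyI rpf_orthogonal[OF R] harmonic_poly_rpf[OF p])
      (auto simp: linear_scale[OF lin] harmonic_poly_def)
  show "laplacian (\<lambda>x. p (R x)) = (\<lambda>x. 0)"
    using p laplacian_orthogonal[OF R harmonic_poly_rpf[OF p]] by (auto simp: harmonic_poly_def)
qed

text \<open>The reflection that exchanges x and y.\<close>
lemma orthogonal_transformation_exists_sphere:
  fixes x y :: "'a::euclidean_space"
  assumes "norm x = norm y"
  shows "\<exists>R. orthogonal_transformation R \<and> R y = x"
proof (cases "x = y")
  case True
  then show ?thesis using orthogonal_transformation_id by blast
next
  case False
  define u where "u = y - x"
  have u: "u \<bullet> u \<noteq> 0" using False by (simp add: u_def)
  define R where "R z = z - (2 * (z \<bullet> u) / (u \<bullet> u)) *\<^sub>R u" for z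
  have "orthogonal_transformation R"
    unfolding orthogonal_transformation_def
  proof (intro conjI allI)
    show "linear R"
      by (rule linearI) (simp_all add: R_def inner_add_left algebra_simps add_divide_distrib)
    show "R v \<bullet> R w = v \<bullet> w" for v w
      using u by (simp add: R_def inner_diff_left inner_diff_right inner_commute field_simps)
  qed
  moreover have "R y = x"
  proof -
    have "x \<bullet> x = y \<bullet> y" using assms by (simp add: norm_eq)
    then have "2 * (y \<bullet> u) = u \<bullet> u"
      by (simp add: u_def inner_diff_left inner_diff_right inner_commute)
    then show ?thesis using u by (simp add: R_def u_def)
  qed
  ultimately show ?thesis by blast
qed

section \<open>Orthonormal bases of spherical harmonics\<close>

text \<open>An orthonormal family of harm_dim members therefore has the largest size that linear independence
  allows, which is what makes it a basis in harmonic_expansion.\<close>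
lemma harm_dim_eq_harm_bound:
  assumes "2 \<le> d"
  shows "harm_dim d l = real (harm_bound d l)"
proof -
  obtain e where d: "d = e + 2" using assms le_Suc_ex by (metis add.commute)
  have G1: "Gamma (real l + real d - 1) = fact (l + e)"
    using Gamma_fact[of "l + e", where 'a=real] by (simp add: d algebra_simps)
  have G2: "Gamma (real d) = fact (e + 1)"
    using Gamma_fact[of "e + 1", where 'a=real] by (simp add: d algebra_simps)
  have G3: "Gamma (real l + 1) = fact l"
    using Gamma_fact[of l, where 'a=real] by (simp add: algebra_simps)
  have *: "harm_dim d l = (2 * real l + real e + 1) * fact (l + e) / (fact (e + 1) * fact l)"
    unfolding harm_dim_def G1 G2 G3 by (simp add: d algebra_simps)
  show ?thesis
  proof (cases l)
    case 0
    have f: "fact (e + 1) = (real e + 1) * fact e" by (simp add: algebra_simps)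
    show ?thesis using * unfolding f 0 harm_bound_def by (simp add: add_nonneg_eq_0_iff)
  next
    case (Suc k)
    have b1: "real (l + d - 1 choose l) = fact (l + e + 1) / (fact l * fact (e + 1))"
      using binomial_fact[of l "l + e + 1", where 'a=real] by (simp add: d)
    have b2: "real (l + d - 2 choose (l - 1)) = fact (l + e) / (fact k * fact (e + 1))"
      using binomial_fact[of k "l + e", where 'a=real] by (simp add: d Suc)
    have "real (harm_bound d l) = fact (l + e + 1) / (fact l * fact (e + 1)) + fact (l + e) / (fact k * fact (e + 1))"
      unfolding harm_bound_def using Suc b1 b2 by simp
    also have "fact (l + e + 1) = (real l + real e + 1) * fact (l + e)"
      by (simp add: algebra_simps)
    also have "fact (l + e) / (fact k * fact (e + 1)) = real l * fact (l + e) / (fact l * fact (e + 1))"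
      using Suc by (simp add: divide_simps)
    finally show ?thesis unfolding * by (simp add: add_divide_distrib[symmetric] algebra_simps)
  qed
qed

lemma card_harm_index: "2 \<le> d \<Longrightarrow> card (harm_index d l) = harm_bound d l"
  by (simp add: harm_index_def harm_dim_eq_harm_bound)

lemma finite_harm_index [simp]: "finite (harm_index d l)"
  by (simp add: harm_index_def)

abbreviation l2_inner :: "('a::euclidean_space \<Rightarrow> real) \<Rightarrow> ('a \<Rightarrow> real) \<Rightarrow> real" where
  "l2_inner f g \<equiv> (\<integral>x. f x * g x \<partial>sphere_measure)"

lemma l2_inner_cong:
  assumes "\<And>x. x \<in> sphere 0 1 \<Longrightarrow> f x = f' x" "\<And>x. x \<in> sphere 0 1 \<Longrightarrow> g x = g' x"
  shows "l2_inner f g = l2_inner f' g'"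
  by (rule Bochner_Integration.integral_cong) (use assms in auto)

lemma l2_inner_sum_left:
  fixes f :: "'i \<Rightarrow> 'a::euclidean_space \<Rightarrow> real"
  assumes "\<And>i. i \<in> I \<Longrightarrow> continuous_on (sphere 0 1) (f i)" "continuous_on (sphere 0 1) g"
  shows "l2_inner (\<lambda>x. \<Sum>i\<in>I. c i * f i x) g = (\<Sum>i\<in>I. c i * l2_inner (f i) g)"
proof -
  have "l2_inner (\<lambda>x. \<Sum>i\<in>I. c i * f i x) g = (\<integral>x. (\<Sum>i\<in>I. c i * (f i x * g x)) \<partial>sphere_measure)"
    by (simp add: sum_distrib_right mult.assoc)
  also have "\<dots> = (\<Sum>i\<in>I. \<integral>x. c i * (f i x * g x) \<partial>sphere_measure)"
    by (intro integral_sphere_sum continuous_intros assms)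
  finally show ?thesis by simp
qed

lemma l2_inner_diff_left:
  fixes f g h :: "'a::euclidean_space \<Rightarrow> real"
  assumes "continuous_on (sphere 0 1) f" "continuous_on (sphere 0 1) g" "continuous_on (sphere 0 1) h"
  shows "l2_inner (\<lambda>x. f x - g x) h = l2_inner f h - l2_inner g h"
  unfolding left_diff_distrib
  by (intro Bochner_Integration.integral_diff integrable_continuous_on_sphere continuous_intros assms)

locale harmonic_basis =
  fixes d :: nat and Y :: "nat \<Rightarrow> nat \<Rightarrow> 'a::euclidean_space \<Rightarrow> real"
  assumes dim: "DIM('a) = d + 1" and d_ge_2: "2 \<le> d" and family: "harmonic_family d Y"
begin

text \<open>The function Y l k is only known on the sphere. Gradients and the Laplacian need the homogeneous
  polynomial that it is the restriction of.\<close>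
definition harm_rep :: "nat \<Rightarrow> nat \<Rightarrow> 'a \<Rightarrow> real" where
  "harm_rep l k = (SOME p. harmonic_poly l p \<and> (\<forall>x\<in>sphere 0 1. Y l k x = p x))"

abbreviation idx :: "nat \<Rightarrow> nat set" where "idx \<equiv> harm_index d"

definition Z :: "nat \<Rightarrow> real" where "Z l = real (card (idx l))"

lemma harm_rep:
  assumes "k \<in> idx l"
  shows "harmonic_poly l (harm_rep l k)" "x \<in> sphere 0 1 \<Longrightarrow> Y l k x = harm_rep l k x"
proof -
  have "spherical_harmonic l (Y l k)" using family assms unfolding harmonic_family_def by blast
  then have "\<exists>p. harmonic_poly l p \<and> (\<forall>x\<in>sphere 0 1. Y l k x = p x)"
    by (rule spherical_harmonic_extends)
  from someI_ex[OF this, folded harm_rep_def]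
  show "harmonic_poly l (harm_rep l k)" "x \<in> sphere 0 1 \<Longrightarrow> Y l k x = harm_rep l k x" by auto
qed

lemma continuous_Y:
  assumes "k \<in> idx l"
  shows "continuous_on (sphere 0 1) (Y l k)"
  using rpf_continuous_on[OF harmonic_poly_rpf[OF harm_rep(1)[OF assms]], of "sphere 0 1"]
    harm_rep(2)[OF assms] by (subst continuous_on_cong[OF refl]) auto

lemma orthonormal:
  assumes "k \<in> idx l" "k' \<in> idx l'"
  shows "l2_inner (Y l k) (Y l' k') = (if l = l' \<and> k = k' then 1 else 0)"
proof (cases "l = l'")
  case True
  then show ?thesis using family assms unfolding harmonic_family_def by auto
next
  case False
  have "l2_inner (Y l k) (Y l' k') = l2_inner (harm_rep l k) (harm_rep l' k')"
    by (rule l2_inner_cong) (simp_all add: harm_rep assms)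
  also have "\<dots> = 0"
    by (rule harmonic_poly_orthogonal[OF harm_rep(1)[OF assms(1)] harm_rep(1)[OF assms(2)] False])
      (use dim d_ge_2 in simp)
  finally show ?thesis using False by simp
qed

text \<open>The remainder r is orthogonal to the family. Adding it gives more harmonic polynomials than
  harm_bound allows to be independent, and in a linear relation between them all coefficients but that
  of r vanish by orthogonality. So r = 0.\<close>
lemma harmonic_expansion:
  assumes h: "harmonic_poly l h" and x: "x \<in> sphere 0 1"
  shows "h x = (\<Sum>k\<in>idx l. l2_inner h (Y l k) * Y l k x)"
proof -
  define r where "r x = h x - (\<Sum>k\<in>idx l. l2_inner h (Y l k) * harm_rep l k x)" for x
  have ch: "continuous_on S h" for S by (rule rpf_continuous_on[OF harmonic_poly_rpf[OF h]])
  have cP: "continuous_on S (harm_rep l k)" if "k \<in> idx l" for k S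
    by (rule rpf_continuous_on[OF harmonic_poly_rpf[OF harm_rep(1)[OF that]]])
  have rh: "harmonic_poly l r"
  proof -
    have "harmonic_poly l (\<lambda>x. \<Sum>k\<in>idx l. l2_inner h (Y l k) * harm_rep l k x)"
      by (intro harmonic_poly_sum harmonic_poly_cmult harm_rep)
    from harmonic_poly_add[OF h harmonic_poly_cmult[OF this, of "-1"]]
    show ?thesis unfolding r_def[abs_def] by simp
  qed
  have PY: "l2_inner f (harm_rep l k) = l2_inner f (Y l k)" if "k \<in> idx l" for f k
    by (rule l2_inner_cong) (use harm_rep(2)[OF that] in auto)
  have PP: "l2_inner (harm_rep l k) (harm_rep l k') = (if k = k' then 1 else 0)"
    if "k \<in> idx l" "k' \<in> idx l" for k k'
  proof -
    have "l2_inner (harm_rep l k) (harm_rep l k') = l2_inner (Y l k) (Y l k')"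
      by (rule l2_inner_cong) (use harm_rep(2) that in auto)
    then show ?thesis using orthonormal[OF that] by simp
  qed
  have rP: "l2_inner r (harm_rep l k) = 0" if k: "k \<in> idx l" for k
  proof -
    have "l2_inner r (harm_rep l k) = l2_inner h (harm_rep l k) -
        l2_inner (\<lambda>x. \<Sum>k\<in>idx l. l2_inner h (Y l k) * harm_rep l k x) (harm_rep l k)"
      unfolding r_def using k by (intro l2_inner_diff_left continuous_intros ch cP)
    also have "l2_inner (\<lambda>x. \<Sum>k\<in>idx l. l2_inner h (Y l k) * harm_rep l k x) (harm_rep l k)
        = (\<Sum>k'\<in>idx l. l2_inner h (Y l k') * l2_inner (harm_rep l k') (harm_rep l k))"
      using k by (intro l2_inner_sum_left cP)
    also have "\<dots> = (\<Sum>k'\<in>idx l. if k' = k then l2_inner h (Y l k) else 0)"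
      using k by (intro sum.cong refl) (auto simp: PP)
    also have "\<dots> = l2_inner h (Y l k)" using k by simp
    finally show ?thesis using PY[OF k, of h] by simp
  qed
  let ?I = "insert None (Some ` idx l)"
  let ?g = "\<lambda>i. case i of None \<Rightarrow> r | Some k \<Rightarrow> harm_rep l k"
  have "card ?I = Suc (card (idx l))" by (subst card_insert_disjoint) (auto simp: card_image)
  then have "harm_bound d l < card ?I" using card_harm_index[OF d_ge_2] by simp
  moreover have "\<And>i. i \<in> ?I \<Longrightarrow> harmonic_poly l (?g i)" using rh harm_rep(1) by auto
  ultimately obtain c where c: "\<exists>i\<in>?I. c i \<noteq> 0" "\<And>x. (\<Sum>i\<in>?I. c i * ?g i x) = 0"
    using harmonic_poly_linearly_dependent[OF dim, of ?I l ?g] by auto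
  have c0: "c None * r x + (\<Sum>k\<in>idx l. c (Some k) * harm_rep l k x) = 0" for x
    using c(2)[of x] by (subst (asm) sum.insert) (auto simp: sum.reindex o_def)
  have "c (Some k) = 0" if k: "k \<in> idx l" for k
  proof -
    have cr: "continuous_on S r" for S by (rule rpf_continuous_on[OF harmonic_poly_rpf[OF rh]])
    have "0 = l2_inner (\<lambda>x. - c None * r x - (\<Sum>k\<in>idx l. c (Some k) * harm_rep l k x)) (harm_rep l k)"
    proof -
      have "- c None * r x - (\<Sum>k\<in>idx l. c (Some k) * harm_rep l k x) = 0" for x
        using c0[of x] by simp
      then show ?thesis by simp
    qed
    also have "\<dots> = l2_inner (\<lambda>x. - c None * r x) (harm_rep l k)
        - l2_inner (\<lambda>x. \<Sum>k\<in>idx l. c (Some k) * harm_rep l k x) (harm_rep l k)"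
      using k by (intro l2_inner_diff_left continuous_intros cr cP)
    also have "l2_inner (\<lambda>x. - c None * r x) (harm_rep l k) = 0"
      using rP[OF k] by (simp add: mult.assoc)
    also have "l2_inner (\<lambda>x. \<Sum>k\<in>idx l. c (Some k) * harm_rep l k x) (harm_rep l k)
        = (\<Sum>k'\<in>idx l. c (Some k') * l2_inner (harm_rep l k') (harm_rep l k))"
      using k by (intro l2_inner_sum_left cP)
    also have "\<dots> = (\<Sum>k'\<in>idx l. if k' = k then c (Some k) else 0)"
      using k by (intro sum.cong refl) (auto simp: PP)
    also have "\<dots> = c (Some k)" using k by simp
    finally show ?thesis by simp
  qed
  then have "c None \<noteq> 0" "r x = 0" using c(1) c0[of x] by auto
  then show ?thesis using x by (simp add: r_def harm_rep(2)[symmetric])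
qed

lemma harmonic_parseval:
  assumes h: "harmonic_poly l h"
  shows "(\<Sum>k\<in>idx l. (l2_inner h (Y l k))\<^sup>2) = l2_inner h h"
proof -
  have ch: "continuous_on S h" for S by (rule rpf_continuous_on[OF harmonic_poly_rpf[OF h]])
  have "l2_inner h h = l2_inner (\<lambda>x. \<Sum>k\<in>idx l. l2_inner h (Y l k) * Y l k x) h"
    by (rule l2_inner_cong) (use harmonic_expansion[OF h] in auto)
  also have "\<dots> = (\<Sum>k\<in>idx l. l2_inner h (Y l k) * l2_inner (Y l k) h)"
    by (intro l2_inner_sum_left continuous_Y ch)
  finally show ?thesis by (simp add: power2_eq_square mult.commute)
qed

text \<open>The function h with coefficients Y l k x is the reproducing kernel at x. An isometry that moves y to
  x leaves its norm unchanged and moves its value at x to y, where Cauchy-Schwarz bounds it.\<close>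
lemma sum_squares_le:
  assumes x: "x \<in> sphere 0 1" and y: "y \<in> sphere 0 1"
  shows "(\<Sum>k\<in>idx l. (Y l k x)\<^sup>2) \<le> (\<Sum>k\<in>idx l. (Y l k y)\<^sup>2)"
proof -
  define K where "K z = (\<Sum>k\<in>idx l. (Y l k z)\<^sup>2)" for z
  obtain R where R: "orthogonal_transformation R" "R y = x"
    using orthogonal_transformation_exists_sphere[of x y] x y by auto
  define h where "h z = (\<Sum>k\<in>idx l. Y l k x * harm_rep l k z)" for z
  have h: "harmonic_poly l h" unfolding h_def[abs_def]
    by (intro harmonic_poly_sum harmonic_poly_cmult harm_rep)
  have ch: "continuous_on S h" for S by (rule rpf_continuous_on[OF harmonic_poly_rpf[OF h]])
  have hY: "h z = (\<Sum>k\<in>idx l. Y l k x * Y l k z)" if "z \<in> sphere 0 1" for z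
    using that by (simp add: h_def harm_rep(2)[symmetric])
  have hx: "h x = K x" using hY[OF x] by (simp add: K_def power2_eq_square)
  have coeff: "l2_inner h (Y l k) = Y l k x" if k: "k \<in> idx l" for k
  proof -
    have "l2_inner h (Y l k) = l2_inner (\<lambda>z. \<Sum>k\<in>idx l. Y l k x * Y l k z) (Y l k)"
      by (rule l2_inner_cong) (use hY in auto)
    also have "\<dots> = (\<Sum>k'\<in>idx l. Y l k' x * l2_inner (Y l k') (Y l k))"
      using k by (intro l2_inner_sum_left continuous_Y)
    also have "\<dots> = (\<Sum>k'\<in>idx l. if k' = k then Y l k x else 0)"
      using k by (intro sum.cong refl) (auto simp: orthonormal)
    finally show ?thesis using k by simp
  qed
  have hh: "l2_inner h h = K x"
    using harmonic_parseval[OF h] by (simp add: coeff K_def)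
  note hR = harmonic_poly_orthogonal_transformation[OF R(1) h]
  have "l2_inner (\<lambda>z. h (R z)) (\<lambda>z. h (R z)) = K x"
    using integral_sphere_orthogonal[OF R(1), of "\<lambda>z. h z * h z"] hh
    by (simp add: continuous_intros ch)
  then have n: "(\<Sum>k\<in>idx l. (l2_inner (\<lambda>z. h (R z)) (Y l k))\<^sup>2) = K x"
    using harmonic_parseval[OF hR] by simp
  have "K x = (\<Sum>k\<in>idx l. l2_inner (\<lambda>z. h (R z)) (Y l k) * Y l k y)"
    using harmonic_expansion[OF hR y] by (simp add: R(2) hx)
  then have "(K x)\<^sup>2 \<le> K x * K y"
    using Cauchy_Schwarz_ineq_sum[of "\<lambda>k. l2_inner (\<lambda>z. h (R z)) (Y l k)" "\<lambda>k. Y l k y" "idx l"] n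
    by (simp add: K_def)
  moreover have "0 \<le> K x" "0 \<le> K y" by (auto simp: K_def sum_nonneg)
  ultimately have "K x \<le> K y"
    by (cases "K x = 0") (auto simp: power2_eq_square)
  then show ?thesis by (simp add: K_def)
qed

text \<open>The sum is constant by sum_squares_le, and its integral is the number of terms.\<close>
lemma addition_theorem_diagonal:
  assumes x: "x \<in> sphere 0 1"
  shows "(\<Sum>k\<in>idx l. (Y l k x)\<^sup>2) = Z l"
proof -
  interpret prob_space "sphere_measure :: 'a measure" by (rule prob_space_sphere_measure)
  have "Z l = (\<Sum>k\<in>idx l. l2_inner (Y l k) (Y l k))"
    by (simp add: orthonormal Z_def)
  also have "\<dots> = (\<integral>y. (\<Sum>k\<in>idx l. (Y l k y)\<^sup>2) \<partial>sphere_measure)"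
    unfolding power2_eq_square by (intro integral_sphere_sum[symmetric] continuous_intros continuous_Y)
  also have "\<dots> = (\<integral>y. (\<Sum>k\<in>idx l. (Y l k x)\<^sup>2) \<partial>(sphere_measure :: 'a measure))"
    by (rule Bochner_Integration.integral_cong) (auto intro!: antisym sum_squares_le simp: x[simplified])
  finally show ?thesis using prob_space by simp
qed

text \<open>Writing x as a multiple of a unit vector u, also for x = 0, reduces this to the sphere.\<close>
lemma sum_harm_rep_squares: "(\<Sum>k\<in>idx l. (harm_rep l k x)\<^sup>2) = Z l * (x \<bullet> x) ^ l"
proof -
  obtain u t where u: "u \<in> sphere (0::'a) 1" "x = t *\<^sub>R u"
  proof (cases "x = 0")
    case True
    obtain b :: 'a where "b \<in> Basis" using nonempty_Basis by blast
    then show ?thesis using that[of b 0] True by simp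
  next
    case False
    then show ?thesis using that[of "sgn x" "norm x"] by (simp add: norm_sgn sgn_div_norm)
  qed
  have "(\<Sum>k\<in>idx l. (harm_rep l k x)\<^sup>2) = (\<Sum>k\<in>idx l. (t ^ l)\<^sup>2 * (Y l k u)\<^sup>2)"
  proof (rule sum.cong[OF refl])
    fix k assume k: "k \<in> idx l"
    have "harm_rep l k x = t ^ l * Y l k u"
      using hom_poly_scale harm_rep[OF k] u unfolding harmonic_poly_def by metis
    then show "(harm_rep l k x)\<^sup>2 = (t ^ l)\<^sup>2 * (Y l k u)\<^sup>2" by (simp add: power_mult_distrib)
  qed
  also have "\<dots> = (t ^ l)\<^sup>2 * Z l"
    by (simp add: sum_distrib_left[symmetric] addition_theorem_diagonal[OF u(1)])
  also have "(t ^ l)\<^sup>2 = (x \<bullet> x) ^ l"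
    using u by (simp add: power2_eq_square power_mult_distrib[symmetric] norm_eq_1)
  finally show ?thesis by simp
qed

text \<open>The sum of the squared gradients of the harmonics of degree l at a point of the sphere.\<close>
definition deriv_bound :: "nat \<Rightarrow> real" where
  "deriv_bound l = Z l * (real l * (2 * real l + real d - 1))"

lemma deriv_bound_nonneg: "0 \<le> deriv_bound l"
  unfolding deriv_bound_def Z_def using d_ge_2 by simp

text \<open>The Laplacian of the square of a harmonic function is twice its squared gradient. Summed over k, the
  squares are Z l * |x|^(2l), whose Laplacian is explicit.\<close>
lemma sum_gradient_squares:
  assumes "norm x \<le> 1"
  shows "(\<Sum>k\<in>idx l. \<Sum>b\<in>Basis. (pd b (harm_rep l k) x)\<^sup>2) \<le> deriv_bound l"
proof -
  have rpf: "real_polynomial_function (harm_rep l k)" if "k \<in> idx l" for k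
    using harmonic_poly_rpf harm_rep(1) that by blast
  have "laplacian (\<lambda>x. \<Sum>k\<in>idx l. harm_rep l k x * harm_rep l k x) x
      = (\<Sum>k\<in>idx l. laplacian (\<lambda>x. harm_rep l k x * harm_rep l k x) x)"
    using laplacian_sum[of "idx l" "\<lambda>k x. harm_rep l k x * harm_rep l k x"] rpf
    by (simp add: rpf_mult)
  also have "\<dots> = (\<Sum>k\<in>idx l. 2 * (\<Sum>b\<in>Basis. (pd b (harm_rep l k) x)\<^sup>2))"
  proof (rule sum.cong[OF refl])
    fix k assume k: "k \<in> idx l"
    show "laplacian (\<lambda>x. harm_rep l k x * harm_rep l k x) x = 2 * (\<Sum>b\<in>Basis. (pd b (harm_rep l k) x)\<^sup>2)"
      using laplacian_mult[OF rpf[OF k] rpf[OF k]] harm_rep(1)[OF k]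
      by (simp add: harmonic_poly_def power2_eq_square)
  qed
  finally have 1: "2 * (\<Sum>k\<in>idx l. \<Sum>b\<in>Basis. (pd b (harm_rep l k) x)\<^sup>2)
      = laplacian (\<lambda>x. \<Sum>k\<in>idx l. harm_rep l k x * harm_rep l k x) x"
    by (simp add: sum_distrib_left)
  have eq: "(\<lambda>x. \<Sum>k\<in>idx l. harm_rep l k x * harm_rep l k x) = (\<lambda>x. (x \<bullet> x) ^ l * Z l)"
    using sum_harm_rep_squares[of l] by (auto simp: power2_eq_square mult.commute)
  have "laplacian (\<lambda>x::'a. (x \<bullet> x) ^ l * Z l) x
      = 2 * real l * (real DIM('a) + 2 * real l - 2) * ((x \<bullet> x) ^ (l - 1) * Z l)"
    using laplacian_inner_self_power_mult[OF harmonic_poly_const[of "Z l", where 'a='a], of l] by simp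
  also have "\<dots> = 2 * deriv_bound l * (x \<bullet> x) ^ (l - 1)"
    by (simp add: dim deriv_bound_def algebra_simps)
  also have "\<dots> \<le> 2 * deriv_bound l * 1"
    using assms deriv_bound_nonneg[of l]
    by (intro mult_left_mono power_le_one) (auto simp: norm_le_square)
  finally show ?thesis using 1 unfolding eq by simp
qed

text \<open>The mean value theorem is applied to a single scalar function: the combination F of the harmonics
  whose coefficients are the differences at x and y. Its increment is the sum to be bounded, and its
  gradient is controlled by Cauchy-Schwarz.\<close>
lemma sum_difference_squares:
  assumes x: "x \<in> sphere 0 1" and y: "y \<in> sphere 0 1"
  shows "(\<Sum>k\<in>idx l. (Y l k x - Y l k y)\<^sup>2) \<le> deriv_bound l * (norm (x - y))\<^sup>2"
proof -
  have rpf: "real_polynomial_function (harm_rep l k)" if "k \<in> idx l" for k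
    using harmonic_poly_rpf harm_rep(1) that by blast
  define c where "c k = Y l k x - Y l k y" for k
  define S where "S = (\<Sum>k\<in>idx l. (c k)\<^sup>2)"
  define F where "F z = (\<Sum>k\<in>idx l. c k * harm_rep l k z)" for z
  have F: "real_polynomial_function F" unfolding F_def[abs_def]
    by (intro rpf_sum rpf_mult rpf_const rpf) auto
  have FS: "F x - F y = S"
    using x y by (simp add: F_def S_def c_def harm_rep(2)[symmetric] sum_subtractf[symmetric]
        algebra_simps power2_eq_square)
  have "\<exists>t. 0 < t \<and> t < 1 \<and> F (y + 1 *\<^sub>R (x - y)) - F (y + 0 *\<^sub>R (x - y)) = (1 - 0) * pd (x - y) F (y + t *\<^sub>R (x - y))"
    by (rule MVT2) (auto intro: pd_has_real_derivative[OF F])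
  then obtain t where t: "0 < t" "t < 1" "S = pd (x - y) F (y + t *\<^sub>R (x - y))"
    using FS by auto
  define z where "z = y + t *\<^sub>R (x - y)"
  have "z = (1 - t) *\<^sub>R y + t *\<^sub>R x" by (simp add: z_def algebra_simps)
  then have "norm z \<le> (1 - t) * norm y + t * norm x"
    using norm_triangle_ineq[of "(1 - t) *\<^sub>R y" "t *\<^sub>R x"] t by simp
  then have nz: "norm z \<le> 1" using x y by simp
  have pdF: "pd b F z = (\<Sum>k\<in>idx l. c k * pd b (harm_rep l k) z)" for b
    unfolding F_def[abs_def] by (subst pd_sum) (auto simp: rpf_mult rpf_const rpf pd_cmult)
  have "(\<Sum>b\<in>Basis. (pd b F z)\<^sup>2) \<le> (\<Sum>b\<in>Basis. S * (\<Sum>k\<in>idx l. (pd b (harm_rep l k) z)\<^sup>2))"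
    unfolding pdF S_def by (intro sum_mono Cauchy_Schwarz_ineq_sum)
  also have "\<dots> = S * (\<Sum>k\<in>idx l. \<Sum>b\<in>Basis. (pd b (harm_rep l k) z)\<^sup>2)"
    by (subst sum.swap) (simp add: sum_distrib_left)
  also have "\<dots> \<le> S * deriv_bound l"
    by (intro mult_left_mono sum_gradient_squares nz) (simp add: S_def sum_nonneg)
  finally have grad: "(\<Sum>b\<in>Basis. (pd b F z)\<^sup>2) \<le> S * deriv_bound l" .
  have "S\<^sup>2 = (\<Sum>b\<in>Basis. ((x - y) \<bullet> b) * pd b F z)\<^sup>2"
    using t(3) pd_expand[OF F, of "x - y" z] by (simp add: z_def)
  also have "\<dots> \<le> (\<Sum>b\<in>Basis. ((x - y) \<bullet> b)\<^sup>2) * (\<Sum>b\<in>Basis. (pd b F z)\<^sup>2)"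
    by (rule Cauchy_Schwarz_ineq_sum)
  also have "(\<Sum>b\<in>Basis. ((x - y) \<bullet> b)\<^sup>2) = (norm (x - y))\<^sup>2"
    unfolding power2_norm_eq_inner euclidean_inner[of "x - y" "x - y"] by (simp add: power2_eq_square)
  also have "(norm (x - y))\<^sup>2 * (\<Sum>b\<in>Basis. (pd b F z)\<^sup>2) \<le> (norm (x - y))\<^sup>2 * (S * deriv_bound l)"
    by (intro mult_left_mono grad) simp
  finally have "S\<^sup>2 \<le> S * (deriv_bound l * (norm (x - y))\<^sup>2)"
    by (simp add: algebra_simps)
  moreover have "0 \<le> S" by (simp add: S_def sum_nonneg)
  ultimately have "S \<le> deriv_bound l * (norm (x - y))\<^sup>2"
    using deriv_bound_nonneg[of l]
    by (cases "S = 0") (auto simp: power2_eq_square)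
  then show ?thesis by (simp add: S_def c_def)
qed

subsection \<open>Expansion and completeness\<close>

definition J :: "nat \<Rightarrow> (nat \<times> nat) set" where "J L = Sigma {..L} idx"

abbreviation YY :: "nat \<times> nat \<Rightarrow> 'a \<Rightarrow> real" where "YY \<alpha> \<equiv> Y (fst \<alpha>) (snd \<alpha>)"

lemma finite_J [simp]: "finite (J L)" by (simp add: J_def)

lemma sum_J: "(\<Sum>\<alpha>\<in>J L. f (fst \<alpha>) (snd \<alpha>)) = (\<Sum>l\<le>L. \<Sum>k\<in>idx l. f l k)"
  by (simp add: J_def sum.Sigma case_prod_unfold)

lemma continuous_YY: "\<alpha> \<in> J L \<Longrightarrow> continuous_on (sphere 0 1) (YY \<alpha>)"
  by (auto simp: J_def continuous_Y)

lemma orthonormal_J: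
  "\<alpha> \<in> J L \<Longrightarrow> \<beta> \<in> J M \<Longrightarrow> l2_inner (YY \<alpha>) (YY \<beta>) = (if \<alpha> = \<beta> then 1 else 0)"
  by (auto simp: J_def orthonormal prod_eq_iff)

lemma l2_inner_sum_YY:
  assumes "\<beta> \<in> J M"
  shows "l2_inner (\<lambda>x. \<Sum>\<alpha>\<in>J L. c \<alpha> * YY \<alpha> x) (YY \<beta>) = (if \<beta> \<in> J L then c \<beta> else 0)"
proof -
  have "l2_inner (\<lambda>x. \<Sum>\<alpha>\<in>J L. c \<alpha> * YY \<alpha> x) (YY \<beta>) = (\<Sum>\<alpha>\<in>J L. c \<alpha> * l2_inner (YY \<alpha>) (YY \<beta>))"
    by (intro l2_inner_sum_left continuous_YY[OF assms]) (rule continuous_YY)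
  also have "\<dots> = (\<Sum>\<alpha>\<in>J L. if \<alpha> = \<beta> then c \<beta> else 0)"
    using assms by (intro sum.cong refl) (auto simp: orthonormal_J)
  finally show ?thesis by simp
qed

lemma harm_decomp_span:
  "harm_decomp m p \<Longrightarrow> m \<le> M \<Longrightarrow> \<exists>c. \<forall>x\<in>sphere 0 1. p x = (\<Sum>\<alpha>\<in>J M. c \<alpha> * YY \<alpha> x)"
proof (induction rule: harm_decomp.induct)
  case (harmonic_poly m h j)
  then have m: "m \<le> M" by simp
  let ?c = "\<lambda>\<alpha>. if fst \<alpha> = m then l2_inner h (YY \<alpha>) else 0"
  have "(x \<bullet> x) ^ j * h x = (\<Sum>\<alpha>\<in>J M. ?c \<alpha> * YY \<alpha> x)" if x: "x \<in> sphere 0 1" for x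
  proof -
    have "x \<bullet> x = 1" using x by (simp add: norm_eq_1)
    then have "(x \<bullet> x) ^ j * h x = (\<Sum>k\<in>idx m. l2_inner h (Y m k) * Y m k x)"
      using harmonic_expansion[OF harmonic_poly.hyps x] by simp
    also have "\<dots> = (\<Sum>l\<le>M. if l = m then \<Sum>k\<in>idx m. l2_inner h (Y m k) * Y m k x else 0)"
      using m by simp
    also have "\<dots> = (\<Sum>l\<le>M. \<Sum>k\<in>idx l. (if l = m then l2_inner h (Y l k) else 0) * Y l k x)"
      by (rule sum.cong) auto
    also have "\<dots> = (\<Sum>\<alpha>\<in>J M. ?c \<alpha> * YY \<alpha> x)"
      by (rule sum_J[symmetric])
    finally show ?thesis .
  qed
  then show ?case by (intro exI[of _ ?c] ballI)
next
  case (add l p q)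
  then obtain c e where "\<forall>x\<in>sphere 0 1. p x = (\<Sum>\<alpha>\<in>J M. c \<alpha> * YY \<alpha> x)"
    "\<forall>x\<in>sphere 0 1. q x = (\<Sum>\<alpha>\<in>J M. e \<alpha> * YY \<alpha> x)" by blast
  then show ?case
    by (intro exI[of _ "\<lambda>\<alpha>. c \<alpha> + e \<alpha>"]) (simp add: algebra_simps sum.distrib)
qed

lemma hom_poly_expansion:
  assumes p: "hom_poly Basis m p" and "m \<le> M" and x: "x \<in> sphere 0 1"
  shows "p x = (\<Sum>\<alpha>\<in>J M. l2_inner p (YY \<alpha>) * YY \<alpha> x)"
proof -
  obtain c where c: "\<And>x. x \<in> sphere 0 1 \<Longrightarrow> p x = (\<Sum>\<alpha>\<in>J M. c \<alpha> * YY \<alpha> x)"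
    using harm_decomp_span[OF hom_poly_harm_decomp[OF p] assms(2)] by blast
  have "l2_inner p (YY \<beta>) = c \<beta>" if "\<beta> \<in> J M" for \<beta>
  proof -
    have "l2_inner p (YY \<beta>) = l2_inner (\<lambda>x. \<Sum>\<alpha>\<in>J M. c \<alpha> * YY \<alpha> x) (YY \<beta>)"
      by (rule l2_inner_cong) (use c in auto)
    then show ?thesis using l2_inner_sum_YY[OF that, of c M] that by simp
  qed
  then show ?thesis using c[OF x] by simp
qed

text \<open>By hom_poly_expansion f is orthogonal to all polynomials. As these approximate f uniformly, f is
  orthogonal to itself.\<close>
lemma completeness:
  assumes f: "continuous_on (sphere 0 1) f"
    and orth: "\<And>l k. k \<in> idx l \<Longrightarrow> l2_inner f (Y l k) = 0" and x: "x \<in> sphere 0 1"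
  shows "f x = 0"
proof -
  interpret prob_space "sphere_measure :: 'a measure" by (rule prob_space_sphere_measure)
  have fp: "l2_inner f p = 0" if p: "real_polynomial_function p" for p
  proof -
    obtain L g where g: "\<And>l. hom_poly Basis l (g l)" "p = (\<lambda>x. \<Sum>l\<le>L. g l x)"
      using rpf_hom_decomp[OF p] by blast
    have "l2_inner f (g l) = 0" for l
    proof -
      have "l2_inner f (g l) = l2_inner (\<lambda>x. \<Sum>\<alpha>\<in>J l. l2_inner (g l) (YY \<alpha>) * YY \<alpha> x) f"
        by (subst mult.commute, rule l2_inner_cong) (use hom_poly_expansion[OF g(1) order.refl] in auto)
      also have "\<dots> = (\<Sum>\<alpha>\<in>J l. l2_inner (g l) (YY \<alpha>) * l2_inner (YY \<alpha>) f)"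
        by (intro l2_inner_sum_left continuous_YY f)
      also have "\<dots> = 0"
        using orth by (intro sum.neutral ballI) (auto simp: J_def mult.commute[of _ "f _"])
      finally show ?thesis .
    qed
    moreover have "l2_inner f p = (\<Sum>l\<le>L. l2_inner f (g l))"
      unfolding g(2) sum_distrib_left
      by (intro integral_sphere_sum continuous_intros f rpf_continuous_on hom_poly_rpf[OF g(1)])
    ultimately show ?thesis by simp
  qed
  obtain C where C: "C \<ge> 0" "\<And>x. x \<in> sphere 0 1 \<Longrightarrow> \<bar>f x\<bar> \<le> C"
    using continuous_on_sphere_bounded[OF f] by blast
  have small: "l2_inner f f \<le> C * e" if e: "e > 0" for e
  proof -
    obtain p where p: "real_polynomial_function p" "\<And>x. x \<in> sphere 0 1 \<Longrightarrow> \<bar>f x - p x\<bar> < e"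
      using Stone_Weierstrass_real_polynomial_function[OF compact_sphere f e] by blast
    note cp = rpf_continuous_on[OF p(1), of "sphere 0 1"]
    have "l2_inner f f = l2_inner f f - l2_inner f p" using fp[OF p(1)] by simp
    also have "\<dots> = l2_inner f (\<lambda>x. f x - p x)"
      unfolding right_diff_distrib
      by (intro Bochner_Integration.integral_diff[symmetric] integrable_continuous_on_sphere continuous_intros f cp)
    also have "\<dots> \<le> (\<integral>x. C * e \<partial>(sphere_measure :: 'a measure))"
    proof (rule integral_mono)
      show "integrable sphere_measure (\<lambda>x. f x * (f x - p x))"
        by (intro integrable_continuous_on_sphere continuous_intros f cp)
      fix x :: 'a assume "x \<in> space sphere_measure"
      then have x: "x \<in> sphere 0 1" by simp
      have "f x * (f x - p x) \<le> \<bar>f x\<bar> * \<bar>f x - p x\<bar>" by (simp add: abs_mult[symmetric])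
      also have "\<dots> \<le> C * e" using C p(2)[OF x] x by (intro mult_mono) auto
      finally show "f x * (f x - p x) \<le> C * e" .
    qed simp
    finally show ?thesis using prob_space by simp
  qed
  have "l2_inner f f \<le> 0"
  proof (rule field_le_epsilon)
    fix e :: real assume "e > 0"
    have "l2_inner f f \<le> C * (e / (C + 1))" using small[of "e / (C + 1)"] \<open>e > 0\<close> C(1) by simp
    also have "\<dots> \<le> e" using \<open>e > 0\<close> C(1) by (simp add: field_simps)
    finally show "l2_inner f f \<le> 0 + e" by simp
  qed
  moreover have "0 \<le> l2_inner f f" by (intro integral_nonneg_AE AE_I2) simp
  ultimately have "l2_inner f f = 0" by (rule antisym)
  then have "f x * f x = 0"
    by (rule continuous_nonneg_integral_zero[OF continuous_on_mult[OF f f] _ _ x, rotated]) simp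
  then show ?thesis by simp
qed

end

section \<open>Growth of dimensions and weights\<close>

text \<open>The dimension of the sphere enters as Suc e, since e is the order of growth.\<close>
lemma harm_bound_le: "real (harm_bound (Suc e) l) \<le> 2 * real (Suc e) ^ e * (1 + real l) ^ e"
proof -
  have base: "real (l + e) ^ e \<le> (real (Suc e) * (1 + real l)) ^ e"
    by (intro power_mono) (auto simp: algebra_simps)
  have 1: "real (l + Suc e - 1 choose l) \<le> real (l + e) ^ e"
  proof -
    have "(l + e choose l) = (l + e choose e)" using binomial_symmetric[of l "l + e"] by simp
    also have "\<dots> \<le> (l + e) ^ e" by (rule binomial_le_pow) simp
    finally have "real (l + e choose l) \<le> real ((l + e) ^ e)" by (simp only: of_nat_le_iff)
    then show ?thesis by simp
  qed
  have 2: "real (if l = 0 then 0 else (l + Suc e - 2) choose (l - 1)) \<le> real (l + e) ^ e"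
  proof (cases l)
    case (Suc k)
    have "(k + e choose k) = (k + e choose e)" using binomial_symmetric[of k "k + e"] by simp
    also have "\<dots> \<le> (k + e) ^ e" by (rule binomial_le_pow) simp
    also have "\<dots> \<le> (l + e) ^ e" by (rule power_mono) (auto simp: Suc)
    finally have "real (k + e choose k) \<le> real ((l + e) ^ e)" by (simp only: of_nat_le_iff)
    then show ?thesis using Suc by simp
  qed simp
  have "real (harm_bound (Suc e) l) \<le> 2 * real (l + e) ^ e"
    using 1 2 unfolding harm_bound_def of_nat_add by linarith
  also have "\<dots> \<le> 2 * (real (Suc e) * (1 + real l)) ^ e" using base by simp
  finally show ?thesis by (simp add: power_mult_distrib)
qed

text \<open>The first binomial coefficients in harm_bound already add up to d + L choose d.\<close>
lemma sum_harm_bound_ge: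
  assumes "0 < d"
  shows "(real L / real d) ^ d \<le> (\<Sum>l\<le>L. real (harm_bound d l))"
proof -
  have "(real L / real d) ^ d \<le> (real (d + L) / real d) ^ d"
    by (intro power_mono divide_right_mono) auto
  also have "\<dots> \<le> real (d + L choose d)"
    using binomial_ge_n_over_k_pow_k[of d "d + L", where 'a=real] by simp
  also have "(d + L choose d) = (Suc (d - 1 + L) choose L)"
    using assms binomial_symmetric[of d "d + L"] by simp
  also have "\<dots> = (\<Sum>l\<le>L. d - 1 + l choose l)" by (rule sum_choose_lower[symmetric])
  also have "real \<dots> \<le> (\<Sum>l\<le>L. real (harm_bound d l))"
    unfolding of_nat_sum using assms by (intro sum_mono) (auto simp: harm_bound_def add.commute)
  finally show ?thesis .
qed

lemma square_powr:
  fixes x t :: real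
  assumes "0 < x"
  shows "(x\<^sup>2) powr (- t) = x powr (- 2 * t)"
proof -
  have "x\<^sup>2 = x powr 2" using assms by simp
  then show ?thesis by (simp only: powr_powr) simp
qed

locale sobolev_setting = harmonic_basis d Y
  for d :: nat and Y :: "nat \<Rightarrow> nat \<Rightarrow> 'a::euclidean_space \<Rightarrow> real" +
  fixes s :: real and a :: "nat \<Rightarrow> real"
  assumes s_gt: "real d / 2 < s" and a_pos: "\<And>l. 0 < a l"
    and a_comparable: "comparable a (\<lambda>l. (1 + eigval d l) powr (- s))"
begin

lemma s_pos: "0 < s" using s_gt d_ge_2 by (smt (verit) of_nat_0_le_iff divide_nonneg_nonneg)

lemma eigval_nonneg: "0 \<le> eigval d l"
  using d_ge_2 by (simp add: eigval_def)

lemma eigval_lower: "(1 + real l)\<^sup>2 / 2 \<le> 1 + eigval d l"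
proof -
  have "real l * (real l + 1) \<le> eigval d l"
    unfolding eigval_def using d_ge_2 by (intro mult_left_mono) auto
  moreover have "(1 + real l)\<^sup>2 / 2 \<le> 1 + real l * (real l + 1)"
    by (simp add: power2_eq_square algebra_simps)
  ultimately show ?thesis by linarith
qed

lemma eigval_upper: "1 + eigval d l \<le> real (Suc d) * (1 + real l)\<^sup>2"
  unfolding eigval_def power2_eq_square using d_ge_2
  by (simp add: algebra_simps mult_left_mono)

lemma weight_upper: "\<exists>C>0. \<forall>l. a l \<le> C * (1 + real l) powr (- 2 * s)"
proof -
  obtain c where c: "c > 0" "\<And>l. c * a l \<le> (1 + eigval d l) powr (- s)"
    using a_comparable unfolding comparable_def by blast
  have "a l \<le> (2 powr s / c) * (1 + real l) powr (- 2 * s)" for l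
  proof -
    have "(1 + eigval d l) powr (- s) \<le> ((1 + real l)\<^sup>2 / 2) powr (- s)"
      using eigval_lower[of l] s_pos by (intro powr_mono2') auto
    also have "\<dots> = ((1 + real l)\<^sup>2) powr (- s) / 2 powr (- s)"
      by (rule powr_divide)
    also have "\<dots> = (1 + real l) powr (- 2 * s) * 2 powr s"
      unfolding square_powr[of "1 + real l" s, simplified] powr_minus[of 2] by (simp add: divide_inverse)
    finally have "c * a l \<le> (1 + real l) powr (- 2 * s) * 2 powr s" using c(2)[of l] by linarith
    then show ?thesis using c(1) by (simp add: field_simps)
  qed
  then show ?thesis using c(1) by (intro exI[of _ "2 powr s / c"]) auto
qed

lemma weight_lower: "\<exists>C>0. \<forall>l. C * (1 + real l) powr (- 2 * s) \<le> a l"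
proof -
  obtain c where c: "c > 0" "\<And>l. (1 + eigval d l) powr (- s) \<le> c * a l"
    using a_comparable unfolding comparable_def by blast
  have "real (Suc d) powr (- s) / c * (1 + real l) powr (- 2 * s) \<le> a l" for l
  proof -
    have "real (Suc d) powr (- s) * (1 + real l) powr (- 2 * s)
        = real (Suc d) powr (- s) * ((1 + real l)\<^sup>2) powr (- s)"
      by (subst square_powr) simp_all
    also have "\<dots> = (real (Suc d) * (1 + real l)\<^sup>2) powr (- s)"
      by (rule powr_mult[symmetric])
    also have "\<dots> \<le> (1 + eigval d l) powr (- s)"
      using eigval_upper[of l] eigval_nonneg[of l] s_pos by (intro powr_mono2') auto
    finally show ?thesis using c(1) c(2)[of l] by (simp add: field_simps)
  qed
  then show ?thesis using c(1) by (intro exI[of _ "real (Suc d) powr (- s) / c"]) auto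
qed

lemma Z_eq: "Z l = real (harm_bound d l)"
  by (simp add: Z_def card_harm_index d_ge_2)

lemma Z_nonneg: "0 \<le> Z l" by (simp add: Z_def)

lemma Z_0: "Z 0 = 1" by (simp add: Z_eq harm_bound_def)

lemma Z_upper: "\<exists>C>0. \<forall>l. Z l \<le> C * (1 + real l) powr (real d - 1)"
proof -
  obtain e where e: "d = Suc e" using d_ge_2 by (cases d) auto
  have "Z l \<le> 2 * real d ^ e * (1 + real l) powr (real d - 1)" for l
    unfolding Z_eq using harm_bound_le[of e l] by (simp add: e powr_realpow)
  then show ?thesis using d_ge_2 by (intro exI[of _ "2 * real d ^ e"]) auto
qed

lemma weighted_dim_upper: "\<exists>C>0. \<forall>l. a l * Z l \<le> C * (1 + real l) powr (real d - 1 - 2 * s)"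
proof -
  obtain A where A: "A > 0" "\<And>l. a l \<le> A * (1 + real l) powr (- 2 * s)" using weight_upper by blast
  obtain B where B: "B > 0" "\<And>l. Z l \<le> B * (1 + real l) powr (real d - 1)" using Z_upper by blast
  have "a l * Z l \<le> (A * B) * (1 + real l) powr (real d - 1 - 2 * s)" for l
  proof -
    have "a l * Z l \<le> (A * (1 + real l) powr (- 2 * s)) * (B * (1 + real l) powr (real d - 1))"
      using A B Z_nonneg a_pos[of l] by (intro mult_mono) auto
    also have "\<dots> = (A * B) * ((1 + real l) powr (- 2 * s) * (1 + real l) powr (real d - 1))" by simp
    also have "(1 + real l) powr (- 2 * s) * (1 + real l) powr (real d - 1) = (1 + real l) powr (real d - 1 - 2 * s)"
      by (simp add: powr_add[symmetric] algebra_simps)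
    finally show ?thesis .
  qed
  then show ?thesis using A B by (intro exI[of _ "A * B"]) auto
qed

lemma summable_weighted_dim: "summable (\<lambda>l. a l * Z l)"
proof -
  obtain C where C: "C > 0" "\<And>l. a l * Z l \<le> C * (1 + real l) powr (real d - 1 - 2 * s)"
    using weighted_dim_upper by blast
  have "summable (\<lambda>l. real l powr (real d - 1 - 2 * s))"
    using s_gt by (subst summable_real_powr_iff) (simp add: field_simps)
  then have "summable (\<lambda>l. real (Suc l) powr (real d - 1 - 2 * s))"
    by (subst summable_Suc_iff)
  then have "summable (\<lambda>l. C * (1 + real l) powr (real d - 1 - 2 * s))"
    by (intro summable_mult) (simp add: add.commute)
  then show ?thesis
    by (rule summable_comparison_test_ev[rotated])
       (use C Z_nonneg a_pos in \<open>auto intro!: always_eventually simp: abs_mult less_imp_le\<close>)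
qed

section \<open>Pointwise expansion of Sobolev functions\<close>

lemma sobolev_summable:
  assumes "f \<in> sobolev_space d s Y"
  shows "summable (\<lambda>l. \<Sum>k\<in>idx l. (1 / a l) * (l2_inner f (Y l k))\<^sup>2)"
proof -
  obtain c where c: "c > 0" "\<And>l. (1 + eigval d l) powr (- s) \<le> c * a l"
    using a_comparable unfolding comparable_def by blast
  have inv: "1 / a l \<le> c * (1 + eigval d l) powr s" for l
  proof -
    have "0 < (1 + eigval d l) powr s" using eigval_nonneg[of l] by simp
    then show ?thesis
      using c(2)[of l] a_pos[of l] by (simp add: powr_minus field_simps)
  qed
  have "summable (\<lambda>l. \<Sum>k\<in>idx l. (1 + eigval d l) powr s * (l2_inner f (Y l k))\<^sup>2)"
    using assms by (simp add: sobolev_space_def fourier_coeff_def)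
  then have "summable (\<lambda>l. c * (\<Sum>k\<in>idx l. (1 + eigval d l) powr s * (l2_inner f (Y l k))\<^sup>2))"
    by (rule summable_mult)
  then show ?thesis
  proof (rule summable_comparison_test_ev[rotated], intro always_eventually allI)
    fix l
    have "(\<Sum>k\<in>idx l. (1 / a l) * (l2_inner f (Y l k))\<^sup>2)
        \<le> (\<Sum>k\<in>idx l. c * (1 + eigval d l) powr s * (l2_inner f (Y l k))\<^sup>2)"
      using inv[of l] by (intro sum_mono mult_right_mono) auto
    moreover have "0 \<le> (\<Sum>k\<in>idx l. (1 / a l) * (l2_inner f (Y l k))\<^sup>2)"
      using a_pos[of l] by (intro sum_nonneg) simp
    ultimately show "norm (\<Sum>k\<in>idx l. (1 / a l) * (l2_inner f (Y l k))\<^sup>2)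
        \<le> c * (\<Sum>k\<in>idx l. (1 + eigval d l) powr s * (l2_inner f (Y l k))\<^sup>2)"
      by (simp add: sum_distrib_left mult.assoc)
  qed
qed

lemma sobolev_norm_eq:
  "sobolev_norm d a Y f = sqrt (\<Sum>l. \<Sum>k\<in>idx l. (1 / a l) * (l2_inner f (Y l k))\<^sup>2)"
  by (simp add: sobolev_norm_def fourier_coeff_def)

text \<open>The inequality |u v| \<le> u^2 / a l + a l * v^2 bounds the terms by a summable sequence, uniformly on
  the sphere. The sum G is therefore continuous with the same coefficients as f, and completeness
  gives f = G.\<close>
lemma sobolev_expansion:
  assumes f: "f \<in> sobolev_space d s Y" and x: "x \<in> sphere 0 1"
  shows "(\<lambda>l. \<Sum>k\<in>idx l. l2_inner f (Y l k) * Y l k x) sums f x"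
proof -
  interpret prob_space "sphere_measure :: 'a measure" by (rule prob_space_sphere_measure)
  define F where "F l x = (\<Sum>k\<in>idx l. l2_inner f (Y l k) * Y l k x)" for l x
  define w where "w l = (\<Sum>k\<in>idx l. (1 / a l) * (l2_inner f (Y l k))\<^sup>2) + a l * Z l" for l
  define G where "G x = (\<Sum>l. F l x)" for x
  define W where "W = (\<Sum>l. w l)"
  have cf: "continuous_on (sphere 0 1) f" using f by (simp add: sobolev_space_def)
  have sw: "summable w" unfolding w_def by (intro summable_add sobolev_summable f summable_weighted_dim)
  have Fw: "norm (F l x) \<le> w l" if x: "x \<in> sphere 0 1" for l x
  proof -
    have "\<bar>F l x\<bar> \<le> (\<Sum>k\<in>idx l. \<bar>l2_inner f (Y l k) * Y l k x\<bar>)"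
      unfolding F_def by (rule sum_abs)
    also have "\<dots> \<le> (\<Sum>k\<in>idx l. (1 / a l) * (l2_inner f (Y l k))\<^sup>2 + a l * (Y l k x)\<^sup>2)"
    proof (rule sum_mono)
      fix k
      let ?u = "\<bar>l2_inner f (Y l k)\<bar>" and ?v = "\<bar>Y l k x\<bar>"
      have "0 \<le> (?u - a l * ?v)\<^sup>2" by simp
      then have "2 * (a l * (?u * ?v)) \<le> ?u\<^sup>2 + (a l)\<^sup>2 * ?v\<^sup>2"
        by (simp add: power2_eq_square algebra_simps)
      moreover have "0 \<le> a l * (?u * ?v)" using a_pos[of l] by simp
      ultimately have "a l * (?u * ?v) \<le> ?u\<^sup>2 + (a l)\<^sup>2 * ?v\<^sup>2" by linarith
      then show "\<bar>l2_inner f (Y l k) * Y l k x\<bar> \<le> (1 / a l) * (l2_inner f (Y l k))\<^sup>2 + a l * (Y l k x)\<^sup>2"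
        using a_pos[of l] by (simp add: abs_mult field_simps power2_eq_square)
    qed
    also have "\<dots> = w l"
      by (simp add: w_def sum.distrib sum_distrib_left[symmetric] addition_theorem_diagonal[OF x])
    finally show ?thesis by simp
  qed
  have cF: "continuous_on (sphere 0 1) (F l)" for l
    unfolding F_def by (intro continuous_intros continuous_Y)
  have Fsum: "(\<lambda>l. F l x) sums G x" if "x \<in> sphere 0 1" for x
    unfolding G_def using summable_comparison_test'[OF sw Fw[OF that]] by (simp add: summable_sums)
  have unif: "uniform_limit (sphere 0 1) (\<lambda>n x. \<Sum>l<n. F l x) G sequentially"
    unfolding G_def by (rule Weierstrass_m_test[OF Fw sw])
  have cG: "continuous_on (sphere 0 1) G"
    by (rule uniform_limit_theorem[OF _ unif])
       (auto intro!: always_eventually continuous_intros cF)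
  have partial_le: "\<bar>\<Sum>l<n. F l x\<bar> \<le> W" if x: "x \<in> sphere 0 1" for n x
  proof -
    have "\<bar>\<Sum>l<n. F l x\<bar> \<le> (\<Sum>l<n. w l)"
      using Fw[OF x] by (intro order.trans[OF sum_abs] sum_mono) simp
    also have "\<dots> \<le> W" unfolding W_def
      using order.trans[OF norm_ge_zero Fw[OF x]] by (intro sum_le_suminf sw) auto
    finally show ?thesis .
  qed
  have coeffF: "l2_inner (\<lambda>x. \<Sum>l<n. F l x) (Y l k) = l2_inner f (Y l k)" if k: "k \<in> idx l" and n: "n > l" for n l k
  proof -
    obtain m where m: "n = Suc m" using n by (cases n) auto
    have in_J: "(l, k) \<in> J m" using k n m by (auto simp: J_def)
    have "(\<Sum>l<n. F l x) = (\<Sum>\<alpha>\<in>J m. l2_inner f (YY \<alpha>) * YY \<alpha> x)" for x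
      unfolding F_def m lessThan_Suc_atMost by (rule sum_J[symmetric])
    then show ?thesis using l2_inner_sum_YY[OF in_J, of "\<lambda>\<alpha>. l2_inner f (YY \<alpha>)" m] in_J by simp
  qed
  have coeffG: "l2_inner G (Y l k) = l2_inner f (Y l k)" if k: "k \<in> idx l" for l k
  proof -
    obtain C where C: "C \<ge> 0" "\<And>x. x \<in> sphere 0 1 \<Longrightarrow> \<bar>Y l k x\<bar> \<le> C"
      using continuous_on_sphere_bounded[OF continuous_Y[OF k]] by blast
    have "(\<lambda>n. l2_inner (\<lambda>x. \<Sum>l<n. F l x) (Y l k)) \<longlonglongrightarrow> l2_inner G (Y l k)"
    proof (rule integral_dominated_convergence[where w="\<lambda>_. W * C"])
      show "(\<lambda>x. G x * Y l k x) \<in> borel_measurable sphere_measure"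
        by (intro continuous_on_sphere_measurable continuous_intros cG continuous_Y k)
      show "(\<lambda>x. (\<Sum>l<n. F l x) * Y l k x) \<in> borel_measurable sphere_measure" for n
        by (intro continuous_on_sphere_measurable continuous_intros cF continuous_Y k)
      show "AE x in sphere_measure. (\<lambda>n. (\<Sum>l<n. F l x) * Y l k x) \<longlonglongrightarrow> G x * Y l k x"
        using Fsum by (intro AE_I2 tendsto_mult tendsto_const) (auto simp: sums_def)
      show "AE x in sphere_measure. norm ((\<Sum>l<n. F l x) * Y l k x) \<le> W * C" for n
      proof (rule AE_I2)
        fix x :: 'a assume "x \<in> space sphere_measure"
        then have x: "x \<in> sphere 0 1" by simp
        show "norm ((\<Sum>l<n. F l x) * Y l k x) \<le> W * C"
          using partial_le[OF x, of n] C(2)[OF x]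
          by (simp add: abs_mult) (intro mult_mono, auto)
      qed
    qed simp
    moreover have "(\<lambda>n. l2_inner (\<lambda>x. \<Sum>l<n. F l x) (Y l k)) \<longlonglongrightarrow> l2_inner f (Y l k)"
      by (rule tendsto_eventually, rule eventually_mono[OF eventually_gt_at_top[of l]]) (rule coeffF[OF k])
    ultimately show ?thesis by (rule LIMSEQ_unique)
  qed
  have "f x - G x = 0"
  proof (rule completeness[OF _ _ x])
    show "continuous_on (sphere 0 1) (\<lambda>x. f x - G x)" by (intro continuous_intros cf cG)
    show "l2_inner (\<lambda>x. f x - G x) (Y l k) = 0" if k: "k \<in> idx l" for l k
      using l2_inner_diff_left[OF cf cG continuous_Y[OF k]] coeffG[OF k] by simp
  qed
  then show ?thesis using Fsum[OF x] by (simp add: F_def)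
qed

text \<open>The quadrature rule is exact on constants, so by this identity degree 0 drops out of the error.\<close>
lemma expansion_degree_0:
  assumes x: "x \<in> sphere 0 1"
  shows "(\<Sum>k\<in>idx 0. l2_inner f (Y 0 k) * Y 0 k x) = (\<integral>x. f x \<partial>sphere_measure)"
proof -
  have "l2_inner f (Y 0 k) * Y 0 k x = (\<integral>x. f x \<partial>sphere_measure) * (Y 0 k x)\<^sup>2" if k: "k \<in> idx 0" for k
  proof -
    obtain c where c: "harm_rep 0 k = (\<lambda>x. c)"
      using hom_poly_0_const harm_rep(1)[OF k] unfolding harmonic_poly_def by blast
    have Yc: "Y 0 k z = c" if "z \<in> sphere 0 1" for z using harm_rep(2)[OF k that] c by simp
    have "l2_inner f (Y 0 k) = l2_inner f (\<lambda>_. c)" by (rule l2_inner_cong) (use Yc in auto)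
    then show ?thesis using Yc[OF x] by (simp add: power2_eq_square)
  qed
  then have "(\<Sum>k\<in>idx 0. l2_inner f (Y 0 k) * Y 0 k x)
      = (\<Sum>k\<in>idx 0. (\<integral>x. f x \<partial>sphere_measure) * (Y 0 k x)\<^sup>2)" by (rule sum.cong[OF refl])
  also have "\<dots> = (\<integral>x. f x \<partial>sphere_measure)"
    by (simp add: sum_distrib_left[symmetric] addition_theorem_diagonal[OF x] Z_0)
  finally show ?thesis .
qed

lemma integral_Y:
  assumes k: "k \<in> idx l" and l: "l \<noteq> 0"
  shows "(\<integral>x. Y l k x \<partial>sphere_measure) = 0"
proof -
  have "(\<integral>x. Y l k x \<partial>sphere_measure) = l2_inner (harm_rep l k) (\<lambda>_. 1)"
    by (rule Bochner_Integration.integral_cong) (use harm_rep(2)[OF k] in auto)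
  also have "\<dots> = 0"
    by (rule harmonic_poly_orthogonal[OF harm_rep(1)[OF k] harmonic_poly_const l])
       (use dim d_ge_2 in simp)
  finally show ?thesis .
qed

section \<open>The worst-case error as a series\<close>

text \<open>The squared norm of the functional f \<mapsto> qmc N x f on the harmonics of degree l.\<close>
definition energy :: "nat \<Rightarrow> (nat \<Rightarrow> 'a) \<Rightarrow> nat \<Rightarrow> real" where
  "energy N x l = (\<Sum>k\<in>idx l. (qmc N x (Y l k))\<^sup>2)"

lemma energy_nonneg: "0 \<le> energy N x l"
  by (simp add: energy_def sum_nonneg)

lemma qmc_square_le: "1 \<le> N \<Longrightarrow> (qmc N x f)\<^sup>2 \<le> qmc N x (\<lambda>z. (f z)\<^sup>2)"
proof -
  assume N: "1 \<le> N"
  have "(\<Sum>j=1..N. 1 * f (x j))\<^sup>2 \<le> (\<Sum>j=1..N. 1\<^sup>2) * (\<Sum>j=1..N. (f (x j))\<^sup>2)"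
    by (rule Cauchy_Schwarz_ineq_sum)
  then show ?thesis using N
    by (simp add: qmc_def power_mult_distrib power_divide power2_eq_square field_simps)
qed

lemma energy_le_Z:
  assumes N: "1 \<le> N" and x: "\<And>j. j \<in> {1..N} \<Longrightarrow> x j \<in> sphere 0 1"
  shows "energy N x l \<le> Z l"
proof -
  have "energy N x l \<le> (\<Sum>k\<in>idx l. qmc N x (\<lambda>z. (Y l k z)\<^sup>2))"
    unfolding energy_def by (intro sum_mono qmc_square_le N)
  also have "\<dots> = 1 / real N * (\<Sum>j=1..N. \<Sum>k\<in>idx l. (Y l k (x j))\<^sup>2)"
    unfolding qmc_def sum_distrib_left[symmetric] by (subst sum.swap) (rule refl)
  also have "(\<Sum>j=1..N. \<Sum>k\<in>idx l. (Y l k (x j))\<^sup>2) = (\<Sum>j=1..N. Z l)"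
    by (intro sum.cong refl addition_theorem_diagonal x)
  finally show ?thesis using N by simp
qed

lemma summable_energy:
  assumes N: "1 \<le> N" and x: "\<And>j. j \<in> {1..N} \<Longrightarrow> x j \<in> sphere 0 1"
  shows "summable (\<lambda>l. a (Suc l) * energy N x (Suc l))"
proof (rule summable_comparison_test_ev)
  show "summable (\<lambda>l. a (Suc l) * Z (Suc l))"
    using summable_weighted_dim by (subst summable_Suc_iff)
  show "\<forall>\<^sub>F l in sequentially. norm (a (Suc l) * energy N x (Suc l)) \<le> a (Suc l) * Z (Suc l)"
    using energy_le_Z[where x=x, OF N x] a_pos energy_nonneg
    by (intro always_eventually allI) (simp add: abs_mult less_imp_le mult_left_mono)
qed

text \<open>Cauchy-Schwarz with the weights a l, for partial sums of the expansion without degree 0.\<close>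
lemma qmc_error_le:
  assumes N: "1 \<le> N" and x: "\<And>j. j \<in> {1..N} \<Longrightarrow> x j \<in> sphere 0 1"
    and f: "f \<in> sobolev_space d s Y" and norm: "sobolev_norm d a Y f \<le> 1"
  shows "\<bar>qmc N x f - (\<integral>y. f y \<partial>sphere_measure)\<bar> \<le> sqrt (\<Sum>l. a (Suc l) * energy N x (Suc l))"
proof -
  define c where "c l k = l2_inner f (Y l k)" for l k
  define T where "T l = (\<Sum>k\<in>idx l. c l k * qmc N x (Y l k))" for l
  let ?E = "\<Sum>l. a (Suc l) * energy N x (Suc l)"
  have qT: "qmc N x (\<lambda>z. \<Sum>k\<in>idx l. c l k * Y l k z) = T l" for l
    unfolding qmc_def T_def by (simp add: sum_distrib_left sum_divide_distrib) (rule sum.swap)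
  have "(\<lambda>l. T l) sums qmc N x f"
    unfolding qT[symmetric] unfolding qmc_def c_def
    by (intro sums_mult sums_sum sobolev_expansion f x)
  moreover have "T 0 = (\<integral>y. f y \<partial>sphere_measure)"
  proof -
    have "T 0 = 1 / real N * (\<Sum>j=1..N. \<integral>y. f y \<partial>sphere_measure)"
      unfolding qT[symmetric] unfolding qmc_def c_def
      by (intro arg_cong2[where f="(*)"] sum.cong refl expansion_degree_0 x)
    then show ?thesis using N by simp
  qed
  ultimately have lim: "(\<lambda>n. \<Sum>l<n. T (Suc l)) \<longlonglongrightarrow> qmc N x f - (\<integral>y. f y \<partial>sphere_measure)"
    using sums_Suc_iff[of T "qmc N x f - T 0"] by (simp add: sums_def)
  have norm1: "(\<Sum>l. \<Sum>k\<in>idx l. (1 / a l) * (c l k)\<^sup>2) \<le> 1"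
    using norm unfolding sobolev_norm_eq c_def by simp
  have bound: "\<bar>\<Sum>l<n. T (Suc l)\<bar> \<le> sqrt ?E" for n
  proof -
    let ?S = "Sigma {..<n} (\<lambda>l. idx (Suc l))"
    let ?u = "\<lambda>\<alpha>. c (Suc (fst \<alpha>)) (snd \<alpha>) / sqrt (a (Suc (fst \<alpha>)))"
    let ?v = "\<lambda>\<alpha>. sqrt (a (Suc (fst \<alpha>))) * qmc N x (Y (Suc (fst \<alpha>)) (snd \<alpha>))"
    have "(\<Sum>l<n. T (Suc l)) = (\<Sum>\<alpha>\<in>?S. ?u \<alpha> * ?v \<alpha>)"
      unfolding T_def using a_pos
      by (subst sum.Sigma) (auto intro!: sum.cong simp: less_imp_neq[THEN not_sym])
    then have "(\<Sum>l<n. T (Suc l))\<^sup>2 \<le> (\<Sum>\<alpha>\<in>?S. (?u \<alpha>)\<^sup>2) * (\<Sum>\<alpha>\<in>?S. (?v \<alpha>)\<^sup>2)"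
      using Cauchy_Schwarz_ineq_sum[of ?u ?v ?S] by simp
    also have "(\<Sum>\<alpha>\<in>?S. (?u \<alpha>)\<^sup>2) = (\<Sum>l<n. \<Sum>k\<in>idx (Suc l). (1 / a (Suc l)) * (c (Suc l) k)\<^sup>2)"
      using a_pos
      by (subst sum.Sigma) (auto intro!: sum.cong simp: power_divide less_imp_le)
    also have "(\<Sum>\<alpha>\<in>?S. (?v \<alpha>)\<^sup>2) = (\<Sum>l<n. a (Suc l) * energy N x (Suc l))"
      unfolding energy_def sum_distrib_left using a_pos
      by (subst sum.Sigma) (auto intro!: sum.cong simp: power_mult_distrib less_imp_le)
    also have "(\<Sum>l<n. \<Sum>k\<in>idx (Suc l). (1 / a (Suc l)) * (c (Suc l) k)\<^sup>2)
        * (\<Sum>l<n. a (Suc l) * energy N x (Suc l)) \<le> 1 * ?E"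
    proof (intro mult_mono)
      let ?t = "\<lambda>l. \<Sum>k\<in>idx l. (1 / a l) * (c l k)\<^sup>2"
      have t: "0 \<le> ?t l" for l using a_pos[of l] by (intro sum_nonneg) simp
      have "(\<Sum>l<n. ?t (Suc l)) \<le> (\<Sum>l<Suc n. ?t l)"
        unfolding sum.lessThan_Suc_shift using t[of 0] by simp
      also have "\<dots> \<le> suminf ?t"
        using sobolev_summable[OF f] t by (intro sum_le_suminf) (auto simp: c_def)
      finally show "(\<Sum>l<n. ?t (Suc l)) \<le> 1" using norm1 by simp
      show "(\<Sum>l<n. a (Suc l) * energy N x (Suc l)) \<le> ?E"
        using a_pos energy_nonneg
        by (intro sum_le_suminf summable_energy N x) (auto simp: less_imp_le)
      show "0 \<le> (\<Sum>l<n. a (Suc l) * energy N x (Suc l))"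
        using a_pos energy_nonneg by (intro sum_nonneg) (simp add: less_imp_le)
    qed simp
    finally have "(\<Sum>l<n. T (Suc l))\<^sup>2 \<le> ?E" by simp
    then show ?thesis by (rule real_le_rsqrt[OF _, of "\<bar>_\<bar>", simplified])
  qed
  show ?thesis
    by (rule LIMSEQ_le_const2[OF tendsto_rabs[OF lim]]) (use bound in auto)
qed

text \<open>Up to normalization, f is the representer of the error functional, cut off at degree n so that it is a
  polynomial and belongs to the Sobolev space without any question of convergence.\<close>
lemma wce_lower_partial:
  assumes N: "1 \<le> N" and x: "\<And>j. j \<in> {1..N} \<Longrightarrow> x j \<in> sphere 0 1"
    and S: "S = (\<Sum>l=1..n. a l * energy N x l)" "S > 0"
  shows "\<exists>f\<in>sobolev_space d s Y. sobolev_norm d a Y f \<le> 1 \<and>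
    \<bar>qmc N x f - (\<integral>y. f y \<partial>sphere_measure)\<bar> = sqrt S"
proof -
  define w where "w \<alpha> = (if fst \<alpha> = 0 then 0 else a (fst \<alpha>) * qmc N x (YY \<alpha>) / sqrt S)" for \<alpha>
  define f where "f z = (\<Sum>\<alpha>\<in>J n. w \<alpha> * YY \<alpha> z)" for z
  have cf: "continuous_on (sphere 0 1) f"
    unfolding f_def[abs_def] by (intro continuous_intros continuous_YY)
  have coeff: "l2_inner f (Y l k) = (if l \<le> n then w (l, k) else 0)" if k: "k \<in> idx l" for l k
    using l2_inner_sum_YY[of "(l, k)" l w n] k unfolding f_def[abs_def] by (auto simp: J_def)
  have zero: "(\<Sum>k\<in>idx l. h l k * \<bar>fourier_coeff Y f l k\<bar>\<^sup>2) = 0" if "l \<notin> {..n}" for h l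
    using that by (intro sum.neutral ballI) (simp add: fourier_coeff_def coeff)
  have "f \<in> sobolev_space d s Y"
    unfolding sobolev_space_def
  proof (intro CollectI conjI cf)
    show "integrable sphere_measure (\<lambda>x. (f x)\<^sup>2)"
      by (intro integrable_continuous_on_sphere continuous_intros cf)
    show "summable (\<lambda>l. \<Sum>k\<in>idx l. (1 + eigval d l) powr s * \<bar>fourier_coeff Y f l k\<bar>\<^sup>2)"
      by (rule summable_finite[of "{..n}"], simp, rule zero)
  qed
  moreover have "sobolev_norm d a Y f \<le> 1"
  proof -
    have "(\<Sum>l. \<Sum>k\<in>idx l. (1 / a l) * \<bar>fourier_coeff Y f l k\<bar>\<^sup>2)
        = (\<Sum>l\<le>n. \<Sum>k\<in>idx l. (1 / a l) * \<bar>fourier_coeff Y f l k\<bar>\<^sup>2)"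
      by (rule suminf_finite, simp, rule zero)
    also have "\<dots> = (\<Sum>l\<le>n. if l = 0 then 0 else a l * energy N x l / S)"
    proof (rule sum.cong[OF refl])
      fix l assume l: "l \<in> {..n}"
      show "(\<Sum>k\<in>idx l. (1 / a l) * \<bar>fourier_coeff Y f l k\<bar>\<^sup>2) = (if l = 0 then 0 else a l * energy N x l / S)"
      proof (cases "l = 0")
        case True
        then show ?thesis using l by (auto simp: fourier_coeff_def coeff w_def intro!: sum.neutral)
      next
        case False
        have "(\<Sum>k\<in>idx l. (1 / a l) * \<bar>fourier_coeff Y f l k\<bar>\<^sup>2)
            = (\<Sum>k\<in>idx l. a l / S * (qmc N x (Y l k))\<^sup>2)"
          using False l a_pos[of l] S(2)
          by (intro sum.cong refl)
             (simp add: fourier_coeff_def coeff w_def power_divide power_mult_distrib power2_eq_square field_simps)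
        then show ?thesis using False by (simp add: energy_def sum_distrib_left sum_divide_distrib)
      qed
    qed
    also have "\<dots> = (\<Sum>l=1..n. a l * energy N x l / S)"
      by (rule sum.mono_neutral_cong_right) auto
    also have "\<dots> = 1" using S by (simp add: sum_divide_distrib[symmetric])
    finally show ?thesis by (simp add: sobolev_norm_def)
  qed
  moreover have "(\<integral>z. f z \<partial>sphere_measure) = 0"
  proof -
    have "(\<integral>z. f z \<partial>sphere_measure) = (\<Sum>\<alpha>\<in>J n. \<integral>z. w \<alpha> * YY \<alpha> z \<partial>sphere_measure)"
      unfolding f_def by (intro integral_sphere_sum continuous_intros continuous_YY)
    also have "\<dots> = 0"
      by (intro sum.neutral ballI) (auto simp: J_def w_def integral_Y)
    finally show ?thesis .
  qed
  moreover have "qmc N x f = sqrt S"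
  proof -
    have "qmc N x f = (\<Sum>\<alpha>\<in>J n. w \<alpha> * qmc N x (YY \<alpha>))"
      unfolding qmc_def f_def by (simp add: sum_distrib_left sum_divide_distrib) (rule sum.swap)
    also have "\<dots> = (\<Sum>l\<le>n. \<Sum>k\<in>idx l. w (l, k) * qmc N x (Y l k))"
      using sum_J[of "\<lambda>l k. w (l, k) * qmc N x (Y l k)" n] by simp
    also have "\<dots> = (\<Sum>l\<le>n. if l = 0 then 0 else a l * energy N x l / sqrt S)"
      by (intro sum.cong refl)
        (auto simp: w_def energy_def sum_distrib_left sum_divide_distrib power2_eq_square mult.assoc)
    also have "\<dots> = (\<Sum>l=1..n. a l * energy N x l / sqrt S)"
      by (rule sum.mono_neutral_cong_right) auto
    also have "\<dots> = S / sqrt S" using S by (simp add: sum_divide_distrib[symmetric])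
    also have "\<dots> = sqrt S" using S(2) by (simp add: real_div_sqrt)
    finally show ?thesis .
  qed
  ultimately show ?thesis using S(2) by (intro bexI[of _ f]) auto
qed

text \<open>The cut-off representers exhaust the bound of qmc_error_le.\<close>
lemma wce_squared:
  assumes N: "1 \<le> N" and x: "\<And>j. j \<in> {1..N} \<Longrightarrow> x j \<in> sphere 0 1"
  shows "(wce d s a Y N x)\<^sup>2 = (\<Sum>l. a (Suc l) * energy N x (Suc l))"
proof -
  let ?E = "\<Sum>l. a (Suc l) * energy N x (Suc l)"
  let ?A = "{\<bar>qmc N x f - (\<integral>y. f y \<partial>sphere_measure)\<bar> |f.
            f \<in> sobolev_space d s Y \<and> sobolev_norm d a Y f \<le> 1}"
  have E0: "0 \<le> ?E"
    using a_pos energy_nonneg by (intro suminf_nonneg summable_energy N x) (auto simp: less_imp_le)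
  have "(\<lambda>_. 0) \<in> sobolev_space d s Y" "sobolev_norm d a Y (\<lambda>_. 0) \<le> 1"
    by (simp_all add: sobolev_space_def sobolev_norm_def fourier_coeff_def)
  then have zeroA: "0 \<in> ?A"
    by (intro CollectI exI[of _ "\<lambda>_. 0"]) (simp add: qmc_def)
  have ub: "u \<le> sqrt ?E" if u: "u \<in> ?A" for u
  proof -
    obtain f where "f \<in> sobolev_space d s Y" "sobolev_norm d a Y f \<le> 1"
      "u = \<bar>qmc N x f - (\<integral>y. f y \<partial>sphere_measure)\<bar>" using u by blast
    then show ?thesis using qmc_error_le[where x=x, OF N x] by simp
  qed
  have bdd: "bdd_above ?A" using ub by (rule bdd_aboveI)
  have le: "wce d s a Y N x \<le> sqrt ?E"
    unfolding wce_def using zeroA ub by (intro cSup_least) auto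
  have nonneg: "0 \<le> wce d s a Y N x"
    unfolding wce_def by (rule cSup_upper[OF zeroA bdd])
  have part: "(\<Sum>l<n. a (Suc l) * energy N x (Suc l)) \<le> (wce d s a Y N x)\<^sup>2" for n
  proof -
    define S where "S = (\<Sum>l=1..n. a l * energy N x l)"
    have eq: "(\<Sum>l<n. a (Suc l) * energy N x (Suc l)) = S"
      unfolding S_def by (rule sum.reindex_bij_witness[of _ "\<lambda>l. l - 1" Suc]) auto
    show ?thesis
    proof (cases "S > 0")
      case True
      from wce_lower_partial[where x=x, OF N x S_def True] have "sqrt S \<in> ?A" by force
      then have "sqrt S \<le> wce d s a Y N x" unfolding wce_def by (rule cSup_upper[OF _ bdd])
      then have "(sqrt S)\<^sup>2 \<le> (wce d s a Y N x)\<^sup>2" using True by (intro power_mono) auto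
      then show ?thesis using True eq by simp
    qed (use eq in \<open>simp add: order.trans[OF _ zero_le_power2]\<close>)
  qed
  have "?E \<le> (wce d s a Y N x)\<^sup>2"
    by (rule suminf_le_const[OF summable_energy[where x=x, OF N x] part])
  moreover have "(wce d s a Y N x)\<^sup>2 \<le> ?E"
    using power_mono[OF le nonneg, of 2] E0 by simp
  ultimately show ?thesis by (rule antisym[rotated])
qed

end

section \<open>Independent points\<close>

lemma integral_uniform_measure:
  fixes f :: "'b \<Rightarrow> real"
  assumes f: "f \<in> borel_measurable M" and A: "A \<in> sets M" and pos: "0 < measure M A"
  shows "(\<integral>x. f x \<partial>uniform_measure M A) = (\<integral>x. indicator A x * f x \<partial>M) / measure M A"
proof -
  have em: "emeasure M A = ennreal (measure M A)"
    using pos by (intro emeasure_eq_ennreal_measure) (auto simp: measure_def)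
  have "uniform_measure M A = density M (\<lambda>x. ennreal (indicator A x / measure M A))"
    unfolding uniform_measure_def em using pos
    by (intro arg_cong[where f="density M"] ext) (auto split: split_indicator simp: divide_ennreal simp flip: ennreal_1)
  then have "(\<integral>x. f x \<partial>uniform_measure M A) = (\<integral>x. (indicator A x / measure M A) *\<^sub>R f x \<partial>M)"
    using f A pos by (simp add: integral_density)
  then show ?thesis by simp
qed

lemma measurable_PiM_coordinate:
  "i \<in> I \<Longrightarrow> f \<in> borel_measurable (M i) \<Longrightarrow> (\<lambda>x. f (x i)) \<in> borel_measurable (PiM I M)"
  by (rule measurable_compose[OF measurable_component_singleton])

lemma integral_PiM_component:
  fixes g :: "'b \<Rightarrow> real"
  assumes "\<And>i. i \<in> I \<Longrightarrow> prob_space (M i)" "j \<in> I" "g \<in> borel_measurable (M j)"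
  shows "(\<integral>x. g (x j) \<partial>PiM I M) = (\<integral>z. g z \<partial>M j)"
proof -
  have "(\<integral>z. g z \<partial>distr (PiM I M) (M j) (\<lambda>x. x j)) = (\<integral>x. g (x j) \<partial>PiM I M)"
    using assms by (intro integral_distr) auto
  then show ?thesis using distr_PiM_component[of I M j] assms by simp
qed

text \<open>The product formula holds for a factor in every coordinate; the other factors are constant 1.
  Outside I the family M is replaced by trivial probability spaces.\<close>
lemma integral_PiM_two_components:
  fixes g h :: "'b \<Rightarrow> real"
  assumes I: "finite I" and M: "\<And>i. i \<in> I \<Longrightarrow> prob_space (M i)"
    and jk: "j \<in> I" "k \<in> I" "j \<noteq> k" and g: "integrable (M j) g" and h: "integrable (M k) h"
  shows "(\<integral>x. g (x j) * h (x k) \<partial>PiM I M) = (\<integral>z. g z \<partial>M j) * (\<integral>z. h z \<partial>M k)"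
proof -
  define M' where "M' i = (if i \<in> I then M i else count_space {undefined})" for i
  have M'_prob: "prob_space (M' i)" for i
    using M by (cases "i \<in> I") (auto simp: M'_def intro!: prob_spaceI)
  interpret product_sigma_finite M'
    unfolding product_sigma_finite_def using M'_prob prob_space_imp_sigma_finite by blast
  define f where "f i = (if i = j then g else if i = k then h else (\<lambda>_. 1))" for i
  have int_f: "integrable (M' i) (f i)" if "i \<in> I" for i
  proof -
    interpret prob_space "M i" using M[OF that] .
    show ?thesis using that g h by (auto simp: f_def M'_def)
  qed
  have prod_jk: "(\<Prod>i\<in>I. c i) = c j * c k" if "\<And>i. i \<in> I - {j, k} \<Longrightarrow> c i = 1" for c :: "_ \<Rightarrow> real"
  proof -
    have "(\<Prod>i\<in>I. c i) = (\<Prod>i\<in>{j, k}. c i)"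
      using I jk that by (intro prod.mono_neutral_right) auto
    then show ?thesis using jk(3) by simp
  qed
  have "PiM I M = PiM I M'" by (rule PiM_cong) (auto simp: M'_def)
  then have "(\<integral>x. g (x j) * h (x k) \<partial>PiM I M) = (\<integral>x. (\<Prod>i\<in>I. f i (x i)) \<partial>PiM I M')"
    using jk(3) by (subst prod_jk) (auto simp: f_def)
  also have "\<dots> = (\<Prod>i\<in>I. \<integral>z. f i z \<partial>M' i)"
    by (rule product_integral_prod[OF I int_f])
  also have "\<dots> = (\<integral>z. f j z \<partial>M' j) * (\<integral>z. f k z \<partial>M' k)"
    using prob_space.prob_space[OF M'_prob] by (intro prod_jk) (auto simp: f_def)
  finally show ?thesis using jk by (simp add: f_def M'_def)
qed

text \<open>Independent variables with mean 0 are orthogonal.\<close>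
lemma integral_PiM_square_sum:
  fixes g :: "'i \<Rightarrow> 'b \<Rightarrow> real"
  assumes I: "finite I" and M: "\<And>i. i \<in> I \<Longrightarrow> prob_space (M i)"
    and g: "\<And>i. i \<in> I \<Longrightarrow> g i \<in> borel_measurable (M i)"
    and bd: "\<And>i z. i \<in> I \<Longrightarrow> z \<in> space (M i) \<Longrightarrow> \<bar>g i z\<bar> \<le> C"
    and zero: "\<And>i. i \<in> I \<Longrightarrow> (\<integral>z. g i z \<partial>M i) = 0"
  shows "(\<integral>x. (\<Sum>i\<in>I. g i (x i))\<^sup>2 \<partial>PiM I M) = (\<Sum>i\<in>I. \<integral>z. (g i z)\<^sup>2 \<partial>M i)"
proof -
  interpret P: prob_space "PiM I M" by (rule prob_space_PiM) (rule M)
  have gm: "(\<lambda>x. g i (x i)) \<in> borel_measurable (PiM I M)" if "i \<in> I" for i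
    by (rule measurable_PiM_coordinate[where f="g i" and M=M, OF that g[OF that]])
  have intg: "integrable (M i) (g i)" if "i \<in> I" for i
  proof -
    interpret prob_space "M i" using M[OF that] .
    show ?thesis using g bd that by (intro integrable_const_bound[where B=C] AE_I2) auto
  qed
  have int2: "integrable (PiM I M) (\<lambda>x. g i (x i) * g k (x k))" if "i \<in> I" "k \<in> I" for i k
  proof (rule P.integrable_const_bound[where B="C * C"])
    show "AE x in PiM I M. norm (g i (x i) * g k (x k)) \<le> C * C"
    proof (rule AE_I2)
      fix x assume "x \<in> space (PiM I M)"
      then have "x i \<in> space (M i)" "x k \<in> space (M k)" using that by (auto simp: space_PiM)
      then have "\<bar>g i (x i)\<bar> \<le> C" "\<bar>g k (x k)\<bar> \<le> C" using bd that by auto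
      then show "norm (g i (x i) * g k (x k)) \<le> C * C"
        by (simp add: abs_mult) (intro mult_mono, auto)
    qed
  qed (intro borel_measurable_times gm that)
  have "(\<integral>x. (\<Sum>i\<in>I. g i (x i))\<^sup>2 \<partial>PiM I M) = (\<Sum>i\<in>I. \<Sum>k\<in>I. \<integral>x. g i (x i) * g k (x k) \<partial>PiM I M)"
    unfolding power2_eq_square sum_product using int2
    by (subst Bochner_Integration.integral_sum) (auto intro!: sum.cong Bochner_Integration.integral_sum)
  also have "\<dots> = (\<Sum>i\<in>I. \<Sum>k\<in>I. if i = k then \<integral>z. (g i z)\<^sup>2 \<partial>M i else 0)"
  proof (intro sum.cong refl)
    fix i k assume ik: "i \<in> I" "k \<in> I"
    show "(\<integral>x. g i (x i) * g k (x k) \<partial>PiM I M) = (if i = k then \<integral>z. (g i z)\<^sup>2 \<partial>M i else 0)"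
    proof (cases "i = k")
      case True
      then show ?thesis
        using integral_PiM_component[of I M i "\<lambda>z. (g i z)\<^sup>2"] M ik g by (simp add: power2_eq_square)
    next
      case False
      then show ?thesis
        using integral_PiM_two_components[OF I M ik False intg[OF ik(1)] intg[OF ik(2)]] zero ik by simp
    qed
  qed
  also have "\<dots> = (\<Sum>i\<in>I. \<integral>z. (g i z)\<^sup>2 \<partial>M i)" using I by simp
  finally show ?thesis .
qed

lemma (in prob_space) variance_le_second_moment:
  fixes f :: "'a \<Rightarrow> real"
  assumes f: "integrable M f" "integrable M (\<lambda>x. (f x)\<^sup>2)"
  shows "(\<integral>x. (f x - expectation f)\<^sup>2 \<partial>M) \<le> (\<integral>x. (f x - c)\<^sup>2 \<partial>M)"
proof -
  have sq: "(\<integral>x. (f x - b)\<^sup>2 \<partial>M) = (\<integral>x. (f x)\<^sup>2 \<partial>M) - 2 * b * expectation f + b\<^sup>2" for b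
  proof -
    have "(\<integral>x. (f x - b)\<^sup>2 \<partial>M) = (\<integral>x. (f x)\<^sup>2 - 2 * b * f x + b\<^sup>2 \<partial>M)"
      by (rule Bochner_Integration.integral_cong) (auto simp: power2_eq_square algebra_simps)
    also have "\<dots> = (\<integral>x. (f x)\<^sup>2 \<partial>M) - 2 * b * expectation f + b\<^sup>2"
      using f by (simp add: Bochner_Integration.integral_add Bochner_Integration.integral_diff prob_space)
    finally show ?thesis .
  qed
  have "0 \<le> (expectation f - c)\<^sup>2" by simp
  then show ?thesis unfolding sq by (simp add: power2_eq_square algebra_simps)
qed

section \<open>Sums of powers\<close>

text \<open>The mean value theorem gives the factor 1 / r if the derivative of the power decreases; otherwise
  comparing the integer multiples directly gives the factor 1, also for k = 0.\<close>
lemma powr_step_ge: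
  fixes r :: real and k :: nat
  assumes r: "0 < r"
  shows "real (Suc k) powr (r - 1) \<le> max 1 (1 / r) * (real (Suc k) powr r - real k powr r)"
proof (cases "k = 0")
  case True
  then show ?thesis using r by simp
next
  case False
  have "\<exists>z. real k < z \<and> z < real (Suc k) \<and>
      real (Suc k) powr r - real k powr r = (real (Suc k) - real k) * (r * z powr (r - 1))"
    using False by (intro MVT2) (auto intro!: DERIV_powr has_real_derivative_powr)
  then obtain z where z: "real k < z" "z < real (Suc k)"
    "real (Suc k) powr r - real k powr r = r * z powr (r - 1)" by auto
  show ?thesis
  proof (cases "r \<le> 1")
    case True
    have "real (Suc k) powr (r - 1) \<le> z powr (r - 1)"
      using z False True by (intro powr_mono2') auto
    then have "real (Suc k) powr (r - 1) \<le> (1 / r) * (r * z powr (r - 1))" using r by simp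
    also have "\<dots> \<le> max 1 (1 / r) * (r * z powr (r - 1))"
      using r by (intro mult_right_mono) auto
    finally show ?thesis using z(3) by simp
  next
    case r1: False
    have p: "real n powr r = real n * real n powr (r - 1)" for n
      by (cases "n = 0") (auto simp: powr_mult_base)
    have "real k * real k powr (r - 1) \<le> real k * real (Suc k) powr (r - 1)"
      using r1 by (intro mult_left_mono powr_mono2) auto
    then have "real (Suc k) powr (r - 1) \<le> real (Suc k) powr r - real k powr r"
      unfolding p by (simp add: algebra_simps)
    also have "\<dots> \<le> max 1 (1 / r) * (real (Suc k) powr r - real k powr r)"
      using r powr_mono2[of r "real k" "real (Suc k)"]
        mult_right_mono[of 1 "max 1 (1 / r)" "real (Suc k) powr r - real k powr r"] by simp
    finally show ?thesis .
  qed
qed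

lemma sum_powr_le:
  fixes r :: real
  assumes "0 < r"
  shows "(\<Sum>n=1..k. real n powr (r - 1)) \<le> max 1 (1 / r) * real k powr r"
proof (induction k)
  case (Suc k)
  have "(\<Sum>n=1..Suc k. real n powr (r - 1))
      \<le> max 1 (1 / r) * real k powr r + max 1 (1 / r) * (real (Suc k) powr r - real k powr r)"
    using Suc.IH powr_step_ge[OF assms, of k] by simp
  then show ?case by (simp add: algebra_simps)
qed simp

lemma sum_powr_tail_le:
  fixes e :: real
  assumes e: "0 < e" and k: "1 \<le> k"
  shows "(\<Sum>n=Suc k..k+m. real n powr (- 1 - e)) \<le> (1 / e) * (real k powr (- e) - real (k + m) powr (- e))"
proof (induction m)
  case (Suc m)
  define q where "q = k + m"
  have q: "1 \<le> q" using k by (simp add: q_def)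
  have "\<exists>z. real q < z \<and> z < real (Suc q) \<and>
      real (Suc q) powr (- e) - real q powr (- e) = (real (Suc q) - real q) * (- e * z powr (- e - 1))"
  proof (rule MVT2)
    fix y assume "real q \<le> y"
    then show "((\<lambda>x. x powr (- e)) has_real_derivative - e * y powr (- e - 1)) (at y)"
      using q by (intro has_real_derivative_powr) simp
  qed simp
  then obtain z where z: "real q < z" "z < real (Suc q)"
    "real (Suc q) powr (- e) - real q powr (- e) = - e * z powr (- e - 1)" by auto
  have "real (Suc q) powr (- e - 1) \<le> z powr (- e - 1)"
    using z q e by (intro powr_mono2') auto
  also have "\<dots> = (1 / e) * (real q powr (- e) - real (Suc q) powr (- e))"
    using z(3) e by (simp add: field_simps)
  finally have step: "real (Suc q) powr (- 1 - e)
      \<le> (1 / e) * (real q powr (- e) - real (Suc q) powr (- e))"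
    by (simp only: minus_diff_commute[of 1 e])
  have "(\<Sum>n=Suc k..k+Suc m. real n powr (- 1 - e))
      = (\<Sum>n=Suc k..k+m. real n powr (- 1 - e)) + real (Suc q) powr (- 1 - e)"
    by (simp add: q_def)
  also have "\<dots> \<le> (1 / e) * (real k powr (- e) - real q powr (- e))
      + (1 / e) * (real q powr (- e) - real (Suc q) powr (- e))"
    using Suc.IH step by (intro add_mono) (simp_all only: q_def)
  also have "\<dots> = (1 / e) * (real k powr (- e) - real (k + Suc m) powr (- e))"
    by (simp add: q_def diff_divide_distrib)
  finally show ?case .
qed simp

text \<open>Split the sum at n = M. Up to M the terms are n^(1-e) / M^2 and add up to order M^(2-e) / M^2, since
  e < 2. Beyond M they are n^(-1-e) and add up to order M^(-e), since e > 0.\<close>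
lemma truncated_power_sum:
  fixes e :: real
  assumes e: "0 < e" "e < 2"
  shows "\<exists>K>0. \<forall>M\<ge>1. \<forall>m. (\<Sum>n=1..m. real n powr (- 1 - e) * min 1 ((real n / M)\<^sup>2)) \<le> K * M powr (- e)"
proof -
  define C where "C = max 1 (1 / (2 - e))"
  have C: "C \<ge> 1" by (simp add: C_def)
  have "(\<Sum>n=1..m. real n powr (- 1 - e) * min 1 ((real n / M)\<^sup>2)) \<le> (C + 2 powr e / e) * M powr (- e)"
    if M: "M \<ge> 1" for M :: real and m
  proof -
    define k where "k = nat \<lfloor>M\<rfloor>"
    have k: "1 \<le> k" "real k \<le> M" "M / 2 \<le> real k"
    proof -
      have "1 \<le> \<lfloor>M\<rfloor>" using M by linarith
      then have "real k = of_int \<lfloor>M\<rfloor>" "1 \<le> real k" by (simp_all add: k_def)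
      then show "1 \<le> k" "real k \<le> M" "M / 2 \<le> real k" by linarith+
    qed
    let ?t = "\<lambda>n. real n powr (- 1 - e) * min 1 ((real n / M)\<^sup>2)"
    have "(\<Sum>n=1..m. ?t n) \<le> (\<Sum>n=1..k+m. ?t n)"
      by (intro sum_mono2) auto
    also have "\<dots> = (\<Sum>n=1..k. ?t n) + (\<Sum>n=Suc k..k+m. ?t n)"
      using k(1) sum.ub_add_nat[of 1 k ?t m] by simp
    also have "(\<Sum>n=1..k. ?t n) \<le> (\<Sum>n=1..k. real n powr ((2 - e) - 1) / M\<^sup>2)"
    proof (rule sum_mono)
      fix n assume n: "n \<in> {1..k}"
      have "?t n \<le> real n powr (- 1 - e) * (real n / M)\<^sup>2" by (intro mult_left_mono) auto
      also have "\<dots> = real n powr (- 1 - e) * real n powr 2 / M\<^sup>2"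
        using n by (simp add: power_divide)
      also have "real n powr (- 1 - e) * real n powr 2 = real n powr ((2 - e) - 1)"
        unfolding powr_add[symmetric] by (simp add: algebra_simps)
      finally show "?t n \<le> real n powr ((2 - e) - 1) / M\<^sup>2" .
    qed
    also have "\<dots> = (\<Sum>n=1..k. real n powr ((2 - e) - 1)) / M\<^sup>2"
      by (rule sum_divide_distrib[symmetric])
    also have "\<dots> \<le> (C * M powr (2 - e)) / M\<^sup>2"
    proof (intro divide_right_mono)
      have "(\<Sum>n=1..k. real n powr ((2 - e) - 1)) \<le> C * real k powr (2 - e)"
        unfolding C_def using e by (intro sum_powr_le) simp
      also have "\<dots> \<le> C * M powr (2 - e)"
        using C k e by (intro mult_left_mono powr_mono2) auto
      finally show "(\<Sum>n=1..k. real n powr ((2 - e) - 1)) \<le> C * M powr (2 - e)" .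
    qed simp
    also have "(C * M powr (2 - e)) / M\<^sup>2 = C * M powr (- e)"
    proof -
      have "M\<^sup>2 = M powr 2" using M by simp
      then have "M powr (2 - e) / M\<^sup>2 = M powr ((2 - e) - 2)" by (simp only: powr_diff)
      then have "M powr (2 - e) / M\<^sup>2 = M powr (- e)" by simp
      then show ?thesis by (simp only: times_divide_eq_right[symmetric])
    qed
    also have "(\<Sum>n=Suc k..k+m. ?t n) \<le> (\<Sum>n=Suc k..k+m. real n powr (- 1 - e))"
      by (intro sum_mono mult_left_le) auto
    also have "\<dots> \<le> (1 / e) * (real k powr (- e) - real (k + m) powr (- e))"
      by (rule sum_powr_tail_le[OF e(1) k(1)])
    also have "\<dots> \<le> (1 / e) * real k powr (- e)"
      using e by (intro mult_left_mono) auto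
    also have "\<dots> \<le> (1 / e) * (M / 2) powr (- e)"
      using e k M by (intro mult_left_mono powr_mono2') auto
    also have "(M / 2) powr (- e) = M powr (- e) * 2 powr e"
    proof -
      have "(M / 2) powr (- e) = M powr (- e) / 2 powr (- e)" by (rule powr_divide)
      then show ?thesis by (simp only: powr_minus[of 2] divide_inverse inverse_inverse_eq)
    qed
    finally show ?thesis by (simp add: algebra_simps)
  qed
  moreover have "C + 2 powr e / e > 0" using C e by (simp add: add_pos_pos)
  ultimately show ?thesis by blast
qed

context sobolev_setting
begin

section \<open>Lower bound for arbitrary nodes\<close>

definition dim_upto :: "nat \<Rightarrow> real" where "dim_upto L = (\<Sum>l\<le>L. Z l)"

lemma sum_J_squares: "x \<in> sphere 0 1 \<Longrightarrow> (\<Sum>\<alpha>\<in>J L. (YY \<alpha> x)\<^sup>2) = dim_upto L"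
  unfolding dim_upto_def by (subst sum_J[of "\<lambda>l k. (Y l k x)\<^sup>2"]) (simp add: addition_theorem_diagonal)

text \<open>The squared norm of g minus its projection p is non-negative.\<close>
lemma bessel_inequality:
  assumes g: "continuous_on (sphere 0 1) g"
  shows "(\<Sum>\<alpha>\<in>J L. (l2_inner g (YY \<alpha>))\<^sup>2) \<le> l2_inner g g"
proof -
  define p where "p x = (\<Sum>\<alpha>\<in>J L. l2_inner g (YY \<alpha>) * YY \<alpha> x)" for x
  have cp: "continuous_on (sphere 0 1) p"
    unfolding p_def[abs_def] by (intro continuous_intros continuous_YY)
  have pY: "l2_inner p h = (\<Sum>\<alpha>\<in>J L. l2_inner g (YY \<alpha>) * l2_inner (YY \<alpha>) h)"
    if "continuous_on (sphere 0 1) h" for h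
    unfolding p_def[abs_def] by (intro l2_inner_sum_left continuous_YY that)
  have pg: "l2_inner p g = (\<Sum>\<alpha>\<in>J L. (l2_inner g (YY \<alpha>))\<^sup>2)"
    unfolding pY[OF g] by (simp add: power2_eq_square mult.commute)
  have pp: "l2_inner p p = (\<Sum>\<alpha>\<in>J L. (l2_inner g (YY \<alpha>))\<^sup>2)"
  proof -
    have "l2_inner (YY \<alpha>) p = l2_inner g (YY \<alpha>)" if "\<alpha> \<in> J L" for \<alpha>
      using l2_inner_sum_YY[OF that, of "\<lambda>\<alpha>. l2_inner g (YY \<alpha>)" L] that
      unfolding p_def[abs_def] by (simp add: mult.commute)
    then show ?thesis unfolding pY[OF cp] by (simp add: power2_eq_square)
  qed
  have "0 \<le> l2_inner (\<lambda>x. g x - p x) (\<lambda>x. g x - p x)"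
    by (intro integral_nonneg_AE AE_I2) simp
  also have "\<dots> = l2_inner g (\<lambda>x. g x - p x) - l2_inner p (\<lambda>x. g x - p x)"
    by (intro l2_inner_diff_left continuous_intros g cp)
  also have "l2_inner g (\<lambda>x. g x - p x) = l2_inner g g - l2_inner p g"
    using l2_inner_diff_left[OF g cp g] by (simp add: mult.commute)
  also have "l2_inner p (\<lambda>x. g x - p x) = l2_inner p g - l2_inner p p"
    using l2_inner_diff_left[OF g cp cp] by (simp add: mult.commute)
  finally show ?thesis using pg pp by simp
qed

text \<open>Let G be the reproducing kernel of the harmonics of degree at most L. The mean of G^2 over all
  pairs of nodes is computed in two ways. Its diagonal part is D^2 / N, where D = dim_upto L. On the
  other hand it is the sum of the squared means of the products of two harmonics of degree at most L.
  These products have degree at most 2 L, so each mean is an inner product with the polynomial w that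
  represents the mean in these degrees, and Bessel's inequality bounds the sum by D times the squared
  norm of w.\<close>
lemma energy_sum_ge:
  assumes N: "1 \<le> N" and x: "\<And>j. j \<in> {1..N} \<Longrightarrow> x j \<in> sphere 0 1"
    and L: "2 * real N \<le> dim_upto L"
  shows "1 \<le> (\<Sum>l=1..2*L. energy N x l)"
proof -
  define v where "v \<gamma> = qmc N x (YY \<gamma>)" for \<gamma>
  define w where "w z = (\<Sum>\<gamma>\<in>J (2*L). v \<gamma> * YY \<gamma> z)" for z
  have cw: "continuous_on (sphere 0 1) w"
    unfolding w_def[abs_def] by (intro continuous_intros continuous_YY)
  have w_inner: "l2_inner w h = (\<Sum>\<gamma>\<in>J (2*L). v \<gamma> * l2_inner (YY \<gamma>) h)"
    if "continuous_on (sphere 0 1) h" for h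
    unfolding w_def[abs_def] by (intro l2_inner_sum_left continuous_YY that)
  define D where "D = dim_upto L"
  have D: "D > 0" using L N by (simp add: D_def)
  have ww: "l2_inner w w = (\<Sum>l\<le>2*L. energy N x l)"
  proof -
    have "l2_inner w w = (\<Sum>\<gamma>\<in>J (2*L). v \<gamma> * l2_inner (YY \<gamma>) w)"
      by (rule w_inner[OF cw])
    also have "\<dots> = (\<Sum>\<gamma>\<in>J (2*L). (v \<gamma>)\<^sup>2)"
    proof (rule sum.cong[OF refl])
      fix \<gamma> assume "\<gamma> \<in> J (2*L)"
      then have "l2_inner (YY \<gamma>) w = v \<gamma>"
        using l2_inner_sum_YY[of \<gamma> "2*L" v "2*L"] unfolding w_def[abs_def] by (simp add: mult.commute)
      then show "v \<gamma> * l2_inner (YY \<gamma>) w = (v \<gamma>)\<^sup>2" by (simp add: power2_eq_square)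
    qed
    also have "\<dots> = (\<Sum>l\<le>2*L. energy N x l)"
      unfolding v_def energy_def by (rule sum_J)
    finally show ?thesis .
  qed
  have product: "qmc N x (\<lambda>z. YY \<alpha> z * YY \<beta> z) = l2_inner (\<lambda>z. w z * YY \<beta> z) (YY \<alpha>)"
    if \<alpha>: "\<alpha> \<in> J L" and \<beta>: "\<beta> \<in> J L" for \<alpha> \<beta>
  proof -
    define p where "p z = harm_rep (fst \<alpha>) (snd \<alpha>) z * harm_rep (fst \<beta>) (snd \<beta>) z" for z
    have a: "snd \<alpha> \<in> idx (fst \<alpha>)" "fst \<alpha> \<le> L" and b: "snd \<beta> \<in> idx (fst \<beta>)" "fst \<beta> \<le> L"
      using \<alpha> \<beta> by (auto simp: J_def)
    have hp: "hom_poly Basis (fst \<alpha> + fst \<beta>) p"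
      unfolding p_def[abs_def] using harm_rep(1)[OF a(1)] harm_rep(1)[OF b(1)]
      by (intro hom_poly_mult) (auto simp: harmonic_poly_def)
    have pY: "p z = YY \<alpha> z * YY \<beta> z" if "z \<in> sphere 0 1" for z
      using harm_rep(2)[OF a(1) that] harm_rep(2)[OF b(1) that] by (simp add: p_def)
    have cp: "continuous_on (sphere 0 1) p" by (rule rpf_continuous_on[OF hom_poly_rpf[OF hp]])
    have exp: "p z = (\<Sum>\<gamma>\<in>J (2*L). l2_inner p (YY \<gamma>) * YY \<gamma> z)" if "z \<in> sphere 0 1" for z
      using a(2) b(2) that by (intro hom_poly_expansion[OF hp]) auto
    have "qmc N x (\<lambda>z. YY \<alpha> z * YY \<beta> z) = qmc N x (\<lambda>z. \<Sum>\<gamma>\<in>J (2*L). l2_inner p (YY \<gamma>) * YY \<gamma> z)"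
      unfolding qmc_def
    proof (intro arg_cong2[where f="(*)"] sum.cong refl)
      fix j assume "j \<in> {1..N}"
      then have "x j \<in> sphere 0 1" by (rule x)
      from pY[OF this] exp[OF this]
      show "YY \<alpha> (x j) * YY \<beta> (x j) = (\<Sum>\<gamma>\<in>J (2*L). l2_inner p (YY \<gamma>) * YY \<gamma> (x j))" by simp
    qed
    also have "\<dots> = (\<Sum>\<gamma>\<in>J (2*L). l2_inner p (YY \<gamma>) * v \<gamma>)"
      unfolding qmc_def v_def by (simp add: sum_distrib_left sum_divide_distrib) (rule sum.swap)
    also have "\<dots> = (\<Sum>\<gamma>\<in>J (2*L). v \<gamma> * l2_inner (YY \<gamma>) p)"
      by (simp add: mult.commute)
    also have "\<dots> = l2_inner w p"
      by (rule w_inner[OF cp, symmetric])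
    also have "\<dots> = l2_inner (\<lambda>z. w z * YY \<beta> z) (YY \<alpha>)"
      by (rule Bochner_Integration.integral_cong) (auto simp: pY mult_ac)
    finally show ?thesis .
  qed
  have "(\<Sum>\<beta>\<in>J L. \<Sum>\<alpha>\<in>J L. (qmc N x (\<lambda>z. YY \<alpha> z * YY \<beta> z))\<^sup>2)
      \<le> (\<Sum>\<beta>\<in>J L. l2_inner (\<lambda>z. w z * YY \<beta> z) (\<lambda>z. w z * YY \<beta> z))"
  proof (rule sum_mono)
    fix \<beta> assume \<beta>: "\<beta> \<in> J L"
    have "(\<Sum>\<alpha>\<in>J L. (qmc N x (\<lambda>z. YY \<alpha> z * YY \<beta> z))\<^sup>2)
        = (\<Sum>\<alpha>\<in>J L. (l2_inner (\<lambda>z. w z * YY \<beta> z) (YY \<alpha>))\<^sup>2)"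
      using product \<beta> by (intro sum.cong refl) simp
    also have "\<dots> \<le> l2_inner (\<lambda>z. w z * YY \<beta> z) (\<lambda>z. w z * YY \<beta> z)"
      by (intro bessel_inequality continuous_intros cw continuous_YY[OF \<beta>])
    finally show "(\<Sum>\<alpha>\<in>J L. (qmc N x (\<lambda>z. YY \<alpha> z * YY \<beta> z))\<^sup>2)
        \<le> l2_inner (\<lambda>z. w z * YY \<beta> z) (\<lambda>z. w z * YY \<beta> z)" .
  qed
  also have "\<dots> = (\<integral>z. (\<Sum>\<beta>\<in>J L. (w z * YY \<beta> z) * (w z * YY \<beta> z)) \<partial>sphere_measure)"
    by (intro integral_sphere_sum[symmetric] continuous_intros cw continuous_YY)
  also have "\<dots> = (\<integral>z. D * (w z * w z) \<partial>sphere_measure)"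
  proof (rule Bochner_Integration.integral_cong[OF refl])
    fix z :: 'a assume "z \<in> space sphere_measure"
    then have z: "z \<in> sphere 0 1" by simp
    have "(\<Sum>\<beta>\<in>J L. (w z * YY \<beta> z) * (w z * YY \<beta> z)) = (w z * w z) * (\<Sum>\<beta>\<in>J L. (YY \<beta> z)\<^sup>2)"
      by (simp add: sum_distrib_left power2_eq_square mult_ac)
    then show "(\<Sum>\<beta>\<in>J L. (w z * YY \<beta> z) * (w z * YY \<beta> z)) = D * (w z * w z)"
      using sum_J_squares[OF z, of L] by (simp add: D_def)
  qed
  also have "\<dots> = D * l2_inner w w" by simp
  finally have upper: "(\<Sum>\<beta>\<in>J L. \<Sum>\<alpha>\<in>J L. (qmc N x (\<lambda>z. YY \<alpha> z * YY \<beta> z))\<^sup>2) \<le> D * l2_inner w w" .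
  define G where "G i j = (\<Sum>\<alpha>\<in>J L. YY \<alpha> (x i) * YY \<alpha> (x j))" for i j
  have "D\<^sup>2 / real N = 1 / (real N)\<^sup>2 * (\<Sum>i=1..N. (G i i)\<^sup>2)"
  proof -
    have "G i i = D" if "i \<in> {1..N}" for i
      using sum_J_squares[OF x[OF that], of L] by (simp add: G_def D_def power2_eq_square)
    then show ?thesis using N by (simp add: power2_eq_square)
  qed
  also have "\<dots> \<le> 1 / (real N)\<^sup>2 * (\<Sum>i=1..N. \<Sum>j=1..N. (G i j)\<^sup>2)"
  proof (intro mult_left_mono sum_mono)
    fix i assume "i \<in> {1..N}"
    then show "(G i i)\<^sup>2 \<le> (\<Sum>j=1..N. (G i j)\<^sup>2)"
      by (intro member_le_sum[of i "{1..N}" "\<lambda>j. (G i j)\<^sup>2"]) auto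
  qed simp
  also have "\<dots> = (\<Sum>\<beta>\<in>J L. \<Sum>\<alpha>\<in>J L. (qmc N x (\<lambda>z. YY \<alpha> z * YY \<beta> z))\<^sup>2)"
  proof -
    have "(\<Sum>\<beta>\<in>J L. \<Sum>\<alpha>\<in>J L. (qmc N x (\<lambda>z. YY \<alpha> z * YY \<beta> z))\<^sup>2)
        = 1 / (real N)\<^sup>2 * (\<Sum>\<beta>\<in>J L. \<Sum>\<alpha>\<in>J L. (\<Sum>i=1..N. YY \<alpha> (x i) * YY \<beta> (x i))\<^sup>2)"
      by (simp only: qmc_def power_mult_distrib power_one_over sum_distrib_left[symmetric])
    also have "(\<Sum>\<beta>\<in>J L. \<Sum>\<alpha>\<in>J L. (\<Sum>i=1..N. YY \<alpha> (x i) * YY \<beta> (x i))\<^sup>2)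
        = (\<Sum>\<beta>\<in>J L. \<Sum>\<alpha>\<in>J L. \<Sum>i=1..N. \<Sum>j=1..N.
            (YY \<alpha> (x i) * YY \<alpha> (x j)) * (YY \<beta> (x i) * YY \<beta> (x j)))"
      by (simp add: power2_eq_square sum_product mult_ac)
    also have "\<dots> = (\<Sum>i=1..N. \<Sum>j=1..N. \<Sum>\<beta>\<in>J L. \<Sum>\<alpha>\<in>J L.
            (YY \<alpha> (x i) * YY \<alpha> (x j)) * (YY \<beta> (x i) * YY \<beta> (x j)))"
      by (simp only: sum.swap[where A="J L" and B="{1..N}"])
    also have "\<dots> = (\<Sum>i=1..N. \<Sum>j=1..N. (G i j)\<^sup>2)"
      unfolding G_def power2_eq_square sum_product
      by (rule sum.cong[OF refl], rule sum.cong[OF refl], rule sum.swap)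
    finally show ?thesis by simp
  qed
  also note upper
  finally have "D * (D / real N) \<le> D * l2_inner w w" by (simp add: power2_eq_square)
  then have "D / real N \<le> l2_inner w w" by (rule mult_left_le_imp_le) (rule D)
  moreover have "2 \<le> D / real N" using L N by (simp add: D_def field_simps)
  ultimately have "2 \<le> (\<Sum>l\<le>2*L. energy N x l)" using ww by linarith
  moreover have "(\<Sum>l\<le>2*L. energy N x l) = energy N x 0 + (\<Sum>l=1..2*L. energy N x l)"
  proof -
    have "{..2*L} = insert 0 {1..2*L}" by auto
    then show ?thesis by simp
  qed
  moreover have "energy N x 0 \<le> 1" using energy_le_Z[where x=x, OF N x, of 0] Z_0 by simp
  ultimately show ?thesis by linarith
qed

text \<open>It suffices to take L proportional to N^(1/d) in energy_sum_ge.\<close>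
lemma wce_lower_bound:
  "\<exists>\<beta>>0. \<forall>N\<ge>1. \<forall>x. (\<forall>j\<in>{1..N}. x j \<in> sphere 0 1) \<longrightarrow>
     \<beta> * real N powr (- 2 * s / real d) \<le> (wce d s a Y N x)\<^sup>2"
proof -
  obtain c where c: "c > 0" "\<And>l. c * (1 + real l) powr (- 2 * s) \<le> a l" using weight_lower by blast
  \<comment> \<open>The constant 4 d + 3 comes from 1 + 2 L \<le> 3 + 4 d M \<le> (4 d + 3) M below.\<close>
  define \<beta> where "\<beta> = c * real (4 * d + 3) powr (- 2 * s)"
  have "\<beta> * real N powr (- 2 * s / real d) \<le> (wce d s a Y N x)\<^sup>2"
    if N: "1 \<le> N" and x: "\<forall>j\<in>{1..N}. x j \<in> sphere 0 1" for N x
  proof -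
    have xs: "x j \<in> sphere 0 1" if "j \<in> {1..N}" for j using x that by blast
    define M where "M = real N powr (1 / real d)"
    have M1: "M \<ge> 1" unfolding M_def using N by (intro ge_one_powr_ge_zero) auto
    have Md: "M ^ d = real N"
      unfolding M_def using N d_ge_2 by (subst powr_realpow[symmetric]) (auto simp: powr_powr)
    define L where "L = nat \<lceil>2 * real d * M\<rceil>"
    have L_ge: "2 * real d * M \<le> real L" unfolding L_def by linarith
    have L_le: "real L \<le> 2 * real d * M + 1"
      using M1 unfolding L_def by (simp add: of_nat_nat)
    have "2 * real N \<le> dim_upto L"
    proof -
      have "2 * real N \<le> 2 ^ d * real N"
        using power_increasing[of 1 d "2::real"] d_ge_2 by (intro mult_right_mono) auto
      also have "\<dots> = (2 * M) ^ d" by (simp add: power_mult_distrib Md)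
      also have "\<dots> \<le> (real L / real d) ^ d"
        using L_ge M1 d_ge_2 by (intro power_mono) (auto simp: field_simps)
      also have "\<dots> \<le> dim_upto L"
        unfolding dim_upto_def Z_eq using d_ge_2 by (intro sum_harm_bound_ge) simp
      finally show ?thesis .
    qed
    note en = energy_sum_ge[where x=x, OF N xs this]
    define q where "q = c * (real (4 * d + 3) * M) powr (- 2 * s)"
    have q0: "q \<ge> 0" using c by (simp add: q_def)
    have aq: "q \<le> a l" if "l \<le> 2 * L" for l
    proof -
      have "1 + real l \<le> 1 + 2 * real L" using that by linarith
      also have "\<dots> \<le> 3 + 4 * real d * M" using L_le by linarith
      also have "\<dots> \<le> real (4 * d + 3) * M" using M1 by (simp add: algebra_simps)
      finally have "(real (4 * d + 3) * M) powr (- 2 * s) \<le> (1 + real l) powr (- 2 * s)"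
        using s_pos by (intro powr_mono2') auto
      then have "q \<le> c * (1 + real l) powr (- 2 * s)"
        unfolding q_def using c(1) by (intro mult_left_mono) auto
      then show ?thesis using c(2)[of l] by linarith
    qed
    have "\<beta> * real N powr (- 2 * s / real d) = q * 1"
      unfolding q_def \<beta>_def M_def using N by (simp add: powr_mult powr_powr)
    also have "\<dots> \<le> q * (\<Sum>l=1..2*L. energy N x l)" using en q0 by (intro mult_left_mono)
    also have "\<dots> \<le> (\<Sum>l=1..2*L. a l * energy N x l)"
      unfolding sum_distrib_left using aq energy_nonneg by (intro sum_mono mult_right_mono) auto
    also have "\<dots> = (\<Sum>l<2*L. a (Suc l) * energy N x (Suc l))"
      by (rule sum.reindex_bij_witness[of _ Suc "\<lambda>l. l - 1"]) auto
    also have "\<dots> \<le> (\<Sum>l. a (Suc l) * energy N x (Suc l))"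
      using a_pos energy_nonneg
      by (intro sum_le_suminf summable_energy N xs) (auto simp: less_imp_le)
    also have "\<dots> = (wce d s a Y N x)\<^sup>2"
      by (rule wce_squared[symmetric, where x=x, OF N xs])
    finally show ?thesis .
  qed
  moreover have "\<beta> > 0" using c by (simp add: \<beta>_def)
  ultimately show ?thesis by blast
qed

section \<open>Upper bound for jittered points\<close>

lemma equal_area_partition_facts:
  fixes D :: "nat \<Rightarrow> 'a set"
  assumes D: "equal_area_partition N D" and N: "1 \<le> N" and j: "j \<in> {1..N}"
  shows "D j \<in> sets sphere_measure" "measure sphere_measure (D j) = 1 / real N"
    "D j \<subseteq> sphere 0 1" "prob_space (uniform_measure sphere_measure (D j))" "\<exists>z. z \<in> D j"
proof -
  show set: "D j \<in> sets sphere_measure" and m: "measure sphere_measure (D j) = 1 / real N"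
    using D j by (auto simp: equal_area_partition_def)
  show "D j \<subseteq> sphere 0 1" using sets.sets_into_space[OF set] by simp
  have pos: "measure sphere_measure (D j) > 0" using m N by simp
  then show "\<exists>z. z \<in> D j" by (metis all_not_in_conv less_irrefl measure_empty)
  show "prob_space (uniform_measure sphere_measure (D j))"
    using pos by (intro prob_space_uniform_measure) (auto simp: measure_def)
qed

text \<open>Outside the overlaps, which are null sets, the indicators of the cells add up to 1.\<close>
lemma sum_integral_partition:
  fixes D :: "nat \<Rightarrow> 'a set" and f :: "'a \<Rightarrow> real"
  assumes D: "equal_area_partition N D" and N: "1 \<le> N" and f: "continuous_on (sphere 0 1) f"
  shows "(\<Sum>j=1..N. \<integral>z. f z \<partial>uniform_measure sphere_measure (D j)) = real N * (\<integral>z. f z \<partial>sphere_measure)"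
proof -
  interpret prob_space "sphere_measure :: 'a measure" by (rule prob_space_sphere_measure)
  note fm = continuous_on_sphere_measurable[OF f]
  note fi = integrable_continuous_on_sphere[OF f]
  note facts = equal_area_partition_facts[OF D N]
  have "(\<integral>z. f z \<partial>uniform_measure sphere_measure (D j)) = real N * (\<integral>z. indicator (D j) z * f z \<partial>sphere_measure)"
    if j: "j \<in> {1..N}" for j
    using integral_uniform_measure[OF fm facts(1)[OF j]] facts(2)[OF j] N by simp
  then have "(\<Sum>j=1..N. \<integral>z. f z \<partial>uniform_measure sphere_measure (D j))
      = real N * (\<Sum>j=1..N. \<integral>z. indicator (D j) z * f z \<partial>sphere_measure)"
    by (simp add: sum_distrib_left)
  also have "(\<Sum>j=1..N. \<integral>z. indicator (D j) z * f z \<partial>sphere_measure)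
      = (\<integral>z. (\<Sum>j=1..N. indicator (D j) z * f z) \<partial>sphere_measure)"
    by (rule Bochner_Integration.integral_sum[symmetric])
       (use facts(1) fi in \<open>auto intro!: integrable_real_mult_indicator simp: mult.commute[of "indicator _ _"]\<close>)
  also have "\<dots> = (\<integral>z. f z \<partial>sphere_measure)"
  proof (rule integral_cong_AE)
    show "(\<lambda>z. \<Sum>j=1..N. indicator (D j) z * f z) \<in> borel_measurable sphere_measure"
      using facts(1) fm by (intro borel_measurable_sum borel_measurable_times borel_measurable_indicator) auto
    show "f \<in> borel_measurable sphere_measure" by (rule fm)
    have "AE z in sphere_measure. \<forall>j\<in>{1..N}. \<forall>k\<in>{1..N}. j \<noteq> k \<longrightarrow> z \<notin> D j \<inter> D k"
    proof (intro AE_finite_allI finite_atLeastAtMost)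
      fix j k assume jk: "j \<in> {1..N}" "k \<in> {1..N}"
      show "AE z in sphere_measure. j \<noteq> k \<longrightarrow> z \<notin> D j \<inter> D k"
      proof (cases "j = k")
        case False
        then have "measure sphere_measure (D j \<inter> D k) = 0"
          using D jk by (auto simp: equal_area_partition_def)
        then have "D j \<inter> D k \<in> null_sets sphere_measure"
          using facts(1)[OF jk(1)] facts(1)[OF jk(2)] by (auto simp: null_sets_def emeasure_eq_measure)
        from AE_not_in[OF this] show ?thesis by (rule eventually_mono) simp
      qed simp
    qed
    then show "AE z in sphere_measure. (\<Sum>j=1..N. indicator (D j) z * f z) = f z"
    proof (rule AE_mp, intro AE_I2 impI)
      fix z assume z: "z \<in> space (sphere_measure :: 'a measure)"
        and disj: "\<forall>j\<in>{1..N}. \<forall>k\<in>{1..N}. j \<noteq> k \<longrightarrow> z \<notin> D j \<inter> D k"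
      have "z \<in> (\<Union>j\<in>{1..N}. D j)" using z D by (simp add: equal_area_partition_def)
      then obtain j where j: "j \<in> {1..N}" "z \<in> D j" by blast
      have "(\<Sum>k=1..N. indicator (D k) z * f z) = (\<Sum>k=1..N. if k = j then f z else 0)"
        using disj j by (intro sum.cong refl) (auto split: split_indicator)
      then show "(\<Sum>k=1..N. indicator (D k) z * f z) = f z" using j(1) by simp
    qed
  qed
  finally show ?thesis .
qed

text \<open>The variables Y l k (x j) are independent, and their means add up to a multiple of the integral of
  Y l k, which is 0. So only the variances on the cells remain. A variance is at most the second moment
  around any value: the value 0 and the addition theorem give Z l, and the value at a point of the
  cell gives the bound in terms of its diameter.\<close>
lemma expected_energy_le:
  fixes D :: "nat \<Rightarrow> 'a set"
  assumes D: "equal_area_partition N D" and N: "1 \<le> N" and l: "l \<noteq> 0"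
    and diam: "\<And>j. j \<in> {1..N} \<Longrightarrow> diameter (D j) \<le> \<delta>"
  shows "(\<integral>x. energy N x l \<partial>random_points N D) \<le> min (Z l) (deriv_bound l * \<delta>\<^sup>2) / real N"
proof -
  define \<mu> where "\<mu> j = uniform_measure sphere_measure (D j)" for j
  note facts = equal_area_partition_facts[OF D N]
  have \<mu>: "prob_space (\<mu> j)" if "j \<in> {1..N}" for j unfolding \<mu>_def by (rule facts(4)[OF that])
  have space_mu: "space (\<mu> j) = sphere 0 1" for j by (simp add: \<mu>_def)
  have meas: "f \<in> borel_measurable (\<mu> j)" if "continuous_on (sphere 0 1) f" for f :: "'a \<Rightarrow> real" and j
    using continuous_on_sphere_measurable[OF that] by (simp add: \<mu>_def)
  have int: "integrable (\<mu> j) f" if j: "j \<in> {1..N}" and f: "continuous_on (sphere 0 1) f" for f :: "'a \<Rightarrow> real" and j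
  proof -
    interpret prob_space "\<mu> j" by (rule \<mu>[OF j])
    obtain C where "\<forall>z\<in>sphere 0 1. \<bar>f z\<bar> \<le> C" using continuous_on_sphere_bounded[OF f] by blast
    then show ?thesis
      by (intro integrable_const_bound[where B=C] AE_I2 meas f) (auto simp: space_mu)
  qed
  have rp: "random_points N D = PiM {1..N} \<mu>" unfolding random_points_def \<mu>_def ..
  interpret P: prob_space "PiM {1..N} \<mu>" by (rule prob_space_PiM) (rule \<mu>)
  define m where "m k j = (\<integral>z. Y l k z \<partial>\<mu> j)" for k j
  define V where "V k j = (\<integral>z. (Y l k z - m k j)\<^sup>2 \<partial>\<mu> j)" for k j
  have msum: "(\<Sum>j=1..N. m k j) = 0" if k: "k \<in> idx l" for k
    using sum_integral_partition[OF D N continuous_Y[OF k]] integral_Y[OF k l] by (simp add: m_def \<mu>_def)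
  have second: "(\<integral>x. (qmc N x (Y l k))\<^sup>2 \<partial>PiM {1..N} \<mu>) = (\<Sum>j=1..N. V k j) / (real N)\<^sup>2"
    if k: "k \<in> idx l" for k
  proof -
    have "qmc N x (Y l k) = (\<Sum>j=1..N. Y l k (x j) - m k j) / real N" for x
      using msum[OF k] by (simp add: qmc_def sum_subtractf)
    then have "(\<integral>x. (qmc N x (Y l k))\<^sup>2 \<partial>PiM {1..N} \<mu>)
        = (\<integral>x. (\<Sum>j=1..N. Y l k (x j) - m k j)\<^sup>2 \<partial>PiM {1..N} \<mu>) / (real N)\<^sup>2"
      by (simp add: power_divide)
    also have "(\<integral>x. (\<Sum>j=1..N. Y l k (x j) - m k j)\<^sup>2 \<partial>PiM {1..N} \<mu>) = (\<Sum>j=1..N. V k j)"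
    proof -
      obtain C where C: "\<And>z. z \<in> sphere 0 1 \<Longrightarrow> \<bar>Y l k z\<bar> \<le> C"
        using continuous_on_sphere_bounded[OF continuous_Y[OF k]] by blast
      \<comment> \<open>One bound for all cells, crude but sufficient for integrability.\<close>
      let ?B = "C + (\<Sum>j=1..N. \<bar>m k j\<bar>)"
      have bd: "\<bar>Y l k z - m k j\<bar> \<le> ?B" if "j \<in> {1..N}" "z \<in> space (\<mu> j)" for j z
      proof -
        have "\<bar>m k j\<bar> \<le> (\<Sum>j=1..N. \<bar>m k j\<bar>)"
          using that by (intro member_le_sum) auto
        moreover have "\<bar>Y l k z\<bar> \<le> C" using C that by (simp add: space_mu)
        ultimately show ?thesis by linarith
      qed
      have zero: "(\<integral>z. Y l k z - m k j \<partial>\<mu> j) = 0" if j: "j \<in> {1..N}" for j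
      proof -
        interpret prob_space "\<mu> j" by (rule \<mu>[OF j])
        show ?thesis
          using int[OF j continuous_Y[OF k]] by (simp add: m_def Bochner_Integration.integral_diff prob_space)
      qed
      show ?thesis
        unfolding V_def
        using integral_PiM_square_sum[of "{1..N}" \<mu> "\<lambda>j z. Y l k z - m k j" ?B] \<mu> bd zero
        by (simp add: meas continuous_intros continuous_Y k)
    qed
    finally show ?thesis .
  qed
  have int_sq: "integrable (PiM {1..N} \<mu>) (\<lambda>x. (qmc N x (Y l k))\<^sup>2)" if k: "k \<in> idx l" for k
  proof -
    obtain C where C: "\<And>z. z \<in> sphere 0 1 \<Longrightarrow> \<bar>Y l k z\<bar> \<le> C"
      using continuous_on_sphere_bounded[OF continuous_Y[OF k]] by blast
    show ?thesis
    proof (rule P.integrable_const_bound[where B="C\<^sup>2"])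
      show "(\<lambda>x. (qmc N x (Y l k))\<^sup>2) \<in> borel_measurable (PiM {1..N} \<mu>)"
        unfolding qmc_def
        by (intro borel_measurable_power borel_measurable_times borel_measurable_const borel_measurable_sum
            measurable_PiM_coordinate[where f="Y l k"] meas continuous_Y k)
      show "AE x in PiM {1..N} \<mu>. norm ((qmc N x (Y l k))\<^sup>2) \<le> C\<^sup>2"
      proof (rule AE_I2)
        fix x assume "x \<in> space (PiM {1..N} \<mu>)"
        then have "x j \<in> sphere 0 1" if "j \<in> {1..N}" for j
          using that by (auto simp: space_PiM PiE_iff space_mu)
        then have "(Y l k (x j))\<^sup>2 \<le> C\<^sup>2" if "j \<in> {1..N}" for j
          using C that by (simp add: abs_le_square_iff[symmetric] order.trans[OF _ abs_ge_self])
        then have "(\<Sum>j=1..N. (Y l k (x j))\<^sup>2) \<le> (\<Sum>j=1..N. C\<^sup>2)" by (intro sum_mono) auto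
        then have "qmc N x (\<lambda>z. (Y l k z)\<^sup>2) \<le> C\<^sup>2" using N by (simp add: qmc_def field_simps)
        then show "norm ((qmc N x (Y l k))\<^sup>2) \<le> C\<^sup>2"
          using qmc_square_le[OF N, of x "Y l k"] by simp
      qed
    qed
  qed
  have V_le: "V k j \<le> (\<integral>z. (Y l k z - b)\<^sup>2 \<partial>\<mu> j)" if k: "k \<in> idx l" and j: "j \<in> {1..N}" for k j b
  proof -
    interpret prob_space "\<mu> j" by (rule \<mu>[OF j])
    show ?thesis unfolding V_def m_def
      by (intro variance_le_second_moment int[OF j] continuous_intros continuous_Y k)
  qed
  have sum_V: "(\<Sum>k\<in>idx l. V k j) \<le> min (Z l) (deriv_bound l * \<delta>\<^sup>2)" if j: "j \<in> {1..N}" for j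
  proof (rule min.boundedI)
    interpret prob_space "\<mu> j" by (rule \<mu>[OF j])
    have "(\<Sum>k\<in>idx l. V k j) \<le> (\<Sum>k\<in>idx l. \<integral>z. (Y l k z - 0)\<^sup>2 \<partial>\<mu> j)"
      by (intro sum_mono V_le j)
    also have "\<dots> = (\<integral>z. (\<Sum>k\<in>idx l. (Y l k z - 0)\<^sup>2) \<partial>\<mu> j)"
      by (intro Bochner_Integration.integral_sum[symmetric] int[OF j] continuous_intros continuous_Y)
    also have "\<dots> = (\<integral>z. Z l \<partial>\<mu> j)"
      by (rule Bochner_Integration.integral_cong) (auto simp: space_mu addition_theorem_diagonal)
    also have "\<dots> = Z l" using prob_space by simp
    finally show "(\<Sum>k\<in>idx l. V k j) \<le> Z l" .
    obtain y0 where y0: "y0 \<in> D j" using facts(5)[OF j] by blast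
    have Dsub: "D j \<subseteq> sphere 0 1" by (rule facts(3)[OF j])
    have "(\<Sum>k\<in>idx l. V k j) \<le> (\<Sum>k\<in>idx l. \<integral>z. (Y l k z - Y l k y0)\<^sup>2 \<partial>\<mu> j)"
      by (intro sum_mono V_le j)
    also have "\<dots> = (\<integral>z. (\<Sum>k\<in>idx l. (Y l k z - Y l k y0)\<^sup>2) \<partial>\<mu> j)"
      by (intro Bochner_Integration.integral_sum[symmetric] int[OF j] continuous_intros continuous_Y)
    also have "\<dots> \<le> (\<integral>z. deriv_bound l * \<delta>\<^sup>2 \<partial>\<mu> j)"
    proof (rule integral_mono_AE)
      show "integrable (\<mu> j) (\<lambda>z. \<Sum>k\<in>idx l. (Y l k z - Y l k y0)\<^sup>2)"
        by (intro int[OF j] continuous_intros continuous_Y)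
      show "AE z in \<mu> j. (\<Sum>k\<in>idx l. (Y l k z - Y l k y0)\<^sup>2) \<le> deriv_bound l * \<delta>\<^sup>2"
        unfolding \<mu>_def
      proof (rule AE_uniform_measureI[OF facts(1)[OF j]], intro AE_I2 impI)
        fix z assume z: "z \<in> D j"
        have "bounded (D j)" using Dsub bounded_subset[OF bounded_sphere] by blast
        then have "norm (z - y0) \<le> \<delta>"
          using diameter_bounded_bound[of "D j" z y0] z y0 diam[OF j] by (simp add: dist_norm)
        then have "(norm (z - y0))\<^sup>2 \<le> \<delta>\<^sup>2" by (intro power_mono) auto
        then have "deriv_bound l * (norm (z - y0))\<^sup>2 \<le> deriv_bound l * \<delta>\<^sup>2"
          by (intro mult_left_mono deriv_bound_nonneg)
        then show "(\<Sum>k\<in>idx l. (Y l k z - Y l k y0)\<^sup>2) \<le> deriv_bound l * \<delta>\<^sup>2"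
          using sum_difference_squares[of z y0 l] z y0 Dsub by (meson order.trans subsetD)
      qed
    qed simp
    also have "\<dots> = deriv_bound l * \<delta>\<^sup>2" using prob_space by simp
    finally show "(\<Sum>k\<in>idx l. V k j) \<le> deriv_bound l * \<delta>\<^sup>2" .
  qed
  have "(\<integral>x. energy N x l \<partial>random_points N D) = (\<Sum>k\<in>idx l. \<integral>x. (qmc N x (Y l k))\<^sup>2 \<partial>PiM {1..N} \<mu>)"
    unfolding rp energy_def by (rule Bochner_Integration.integral_sum[OF int_sq])
  also have "\<dots> = (\<Sum>k\<in>idx l. (\<Sum>j=1..N. V k j) / (real N)\<^sup>2)"
    by (intro sum.cong refl second)
  also have "\<dots> = (\<Sum>j=1..N. \<Sum>k\<in>idx l. V k j) / (real N)\<^sup>2"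
    unfolding sum_divide_distrib[symmetric] by (subst sum.swap) (rule refl)
  also have "\<dots> \<le> (\<Sum>j=1..N. min (Z l) (deriv_bound l * \<delta>\<^sup>2)) / (real N)\<^sup>2"
    by (intro divide_right_mono sum_mono sum_V) auto
  also have "\<dots> = min (Z l) (deriv_bound l * \<delta>\<^sup>2) / real N"
    using N by (simp add: power2_eq_square)
  finally show ?thesis .
qed

lemma random_points_facts:
  fixes D :: "nat \<Rightarrow> 'a set"
  assumes D: "equal_area_partition N D" and N: "1 \<le> N"
  shows "prob_space (random_points N D)"
    and "x \<in> space (random_points N D) \<Longrightarrow> j \<in> {1..N} \<Longrightarrow> x j \<in> sphere 0 1"
    and "(\<lambda>x. energy N x l) \<in> borel_measurable (random_points N D)"
proof -
  show "prob_space (random_points N D)"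
    unfolding random_points_def by (intro prob_space_PiM equal_area_partition_facts(4)[OF D N])
  show "x j \<in> sphere 0 1" if "x \<in> space (random_points N D)" "j \<in> {1..N}"
    using that by (auto simp: random_points_def space_PiM PiE_iff)
  have "Y l k \<in> borel_measurable (uniform_measure sphere_measure (D j))" if "k \<in> idx l" for k j
    using continuous_on_sphere_measurable[OF continuous_Y[OF that]] by simp
  then show "(\<lambda>x. energy N x l) \<in> borel_measurable (random_points N D)"
    unfolding random_points_def energy_def qmc_def
    by (intro borel_measurable_sum borel_measurable_power borel_measurable_times borel_measurable_const
        measurable_PiM_coordinate[where f="Y l _"])
qed

text \<open>The series of wce_squared is dominated by the convergent series of a l * Z l, so it is integrable and
  can be integrated termwise.\<close>
lemma integral_wce_squared:
  fixes D :: "nat \<Rightarrow> 'a set"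
  assumes D: "equal_area_partition N D" and N: "1 \<le> N"
  shows "integrable (random_points N D) (\<lambda>x. (wce d s a Y N x)\<^sup>2)"
    and "(\<lambda>l. a (Suc l) * (\<integral>x. energy N x (Suc l) \<partial>random_points N D))
      sums (\<integral>x. (wce d s a Y N x)\<^sup>2 \<partial>random_points N D)"
proof -
  interpret P: prob_space "random_points N D" by (rule random_points_facts(1)[OF D N])
  note pts = random_points_facts(2)[OF D N]
  let ?t = "\<lambda>l x. a (Suc l) * energy N x (Suc l)"
  have le: "norm (?t l x) \<le> a (Suc l) * Z (Suc l)" if "x \<in> space (random_points N D)" for l x
    using energy_le_Z[where x=x, OF N pts[OF that]] a_pos energy_nonneg
    by (simp add: abs_mult less_imp_le mult_left_mono)
  have it: "integrable (random_points N D) (?t l)" for l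
    by (rule P.integrable_const_bound[where B="a (Suc l) * Z (Suc l)"])
       (use le random_points_facts(3)[OF D N] in auto)
  have sZ: "summable (\<lambda>l. a (Suc l) * Z (Suc l))"
    using summable_weighted_dim by (subst summable_Suc_iff)
  have ae: "AE x in random_points N D. summable (\<lambda>l. norm (?t l x))"
  proof (rule AE_I2)
    fix x assume x: "x \<in> space (random_points N D)"
    show "summable (\<lambda>l. norm (?t l x))"
      using le[OF x] by (intro summable_comparison_test'[OF sZ]) auto
  qed
  have sn: "summable (\<lambda>l. \<integral>x. norm (?t l x) \<partial>random_points N D)"
  proof (rule summable_comparison_test'[OF sZ])
    fix l :: nat
    have "(\<integral>x. norm (?t l x) \<partial>random_points N D) \<le> (\<integral>x. a (Suc l) * Z (Suc l) \<partial>random_points N D)"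
      using le by (intro integral_mono integrable_norm it) auto
    then show "norm (\<integral>x. norm (?t l x) \<partial>random_points N D) \<le> a (Suc l) * Z (Suc l)"
      by (simp add: P.prob_space)
  qed
  have eq: "(wce d s a Y N x)\<^sup>2 = (\<Sum>l. ?t l x)" if "x \<in> space (random_points N D)" for x
    by (rule wce_squared[where x=x, OF N pts[OF that]])
  show "integrable (random_points N D) (\<lambda>x. (wce d s a Y N x)\<^sup>2)"
    using integrable_suminf[OF it ae sn] eq by (subst Bochner_Integration.integrable_cong[OF refl]) auto
  have "(\<integral>x. (wce d s a Y N x)\<^sup>2 \<partial>random_points N D) = (\<integral>x. (\<Sum>l. ?t l x) \<partial>random_points N D)"
    using eq by (intro Bochner_Integration.integral_cong) auto
  then show "(\<lambda>l. a (Suc l) * (\<integral>x. energy N x (Suc l) \<partial>random_points N D))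
      sums (\<integral>x. (wce d s a Y N x)\<^sup>2 \<partial>random_points N D)"
    using sums_integral[OF it ae sn] by simp
qed

lemma deriv_bound_le: "deriv_bound l \<le> Z l * (real (Suc d) * (1 + real l)\<^sup>2)"
  unfolding deriv_bound_def
proof (intro mult_left_mono Z_nonneg)
  have "real l * (2 * real l + real d - 1) \<le> (1 + real l) * (real (Suc d) * (1 + real l))"
    using d_ge_2 mult_right_mono[of 1 "real d" "real l"] by (intro mult_mono) (auto simp: algebra_simps)
  then show "real l * (2 * real l + real d - 1) \<le> real (Suc d) * (1 + real l)\<^sup>2"
    by (simp add: power2_eq_square algebra_simps)
qed

text \<open>With e = 2 s - d, the estimates for a l * Z l and for the expected energies bring the series of
  integral_wce_squared into the form of truncated_power_sum.\<close>
lemma expected_wce_upper_bound: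
  assumes s_lt: "s < real d / 2 + 1" and c: "0 < c"
  shows "\<exists>B>0. \<forall>N\<ge>1. \<forall>D :: nat \<Rightarrow> 'a set. equal_area_partition N D \<longrightarrow>
     (\<forall>j\<in>{1..N}. diameter (D j) \<le> c / real N powr (1 / real d)) \<longrightarrow>
     (\<integral>x. (wce d s a Y N x)\<^sup>2 \<partial>random_points N D) \<le> B * real N powr (- 2 * s / real d)"
proof -
  define e where "e = 2 * s - real d"
  have e: "0 < e" "e < 2" using s_gt s_lt by (simp_all add: e_def)
  obtain A where A: "A > 0" "\<And>l. a l * Z l \<le> A * (1 + real l) powr (real d - 1 - 2 * s)"
    using weighted_dim_upper by blast
  obtain K where K: "K > 0" "\<And>M m. M \<ge> 1 \<Longrightarrow>
      (\<Sum>n=1..m. real n powr (- 1 - e) * min 1 ((real n / M)\<^sup>2)) \<le> K * M powr (- e)"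
    using truncated_power_sum[OF e] by blast
  \<comment> \<open>The maximum with 1 lets one factor serve both arguments of the minimum.\<close>
  define q where "q = max 1 (real (Suc d) * c\<^sup>2)"
  have q: "q \<ge> 1" by (simp add: q_def)
  have "(\<integral>x. (wce d s a Y N x)\<^sup>2 \<partial>random_points N D) \<le> (A * q * K) * real N powr (- 2 * s / real d)"
    if N: "1 \<le> N" and D: "equal_area_partition N D"
      and diam: "\<forall>j\<in>{1..N}. diameter (D j) \<le> c / real N powr (1 / real d)" for N and D :: "nat \<Rightarrow> 'a set"
  proof -
    define M where "M = real N powr (1 / real d)"
    have M1: "M \<ge> 1" unfolding M_def using N by (intro ge_one_powr_ge_zero) auto
    let ?t = "\<lambda>l. a (Suc l) * (\<integral>x. energy N x (Suc l) \<partial>random_points N D)"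
    let ?u = "\<lambda>n. real n powr (- 1 - e) * min 1 ((real n / M)\<^sup>2)"
    \<comment> \<open>The estimates are in terms of 1 + m for the degree m = l + 1, hence the shift by 2.\<close>
    have term_le: "?t l \<le> A * q / real N * ?u (l + 2)" for l
    proof -
      define m where "m = Suc l"
      have "(\<integral>x. energy N x m \<partial>random_points N D) \<le> min (Z m) (deriv_bound m * (c / M)\<^sup>2) / real N"
        unfolding M_def using diam by (intro expected_energy_le[OF D N]) (auto simp: m_def)
      also have "\<dots> \<le> Z m * (q * min 1 (((1 + real m) / M)\<^sup>2)) / real N"
      proof (intro divide_right_mono)
        have "deriv_bound m * (c / M)\<^sup>2 \<le> Z m * (real (Suc d) * (1 + real m)\<^sup>2) * (c / M)\<^sup>2"
          by (intro mult_right_mono deriv_bound_le) simp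
        also have "\<dots> = Z m * ((real (Suc d) * c\<^sup>2) * ((1 + real m) / M)\<^sup>2)"
          by (simp add: power_divide)
        also have "\<dots> \<le> Z m * (q * ((1 + real m) / M)\<^sup>2)"
          by (intro mult_left_mono mult_right_mono Z_nonneg) (auto simp: q_def)
        finally have 1: "deriv_bound m * (c / M)\<^sup>2 \<le> Z m * (q * ((1 + real m) / M)\<^sup>2)" .
        have 2: "Z m \<le> Z m * (q * 1)"
          using mult_left_mono[OF q Z_nonneg[of m]] by simp
        show "min (Z m) (deriv_bound m * (c / M)\<^sup>2) \<le> Z m * (q * min 1 (((1 + real m) / M)\<^sup>2))"
          using 1 2 by (cases "1 \<le> ((1 + real m) / M)\<^sup>2") (auto simp: min_def)
      qed simp
      finally have "a m * (\<integral>x. energy N x m \<partial>random_points N D)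
          \<le> a m * (Z m * (q * min 1 (((1 + real m) / M)\<^sup>2)) / real N)"
        using a_pos[of m] by (intro mult_left_mono) auto
      also have "\<dots> = (a m * Z m) * (q * min 1 (((1 + real m) / M)\<^sup>2) / real N)" by simp
      also have "\<dots> \<le> (A * (1 + real m) powr (real d - 1 - 2 * s)) * (q * min 1 (((1 + real m) / M)\<^sup>2) / real N)"
        using A q by (intro mult_right_mono) auto
      also have "real d - 1 - 2 * s = - 1 - e" by (simp add: e_def)
      also have "(A * (1 + real m) powr (- 1 - e)) * (q * min 1 (((1 + real m) / M)\<^sup>2) / real N)
          = A * q / real N * ?u (l + 2)"
        by (simp add: m_def algebra_simps)
      finally show ?thesis by (simp only: m_def)
    qed
    note sums = integral_wce_squared(2)[OF D N]
    have "(\<integral>x. (wce d s a Y N x)\<^sup>2 \<partial>random_points N D) = suminf ?t"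
      using sums by (rule sums_unique)
    also have "\<dots> \<le> A * q / real N * (K * M powr (- e))"
    proof (rule suminf_le_const[OF sums_summable[OF sums]])
      fix n
      have "(\<Sum>l<n. ?t l) \<le> A * q / real N * (\<Sum>l<n. ?u (l + 2))"
        unfolding sum_distrib_left by (intro sum_mono term_le)
      also have "(\<Sum>l<n. ?u (l + 2)) = (\<Sum>k=2..n+1. ?u k)"
        by (rule sum.reindex_bij_witness[of _ "\<lambda>k. k - 2" "\<lambda>l. l + 2"]) auto
      also have "A * q / real N * (\<Sum>k=2..n+1. ?u k) \<le> A * q / real N * (\<Sum>k=1..n+1. ?u k)"
        using A q by (intro mult_left_mono sum_mono2) auto
      also have "\<dots> \<le> A * q / real N * (K * M powr (- e))"
        using A q by (intro mult_left_mono K(2)[OF M1]) auto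
      finally show "(\<Sum>l<n. ?t l) \<le> A * q / real N * (K * M powr (- e))" .
    qed
    also have "\<dots> = (A * q * K) * (real N powr (- 1) * M powr (- e))"
      using N by (simp add: powr_minus divide_inverse)
    also have "real N powr (- 1) * M powr (- e) = real N powr (- 2 * s / real d)"
    proof -
      have "- 1 + 1 / real d * (- e) = - 2 * s / real d"
        using d_ge_2 by (simp add: e_def field_simps)
      then show ?thesis unfolding M_def powr_powr powr_add[symmetric] by simp
    qed
    finally show ?thesis .
  qed
  moreover have "A * q * K > 0" using A q K by simp
  ultimately show ?thesis by blast
qed

end

theorem theorem24:
  fixes d :: nat and s :: real and a :: "nat \<Rightarrow> real"
    and Y :: "nat \<Rightarrow> nat \<Rightarrow> 'a::euclidean_space \<Rightarrow> real"
  assumes "DIM('a) = d + 1" and "2 \<le> d"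
    and "real d / 2 < s" and "s < real d / 2 + 1"
    and "harmonic_family d Y"
    and "\<And>l. 0 < a l"
    and "comparable a (\<lambda>l. (1 + eigval d l) powr (- s))"
  shows "\<exists>\<beta>'>0. \<forall>(D :: nat \<Rightarrow> nat \<Rightarrow> 'a set) (c :: real).
           0 < c \<and>
           (\<forall>N\<ge>1. equal_area_partition N (D N) \<and>
                   (\<forall>j\<in>{1..N}. diameter (D N j) \<le> c / real N powr (1 / real d)))
           \<longrightarrow> (\<exists>\<beta>>0. \<forall>N\<ge>1.
                 \<beta>' / real N powr (s / real d)
                   \<le> sqrt (\<integral>x. (wce d s a Y N x)\<^sup>2 \<partial>random_points N (D N)) \<and>
                 sqrt (\<integral>x. (wce d s a Y N x)\<^sup>2 \<partial>random_points N (D N))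
                   \<le> \<beta> / real N powr (s / real d))"
proof -
  interpret sobolev_setting d Y s a
    using assms by unfold_locales auto
  obtain b where b: "b > 0" and lower: "\<And>N x. N \<ge> 1 \<Longrightarrow> \<forall>j\<in>{1..N}. x j \<in> sphere 0 1 \<Longrightarrow>
      b * real N powr (- 2 * s / real d) \<le> (wce d s a Y N x)\<^sup>2"
    using wce_lower_bound by blast
  have sqrt_eq: "sqrt (C * real N powr (- 2 * s / real d)) = sqrt C / real N powr (s / real d)"
    if "N \<ge> 1" for C :: real and N :: nat
  proof -
    have "real N powr (- 2 * s / real d) = (real N powr (- (s / real d)))\<^sup>2"
      using that by (simp add: power2_eq_square powr_add[symmetric])
    then show ?thesis
      by (simp only: real_sqrt_mult real_sqrt_abs) (simp add: powr_minus divide_inverse)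
  qed
  show ?thesis
  proof (rule exI[of _ "sqrt b"], intro conjI allI impI)
    show "0 < sqrt b" using b by simp
    fix D :: "nat \<Rightarrow> nat \<Rightarrow> 'a set" and c :: real
    assume D: "0 < c \<and> (\<forall>N\<ge>1. equal_area_partition N (D N) \<and>
        (\<forall>j\<in>{1..N}. diameter (D N j) \<le> c / real N powr (1 / real d)))"
    then obtain B where B: "B > 0" and upper: "\<And>N. N \<ge> 1 \<Longrightarrow>
        (\<integral>x. (wce d s a Y N x)\<^sup>2 \<partial>random_points N (D N)) \<le> B * real N powr (- 2 * s / real d)"
      using expected_wce_upper_bound[OF \<open>s < real d / 2 + 1\<close>, of c] by blast
    show "\<exists>\<beta>>0. \<forall>N\<ge>1.
        sqrt b / real N powr (s / real d) \<le> sqrt (\<integral>x. (wce d s a Y N x)\<^sup>2 \<partial>random_points N (D N)) \<and>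
        sqrt (\<integral>x. (wce d s a Y N x)\<^sup>2 \<partial>random_points N (D N)) \<le> \<beta> / real N powr (s / real d)"
    proof (rule exI[of _ "sqrt B"], intro conjI allI impI)
      show "0 < sqrt B" using B by simp
      fix N :: nat assume N: "1 \<le> N"
      then have part: "equal_area_partition N (D N)" using D by blast
      interpret P: prob_space "random_points N (D N)" by (rule random_points_facts(1)[OF part N])
      have "(\<integral>x. b * real N powr (- 2 * s / real d) \<partial>random_points N (D N))
          \<le> (\<integral>x. (wce d s a Y N x)\<^sup>2 \<partial>random_points N (D N))"
        using random_points_facts(2)[OF part N]
        by (intro integral_mono integral_wce_squared(1)[OF part N] lower N) auto
      then have "b * real N powr (- 2 * s / real d) \<le> (\<integral>x. (wce d s a Y N x)\<^sup>2 \<partial>random_points N (D N))"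
        by (simp add: P.prob_space)
      then show "sqrt b / real N powr (s / real d) \<le> sqrt (\<integral>x. (wce d s a Y N x)\<^sup>2 \<partial>random_points N (D N))"
        unfolding sqrt_eq[OF N, symmetric] by simp
      show "sqrt (\<integral>x. (wce d s a Y N x)\<^sup>2 \<partial>random_points N (D N)) \<le> sqrt B / real N powr (s / real d)"
        unfolding sqrt_eq[OF N, symmetric] using upper[OF N] by simp
    qed
  qed
qed

end
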